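(* Let $\mathcal P=\{(p_j,m_j)\}$ be an appropriate power set, $u\in\mathcal S_{\mathcal P}(\mathbb R_+)$ with expansion coefficients $a_{jk}$ at $0$, and let $\chi\in C^\infty(\mathbb R)$ equal $1$ on $[-1,\infty)$ and $0$ on $(-\infty,-2]$. For $\mathrm{Im}\,\zeta<0$ put $h(\zeta)=(2\pi)^{-1/2}\langle e_+u,\chi(x)e^{-ix\zeta}\rangle$. Then: (i) $h$ is holomorphic on $\mathbb C_-=\{\mathrm{Im}\,\zeta<0\}$ and $h(\cdot-i\eta)\to\mathcal F[e_+u]$ in $\mathcal S'(\mathbb R)$ as $\eta\to0^+$; (ii) there are $C>0$ and $M\in\mathbb N$ with $|h(\zeta)|\le C(1+|\zeta|)^M$ for all $\zeta\in\mathbb C_-$; (iii) if $m_j=0$ for all $j$ (so $a_{j}:=a_{j0}$), then for every $N\in\mathbb N$, as $|\xi|\to\infty$, $$\mathcal F[e_+u](\xi)=\sum_{j=0}^Na_j\frac{\Gamma(p_j+1)}{\sqrt{2\pi}}e^{-i\pi(p_j+1)/2}(\xi-i0)^{-p_j-1}+O(|\xi|^{-\mathrm{Re}\,p_{N+1}-1}),$$ where for $\xi\neq0$, $(\xi-i0)^{b}$ equals $\xi^b$ if $\xi>0$ and $e^{-i\pi b}|\xi|^b$ if $\xi<0$; equivalently the coefficient $c_j^-$ of $|\xi|^{-p_j-1}$ for $\xi\to-\infty$ is $e^{i\pi(p_j+1)}$ times the coefficient $c_j^+$ of $\xi^{-p_j-1}$ for $\xi\to+\infty$.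
   Context: $\mathcal F[u](\xi)=(2\pi)^{-1/2}\int e^{-ix\xi}u(x)dx$, extended to $\mathcal S'(\mathbb R)$ by duality. A power set is $\mathcal P=\{(p_j,m_j)\}_{j\in\mathbb N}\subset\mathbb C\times\mathbb N$ with pairwise distinct $p_j$, $\mathrm{Re}\,p_j\le\mathrm{Re}\,p_{j+1}$, $\mathrm{Re}\,p_j\to\infty$, $0\le m_j\le m$ for a fixed $m$; appropriate if every $n\in\mathbb N$ is some $p_j$ and no $p_j$ is a negative integer. With $\omega$ a cut-off function (smooth, compactly supported, values in $[0,1]$, nonincreasing on $[0,\infty)$, $=1$ near $0$), $\mathcal S_{\mathcal P}(\mathbb R_+)$ is the set of $u\in C^\infty((0,\infty))$ such that $(1-\omega)u$ extended by $0$ lies in $\mathcal S(\mathbb R)$ and there are $a_{jk}$ with $\partial_x^l(u-\sum_{j\le N}\sum_{k\le m_j}a_{jk}x^{p_j}\ln^kx)=O(x^{\mathrm{Re}\,p_{N+1}-l}|\ln x|^m)$ as $x\to0^+$ for all $N,l$. $e_+u\in\mathcal S'(\mathbb R)$ is the extension of $u$ supported in $[0,\infty)$ given by $e_+u=\sum_{j\le N}\sum_ka_{jk}\,\omega x^{p_j}_+\ln^kx_++r_N$ for $N$ with $\mathrm{Re}\,p_{N+1}>-1$, where $r_N$ is the zero extension of $u-\omega\sum_{j\le N}\sum_ka_{jk}x^{p_j}\ln^kx$, $x^a_+$ is the analytic continuation in $a$ of $\varphi\mapsto\int_0^\infty x^a\varphi\,dx$, and $x^a_+\ln^kx_+:=\partial_a^kx^a_+$.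 *)

theory Defs
  imports "HOL-Analysis.Analysis"
begin

definition vd :: "(real \<Rightarrow> 'a::real_normed_vector) \<Rightarrow> real \<Rightarrow> 'a" where
  "vd f = (\<lambda>x. vector_derivative f (at x))"

definition Cinf_on :: "real set \<Rightarrow> (real \<Rightarrow> 'a::real_normed_vector) \<Rightarrow> bool" where
  "Cinf_on S f \<longleftrightarrow> (\<forall>k. \<forall>x\<in>S. ((vd ^^ k) f) differentiable (at x))"

definition schwartz :: "(real \<Rightarrow> complex) \<Rightarrow> bool" where
  "schwartz f \<longleftrightarrow> Cinf_on UNIV f \<and>
     (\<forall>k l. \<exists>C. \<forall>x. \<bar>x\<bar> ^ k * norm ((vd ^^ l) f x) \<le> C)"

definition cutoff :: "(real \<Rightarrow> real) \<Rightarrow> bool" where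
  "cutoff w \<longleftrightarrow> Cinf_on UNIV w \<and> (\<exists>R. \<forall>x. R \<le> \<bar>x\<bar> \<longrightarrow> w x = 0)
     \<and> (\<forall>x. 0 \<le> w x \<and> w x \<le> 1)
     \<and> (\<forall>x y. 0 \<le> x \<longrightarrow> x \<le> y \<longrightarrow> w y \<le> w x)
     \<and> (\<exists>e>0. \<forall>x. \<bar>x\<bar> < e \<longrightarrow> w x = 1)"

definition power_set :: "(nat \<Rightarrow> complex) \<Rightarrow> (nat \<Rightarrow> nat) \<Rightarrow> nat \<Rightarrow> bool" where
  "power_set p m mm \<longleftrightarrow> inj p \<and> (\<forall>j. Re (p j) \<le> Re (p (Suc j)))
     \<and> filterlim (\<lambda>j. Re (p j)) at_top sequentially \<and> (\<forall>j. m j \<le> mm)"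

definition appropriate :: "(nat \<Rightarrow> complex) \<Rightarrow> bool" where
  "appropriate p \<longleftrightarrow> (\<forall>n::nat. \<exists>j. p j = of_nat n) \<and> (\<forall>j n. p j \<noteq> - of_nat (Suc n))"

definition logpow :: "complex \<Rightarrow> nat \<Rightarrow> real \<Rightarrow> complex" where
  "logpow q k x = (complex_of_real x) powr q * (complex_of_real (ln x)) ^ k"

definition expsum :: "(nat \<Rightarrow> complex) \<Rightarrow> (nat \<Rightarrow> nat) \<Rightarrow> (nat \<Rightarrow> nat \<Rightarrow> complex) \<Rightarrow> nat \<Rightarrow> real \<Rightarrow> complex" where
  "expsum p m a N x = (\<Sum>j\<le>N. \<Sum>k\<le>m j. a j k * logpow (p j) k x)"

definition SP :: "(nat \<Rightarrow> complex) \<Rightarrow> (nat \<Rightarrow> nat) \<Rightarrow> nat \<Rightarrow> (real \<Rightarrow> real) \<Rightarrow> (real \<Rightarrow> complex)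
                  \<Rightarrow> (nat \<Rightarrow> nat \<Rightarrow> complex) \<Rightarrow> bool" where
  "SP p m mm w u a \<longleftrightarrow> Cinf_on {0<..} u
     \<and> schwartz (\<lambda>x. if 0 < x then (1 - w x) *\<^sub>R u x else 0)
     \<and> (\<forall>N l. \<exists>C. eventually (\<lambda>x. norm ((vd ^^ l) (\<lambda>y. u y - expsum p m a N y) x)
              \<le> C * x powr (Re (p (Suc N)) - real l) * \<bar>ln x\<bar> ^ mm) (at_right 0))"

definition neg_ints :: "complex set" where
  "neg_ints = {- of_nat (Suc n) | n. True}"

text \<open>Analytic continuation in a of phi |-> int_0^infty x^a phi(x) dx to C minus {-1,-2,...}
  (set to 0 at the poles to make it unique).\<close>
definition xplus :: "(real \<Rightarrow> complex) \<Rightarrow> complex \<Rightarrow> complex" where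
  "xplus \<phi> = (THE F. F holomorphic_on (- neg_ints) \<and> (\<forall>b\<in>neg_ints. F b = 0)
      \<and> (\<forall>b. -1 < Re b \<longrightarrow> F b = (LBINT x:{0<..}. (complex_of_real x) powr b * \<phi> x)))"

text \<open>pairing of x_+^a ln^k x_+ := d^k/da^k x_+^a with phi\<close>
definition xplus_log :: "(real \<Rightarrow> complex) \<Rightarrow> nat \<Rightarrow> complex \<Rightarrow> complex" where
  "xplus_log \<phi> k = (deriv ^^ k) (xplus \<phi>)"

definition eplus :: "(nat \<Rightarrow> complex) \<Rightarrow> (nat \<Rightarrow> nat) \<Rightarrow> (nat \<Rightarrow> nat \<Rightarrow> complex) \<Rightarrow> (real \<Rightarrow> real)
                     \<Rightarrow> (real \<Rightarrow> complex) \<Rightarrow> (real \<Rightarrow> complex) \<Rightarrow> complex" where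
  "eplus p m a w u \<phi> = (let N = (LEAST N. -1 < Re (p (Suc N))) in
     (\<Sum>j\<le>N. \<Sum>k\<le>m j. a j k * xplus_log (\<lambda>x. w x *\<^sub>R \<phi> x) k (p j))
     + (LBINT x:{0<..}. (u x - w x *\<^sub>R expsum p m a N x) * \<phi> x))"

definition fourier :: "(real \<Rightarrow> complex) \<Rightarrow> real \<Rightarrow> complex" where
  "fourier \<phi> \<xi> = complex_of_real (1 / sqrt (2 * pi)) *
     (LBINT x. exp (- \<i> * complex_of_real x * complex_of_real \<xi>) * \<phi> x)"

definition FT :: "((real \<Rightarrow> complex) \<Rightarrow> complex) \<Rightarrow> (real \<Rightarrow> complex) \<Rightarrow> complex" where
  "FT T \<phi> = T (fourier \<phi>)"

definition mi0pow :: "real \<Rightarrow> complex \<Rightarrow> complex" where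
  "mi0pow \<xi> b = (if 0 < \<xi> then (complex_of_real \<xi>) powr b
                 else exp (- \<i> * complex_of_real pi * b) * (complex_of_real \<bar>\<xi>\<bar>) powr b)"

end

theory Submission
  imports Defs "HOL-Complex_Analysis.Complex_Analysis" "HOL-Real_Asymp.Real_Asymp" "HOL-Probability.Sinc_Integral"
begin

text \<open>
  Integrating by parts in the analytically continued pairings with \<open>x\<^sub>+\<^sup>q ln\<^sup>k x\<^sub>+\<close> shows that the extension is
  a finite sum \<open>\<phi> \<mapsto> \<Sum>\<^sub>l \<integral>\<^sub>0\<^sup>\<infinity> G\<^sub>l \<phi>\<^sup>(\<^sup>l\<^sup>)\<close> with integrable \<open>G\<^sub>l\<close>. Pairing it with \<open>exp (-x z)\<close> gives
  \<open>H z = \<Sum>\<^sub>l (-z)\<^sup>l \<integral>\<^sub>0\<^sup>\<infinity> G\<^sub>l(x) exp (-x z) dx\<close>, which is holomorphic for \<open>Re z > 0\<close>, continuous and of polynomial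
  growth for \<open>Re z \<ge> 0\<close>. Since \<open>h \<zeta> = (2\<pi>)\<^sup>-\<^sup>1\<^sup>/\<^sup>2 H (\<i>\<zeta>)\<close>, dominated convergence and Fubini's theorem give (i) and
  (ii), and the Fourier transform is the continuous function \<open>(2\<pi>)\<^sup>-\<^sup>1\<^sup>/\<^sup>2 H (\<i>\<xi>)\<close>.

  For (iii), analytic continuation in \<open>q\<close> of the Gamma integral shows that for \<open>Re z > 0\<close> the term \<open>\<omega> x\<^sub>+\<^sup>q\<close>
  contributes \<open>\<Gamma>(q+1) z\<^sup>-\<^sup>q\<^sup>-\<^sup>1\<close> minus the Laplace transform of \<open>(1-\<omega>) x\<^sup>q\<close>. The latter, as well as the Laplace
  transform of a sufficiently flat remainder, is \<open>O(|z|\<^sup>-\<^sup>K)\<close> by integration by parts, uniformly in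
  \<open>Re z > 0\<close>; letting \<open>z \<rightarrow> \<i>\<xi>\<close> yields the expansion.
\<close>

section \<open>Iterated derivatives on open sets\<close>

text \<open>Three obstacles shape the proof. \<open>xplus\<close> is a definite description, so each
  concrete value needs the identity theorem on the connected complement of \<open>neg_ints\<close>.
  Exponentials on the imaginary axis do not decay, so the extension is put in a form that asks test
  functions only for bounded derivatives on \<open>x > 0\<close>; this covers exponentials and
  Fourier transforms alike. And \<open>eplus\<close> fixes one truncation index while (iii) needs
  every length: beyond that index the expansion is lengthened by trading part of the remainder for a
  convergent integral.

  Claim (iii) is first proved off the imaginary axis because the removed part of a power need not be
  integrable, so its Laplace integral is available only for Re z > 0. The constants there do not
  depend on Re z, and continuity of \<open>H\<close> carries the bounds to the axis. Integration by
  parts yields only integer orders, so a longer sum is taken with an order beyond the wanted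
  exponent, and the surplus terms are absorbed in the error.\<close>

lemma Cinf_on_derivative:
  assumes "Cinf_on S f" "x \<in> S"
  shows "((vd ^^ k) f has_vector_derivative (vd ^^ Suc k) f x) (at x)"
  using assms by (simp add: Cinf_on_def vd_def vector_derivative_works)

text \<open>\<open>vd\<close> is total and carries no information about differentiability, so
  iterated derivatives are computed by exhibiting a whole sequence \<open>D\<close>. Openness of
  \<open>S\<close> matters: the induction step replaces \<open>(vd ^^ k) f\<close> by
  \<open>D k\<close> near \<open>x\<close>, not only at \<open>x\<close>.\<close>

lemma vd_funpow_eqI:
  assumes "open S" "x \<in> S"
    and "\<And>x. x \<in> S \<Longrightarrow> D 0 x = f x"
    and "\<And>k x. x \<in> S \<Longrightarrow> (D k has_vector_derivative D (Suc k) x) (at x)"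
  shows "(vd ^^ k) f x = D k x"
  using \<open>x \<in> S\<close>
proof (induction k arbitrary: x)
  case 0
  then show ?case using assms(3) by simp
next
  case (Suc k)
  have "((vd ^^ k) f has_vector_derivative D (Suc k) x) (at x)"
    by (rule has_vector_derivative_transform_within_open[OF assms(4)[OF Suc.prems] assms(1) Suc.prems])
       (simp add: Suc.IH)
  then show ?case unfolding funpow.simps o_def vd_def[of "(vd ^^ k) f"] by (rule vector_derivative_at)
qed

lemma Cinf_onI:
  assumes "open S"
    and "\<And>x. x \<in> S \<Longrightarrow> D 0 x = f x"
    and "\<And>k x. x \<in> S \<Longrightarrow> (D k has_vector_derivative D (Suc k) x) (at x)"
  shows "Cinf_on S f"
  unfolding Cinf_on_def
proof (intro allI ballI)
  fix k x assume x: "x \<in> S"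
  have "((vd ^^ k) f has_vector_derivative D (Suc k) x) (at x)"
    by (rule has_vector_derivative_transform_within_open[OF assms(3)[OF x] assms(1) x])
       (simp add: vd_funpow_eqI[OF assms(1) _ assms(2,3)])
  then show "(vd ^^ k) f differentiable at x"
    by (rule differentiableI_vector)
qed

lemma Cinf_on_subset: "Cinf_on S f \<Longrightarrow> T \<subseteq> S \<Longrightarrow> Cinf_on T f"
  by (auto simp: Cinf_on_def)

lemma Cinf_on_continuous:
  assumes "Cinf_on S f"
  shows "continuous_on S ((vd ^^ k) f)"
  using Cinf_on_derivative[OF assms]
  by (meson continuous_at_imp_continuous_on has_vector_derivative_continuous)

lemma vd_funpow_cong:
  assumes "Cinf_on S f" "open S" "x \<in> S" "\<And>x. x \<in> S \<Longrightarrow> f x = g x"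
  shows "(vd ^^ k) g x = (vd ^^ k) f x"
  by (rule vd_funpow_eqI[OF assms(2,3)]) (auto simp: assms Cinf_on_derivative[OF assms(1), simplified])

lemma Cinf_on_of_real:
  fixes f :: "real \<Rightarrow> real"
  assumes "Cinf_on S f" "open S"
  shows "Cinf_on S (\<lambda>x. complex_of_real (f x))"
  by (rule Cinf_onI[OF assms(2), of "\<lambda>k x. of_real ((vd ^^ k) f x)"])
     (auto intro!: has_vector_derivative_of_real
        simp: has_real_derivative_iff_has_vector_derivative Cinf_on_derivative[OF assms(1), simplified])

lemma Cinf_on_diff:
  assumes "Cinf_on S f" "Cinf_on S g" "open S"
  shows "Cinf_on S (\<lambda>x. f x - g x)"
  by (rule Cinf_onI[OF assms(3), of "\<lambda>k x. (vd ^^ k) f x - (vd ^^ k) g x"])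
     (use assms Cinf_on_derivative[OF assms(1)] Cinf_on_derivative[OF assms(2)] in
       \<open>auto intro!: has_vector_derivative_diff\<close>)

lemma Cinf_on_sum:
  assumes "\<And>i. i \<in> I \<Longrightarrow> Cinf_on S (f i)" "open S"
  shows "Cinf_on S (\<lambda>x. \<Sum>i\<in>I. f i x)"
  by (rule Cinf_onI[OF assms(2), of "\<lambda>k x. \<Sum>i\<in>I. (vd ^^ k) (f i) x"])
     (use Cinf_on_derivative[OF assms(1)] in \<open>auto intro!: has_vector_derivative_sum\<close>)

lemma Cinf_on_const: "open S \<Longrightarrow> Cinf_on S (\<lambda>x. c)"
  by (rule Cinf_onI[of _ "\<lambda>k x. if k = 0 then c else 0"]) auto

text \<open>Induction step of the Leibniz rule, in the shape that termwise differentiation of the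
  k-th sum produces: an index shift and Pascal's rule merge the two halves.\<close>

lemma leibniz_sum_Suc:
  fixes A B :: "nat \<Rightarrow> 'a::comm_ring_1"
  shows "(\<Sum>i\<le>k. of_nat (k choose i) * (A i * B (Suc (k - i)) + A (Suc i) * B (k - i)))
    = (\<Sum>i\<le>Suc k. of_nat (Suc k choose i) * (A i * B (Suc k - i)))"
proof -
  have "(\<Sum>i\<le>Suc k. of_nat (Suc k choose i) * (A i * B (Suc k - i)))
     = A 0 * B (Suc k) + (\<Sum>i\<le>k. of_nat (Suc k choose Suc i) * (A (Suc i) * B (k - i)))"
    by (subst sum.atMost_Suc_shift) simp
  also have "(\<Sum>i\<le>k. of_nat (Suc k choose Suc i) * (A (Suc i) * B (k - i)))
     = (\<Sum>i\<le>k. of_nat (k choose i) * (A (Suc i) * B (k - i)))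
       + (\<Sum>i\<le>k. of_nat (k choose Suc i) * (A (Suc i) * B (k - i)))"
    by (simp add: sum.distrib[symmetric] algebra_simps)
  \<comment> \<open>The term \<open>i = k\<close> has coefficient \<open>k choose Suc k = 0\<close>;
    without it \<open>k - Suc i\<close> is a genuine subtraction.\<close>
  also have "(\<Sum>i\<le>k. of_nat (k choose Suc i) * (A (Suc i) * B (k - i)))
     = (\<Sum>i<k. of_nat (k choose Suc i) * (A (Suc i) * B (Suc (k - Suc i))))"
    by (subst lessThan_Suc_atMost[symmetric])
       (simp add: Suc_diff_Suc binomial_eq_0)
  also have "A 0 * B (Suc k) + ((\<Sum>i\<le>k. of_nat (k choose i) * (A (Suc i) * B (k - i))) + \<dots>)
     = (\<Sum>i\<le>k. of_nat (k choose i) * (A (Suc i) * B (k - i))) +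
       (\<Sum>i<Suc k. of_nat (k choose i) * (A i * B (Suc (k - i))))"
    by (subst sum.lessThan_Suc_shift) simp
  finally show ?thesis
    by (simp add: sum.distrib distrib_left lessThan_Suc_atMost)
qed

lemma
  fixes f g :: "real \<Rightarrow> complex"
  assumes f: "Cinf_on S f" and g: "Cinf_on S g" and S: "open S"
  shows Cinf_on_mult: "Cinf_on S (\<lambda>x. f x * g x)"
    and vd_funpow_mult: "x \<in> S \<Longrightarrow> (vd ^^ k) (\<lambda>x. f x * g x) x
      = (\<Sum>i\<le>k. of_nat (k choose i) * ((vd ^^ i) f x * (vd ^^ (k - i)) g x))"
proof -
  define D where "D k x = (\<Sum>i\<le>k. of_nat (k choose i) * ((vd ^^ i) f x * (vd ^^ (k - i)) g x))" for k x
  have D: "(D k has_vector_derivative D (Suc k) x) (at x)" if "x \<in> S" for k x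
  proof -
    have "(D k has_vector_derivative (\<Sum>i\<le>k. of_nat (k choose i) *
        ((vd ^^ i) f x * (vd ^^ Suc (k - i)) g x + (vd ^^ Suc i) f x * (vd ^^ (k - i)) g x))) (at x)"
      unfolding D_def
      by (intro has_vector_derivative_sum has_vector_derivative_mult_right has_vector_derivative_mult
            Cinf_on_derivative[OF f that] Cinf_on_derivative[OF g that])
    also have "(\<Sum>i\<le>k. of_nat (k choose i) *
        ((vd ^^ i) f x * (vd ^^ Suc (k - i)) g x + (vd ^^ Suc i) f x * (vd ^^ (k - i)) g x)) = D (Suc k) x"
      unfolding D_def by (rule leibniz_sum_Suc[of k "\<lambda>i. (vd ^^ i) f x" "\<lambda>i. (vd ^^ i) g x"])
    finally show ?thesis .
  qed
  show "Cinf_on S (\<lambda>x. f x * g x)"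
    by (rule Cinf_onI[where D=D, OF S _ D]) (simp add: D_def)
  show "(vd ^^ k) (\<lambda>x. f x * g x) x
      = (\<Sum>i\<le>k. of_nat (k choose i) * ((vd ^^ i) f x * (vd ^^ (k - i)) g x))" if "x \<in> S"
    by (subst vd_funpow_eqI[where D=D, OF S that _ D]) (simp_all add: D_def)
qed

lemma has_vector_derivative_of_real_powr:
  assumes "0 < x"
  shows "((\<lambda>x. complex_of_real x powr q) has_vector_derivative q * complex_of_real x powr (q - 1)) (at x)"
proof -
  have "((\<lambda>z. z powr q) has_field_derivative q * complex_of_real x powr (q - 1)) (at (complex_of_real x))"
    using assms by (intro has_field_derivative_powr) (auto simp: complex_nonpos_Reals_iff)
  then show ?thesis
    by (rule has_vector_derivative_real_field)
qed

lemma
  shows Cinf_on_of_real_powr: "Cinf_on {0<..} (\<lambda>x. complex_of_real x powr q)"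
    and vd_funpow_of_real_powr: "0 < x \<Longrightarrow> (vd ^^ k) (\<lambda>x. complex_of_real x powr q) x
        = (\<Prod>i<k. q - of_nat i) * complex_of_real x powr (q - of_nat k)"
proof -
  define D where "D k x = (\<Prod>i<k. q - of_nat i) * complex_of_real x powr (q - of_nat k)" for k x
  have D: "(D k has_vector_derivative D (Suc k) x) (at x)" if "x \<in> {0<..}" for k x
    unfolding D_def
    using has_vector_derivative_mult_right[OF has_vector_derivative_of_real_powr[of x "q - of_nat k"],
            of "\<Prod>i<k. q - of_nat i"] that
    by (simp add: algebra_simps)
  show "Cinf_on {0<..} (\<lambda>x. complex_of_real x powr q)"
    by (rule Cinf_onI[where D=D, OF _ _ D]) (simp_all add: D_def)
  show "(vd ^^ k) (\<lambda>x. complex_of_real x powr q) x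
        = (\<Prod>i<k. q - of_nat i) * complex_of_real x powr (q - of_nat k)" if "0 < x"
    by (subst vd_funpow_eqI[where S="{0<..}" and D=D, OF _ _ _ D]) (use that in \<open>simp_all add: D_def\<close>)
qed

lemma
  shows Cinf_on_exp: "Cinf_on UNIV (\<lambda>x. exp (- complex_of_real x * z))"
    and vd_funpow_exp: "(vd ^^ k) (\<lambda>x. exp (- complex_of_real x * z)) x = (- z) ^ k * exp (- complex_of_real x * z)"
proof -
  define D where "D k x = (- z) ^ k * exp (- complex_of_real x * z)" for k x
  have D: "(D k has_vector_derivative D (Suc k) x) (at x)" for k x
  proof -
    have "((\<lambda>x. (- z) ^ k * exp (- x * z)) has_field_derivative D (Suc k) x) (at (complex_of_real x))"
      unfolding D_def by (auto intro!: derivative_eq_intros)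
    from has_vector_derivative_real_field[OF this] show ?thesis by (simp add: D_def[abs_def])
  qed
  show "Cinf_on UNIV (\<lambda>x. exp (- complex_of_real x * z))"
    by (rule Cinf_onI[where D=D, OF _ _ D]) (simp_all add: D_def)
  show "(vd ^^ k) (\<lambda>x. exp (- complex_of_real x * z)) x = (- z) ^ k * exp (- complex_of_real x * z)"
    by (subst vd_funpow_eqI[where S=UNIV and D=D, OF _ _ _ D]) (simp_all add: D_def)
qed

section \<open>Integrals over the half-line\<close>

lemma set_borel_measurable_Ioi:
  fixes f :: "real \<Rightarrow> 'a::real_normed_vector"
  assumes "continuous_on {0<..} f"
  shows "set_borel_measurable lborel {0<..} f"
  using borel_measurable_continuous_on_indicator[OF _ assms] by (simp add: set_borel_measurable_def)

lemma set_integrable_powr_near_0: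
  fixes s e :: real
  assumes "-1 < s"
  shows "set_integrable lborel {0<..<e} (\<lambda>x. x powr s)"
proof (cases "0 < e")
  case True
  have "set_integrable lborel (einterval (ereal 0) (ereal e)) (\<lambda>x. x powr s)"
  proof (rule interval_integral_FTC_nonneg(1)[where F="\<lambda>x. x powr (s + 1) / (s + 1)"])
    show "(((\<lambda>x. x powr (s + 1) / (s + 1)) \<circ> real_of_ereal) \<longlongrightarrow> 0) (at_right (ereal 0))"
      unfolding ereal_tendsto_simps using assms by real_asymp
    have "isCont (\<lambda>x. x powr (s + 1) / (s + 1)) e"
      using True assms by (intro continuous_intros) auto
    then show "(((\<lambda>x. x powr (s + 1) / (s + 1)) \<circ> real_of_ereal) \<longlongrightarrow> e powr (s + 1) / (s + 1)) (at_left (ereal e))"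
      unfolding ereal_tendsto_simps isCont_def by (rule tendsto_within_subset) auto
  qed (use True assms in \<open>auto intro!: derivative_eq_intros continuous_intros simp: powr_diff\<close>)
  then show ?thesis by (simp add: einterval_eq)
qed (auto simp: set_integrable_def)

lemma set_integrable_powr_at_top:
  fixes s R :: real
  assumes "s < -1" "0 < R"
  shows "set_integrable lborel {R<..} (\<lambda>x. x powr s)"
proof -
  have "set_integrable lborel (einterval (ereal R) \<infinity>) (\<lambda>x. x powr s)"
  proof (rule interval_integral_FTC_nonneg(1)[where F="\<lambda>x. x powr (s + 1) / (s + 1)"])
    have "isCont (\<lambda>x. x powr (s + 1) / (s + 1)) R"
      using assms by (intro continuous_intros) auto
    then show "(((\<lambda>x. x powr (s + 1) / (s + 1)) \<circ> real_of_ereal) \<longlongrightarrow> R powr (s + 1) / (s + 1)) (at_right (ereal R))"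
      unfolding ereal_tendsto_simps isCont_def by (rule tendsto_within_subset) auto
    have "((\<lambda>x. x powr (s + 1) / (s + 1)) \<longlongrightarrow> 0) at_top"
      using assms by real_asymp
    then show "(((\<lambda>x. x powr (s + 1) / (s + 1)) \<circ> real_of_ereal) \<longlongrightarrow> 0) (at_left \<infinity>)"
      unfolding ereal_tendsto_simps .
  qed (use assms in \<open>auto intro!: derivative_eq_intros continuous_intros simp: powr_diff\<close>)
  then show ?thesis by (simp add: einterval_eq)
qed

text \<open>Convergence test for the half-line integrals below: continuity takes care of a compact
  middle piece, so only power bounds at the two ends have to be supplied.\<close>

lemma set_integrable_Ioi_powr_bounds:
  fixes f :: "real \<Rightarrow> 'a::{banach, second_countable_topology}"
  assumes f: "continuous_on {0<..} f" and s: "-1 < s" and t: "t < -1"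
    and "\<forall>\<^sub>F x in at_right 0. norm (f x) \<le> C * x powr s"
    and "\<forall>\<^sub>F x in at_top. norm (f x) \<le> D * x powr t"
  shows "set_integrable lborel {0<..} f"
proof -
  from assms(4) obtain e where e: "0 < e" "\<And>x. 0 < x \<Longrightarrow> x < e \<Longrightarrow> norm (f x) \<le> C * x powr s"
    unfolding eventually_at_right_field by auto
  from assms(5) obtain R0 where R0: "\<And>x. R0 \<le> x \<Longrightarrow> norm (f x) \<le> D * x powr t"
    unfolding eventually_at_top_linorder by auto
  define R where "R = max R0 1"
  have meas: "set_borel_measurable lborel A f" if "A \<in> sets borel" "A \<subseteq> {0<..}" for A
    using set_borel_measurable_subset[OF set_borel_measurable_Ioi[OF f], of A] that by simp
  have 1: "set_integrable lborel {0<..<e} f"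
    by (rule set_integrable_bound[where f="\<lambda>x. C * x powr s"])
       (use e s in \<open>auto intro!: AE_I2 meas set_integrable_powr_near_0 order.trans[OF e(2)]\<close>)
  \<comment> \<open>Starting at \<open>e/2\<close> keeps the compact piece away from 0 while it
    overlaps the first one.\<close>
  have 2: "set_integrable lborel {e/2..R} f"
    unfolding set_integrable_def
    by (rule borel_integrable_compact) (use e in \<open>auto intro: continuous_on_subset[OF f]\<close>)
  have 3: "set_integrable lborel {R<..} f"
    by (rule set_integrable_bound[where f="\<lambda>x. D * x powr t"])
       (use t in \<open>auto intro!: AE_I2 meas set_integrable_powr_at_top order.trans[OF R0] simp: R_def\<close>)
  have "{0<..} = ({0<..<e} \<union> {e/2..R}) \<union> {R<..}"
    using e by (auto simp: R_def)
  then show ?thesis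
    using set_integrable_Un[OF set_integrable_Un[OF 1 2] 3] by simp
qed

text \<open>A logarithm costs an arbitrarily small power: a single term of the exponential series is
  at most \<open>exp (d * \<bar>ln x\<bar>)\<close>, which is \<open>x powr d\<close> or
  \<open>x powr (- d)\<close>.\<close>

lemma abs_ln_power_le:
  fixes x d :: real
  assumes "0 < x" "0 < d"
  shows "\<bar>ln x\<bar> ^ k \<le> fact k / d ^ k * x powr (if 1 \<le> x then d else - d)"
proof -
  have "(d * \<bar>ln x\<bar>) ^ k / fact k \<le> exp (d * \<bar>ln x\<bar>)"
  proof -
    have "sum (\<lambda>n. (d * \<bar>ln x\<bar>) ^ n /\<^sub>R fact n) {k} \<le> (\<Sum>n. (d * \<bar>ln x\<bar>) ^ n /\<^sub>R fact n)"
      using summable_exp_generic[of "d * \<bar>ln x\<bar>"] assms by (intro sum_le_suminf) auto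
    then show ?thesis by (simp add: exp_def divide_inverse mult.commute)
  qed
  also have "exp (d * \<bar>ln x\<bar>) = x powr (if 1 \<le> x then d else - d)"
    using assms by (auto simp: powr_def abs_if)
  finally show ?thesis
    using assms by (simp add: power_mult_distrib field_simps)
qed

text \<open>Supplies one dominating function for all exponents \<open>s\<close> within
  \<open>d\<close> of \<open>r\<close>. One margin \<open>d\<close> absorbs the moving exponent and
  another the logarithm, whence \<open>2 * d\<close>; the sum of both powers covers large and small
  \<open>x\<close> together.\<close>

lemma powr_times_abs_ln_power_le:
  fixes x d :: real
  assumes "0 < x" "0 < d" "\<bar>s - r\<bar> \<le> d"
  shows "x powr s * \<bar>ln x\<bar> ^ k \<le> fact k / d ^ k * (x powr (r - 2 * d) + x powr (r + 2 * d))"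
proof -
  define c where "c = fact k / d ^ k"
  have "0 \<le> c" using assms by (simp add: c_def)
  show ?thesis
  proof (cases "1 \<le> x")
    case True
    have "x powr s * \<bar>ln x\<bar> ^ k \<le> x powr (r + d) * (c * x powr d)"
      using abs_ln_power_le[OF assms(1,2), of k] True assms
      by (intro mult_mono powr_mono) (auto simp: c_def)
    also have "\<dots> = c * x powr (r + 2 * d)"
      by (simp add: powr_add[symmetric] algebra_simps)
    also have "\<dots> \<le> c * (x powr (r - 2 * d) + x powr (r + 2 * d))"
      using \<open>0 \<le> c\<close> by (intro mult_left_mono) auto
    finally show ?thesis by (simp add: c_def)
  next
    case False
    have "x powr s * \<bar>ln x\<bar> ^ k \<le> x powr (r - d) * (c * x powr (- d))"
      using abs_ln_power_le[OF assms(1,2), of k] False assms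
      by (intro mult_mono powr_mono') (auto simp: c_def)
    also have "\<dots> = c * x powr (r - 2 * d)"
      by (simp add: powr_add[symmetric] algebra_simps)
    also have "\<dots> \<le> c * (x powr (r - 2 * d) + x powr (r + 2 * d))"
      using \<open>0 \<le> c\<close> by (intro mult_left_mono) auto
    finally show ?thesis by (simp add: c_def)
  qed
qed

lemma norm_logpow: "0 < x \<Longrightarrow> norm (logpow q k x) = x powr Re q * \<bar>ln x\<bar> ^ k"
  by (simp add: logpow_def norm_mult norm_power norm_powr_real_powr)

lemma continuous_on_logpow [continuous_intros]: "continuous_on {0<..} (logpow q k)"
  unfolding logpow_def[abs_def]
  by (intro continuous_intros) (auto simp: complex_nonpos_Reals_iff)

lemma logpow_0 [simp]: "logpow q 0 x = complex_of_real x powr q"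
  by (simp add: logpow_def)

section \<open>Parameter integrals and Mellin transforms\<close>

text \<open>The bilinear map \<open>B\<close> covers both real and complex parameters.\<close>

lemma has_derivative_integral_parametric:
  fixes f :: "'b::real_normed_vector \<Rightarrow> 'a \<Rightarrow> 'c::{banach, second_countable_topology}"
    and B :: "'b \<Rightarrow> 'c \<Rightarrow> 'c"
  assumes B: "bounded_bilinear B" and r: "0 < r"
    and f: "\<And>y. y \<in> ball z r \<Longrightarrow> integrable M (f y)"
    and d: "d z \<in> borel_measurable M"
    and der: "\<And>x y. x \<in> space M \<Longrightarrow> y \<in> ball z r \<Longrightarrow> ((\<lambda>y. f y x) has_derivative (\<lambda>h. B h (d y x))) (at y)"
    and bound: "\<And>x y. x \<in> space M \<Longrightarrow> y \<in> ball z r \<Longrightarrow> norm (d y x) \<le> g x"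
    and g: "integrable M g"
  shows "((\<lambda>y. \<integral>x. f y x \<partial>M) has_derivative (\<lambda>h. B h (\<integral>x. d z x \<partial>M))) (at z)"
proof -
  interpret bounded_bilinear B by fact
  obtain K where K: "0 \<le> K" "\<And>a b. norm (B a b) \<le> norm a * norm b * K"
    using nonneg_bounded by auto
  have z: "z \<in> ball z r" using r by simp
  have dint: "integrable M (d z)"
    by (rule Bochner_Integration.integrable_bound[OF g d])
       (use bound z in \<open>auto intro!: AE_I2 order.trans[OF bound abs_ge_self]\<close>)
  have "((\<lambda>y. ((\<integral>x. f y x \<partial>M) - (\<integral>x. f z x \<partial>M) - B (y - z) (\<integral>x. d z x \<partial>M)) /\<^sub>R norm (y - z)) \<longlongrightarrow> 0)
          (at z within ball z r)"
    \<comment> \<open>Dominated convergence speaks of sequences, so the remainder quotient is tested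
      along an arbitrary sequence \<open>X\<close>.\<close>
    unfolding tendsto_at_iff_sequentially
  proof (intro allI impI)
    fix X assume X: "\<forall>i. X i \<in> ball z r - {z}" "X \<longlonglongrightarrow> z"
    define s where "s n x = (f (X n) x - f z x - B (X n - z) (d z x)) /\<^sub>R norm (X n - z)" for n x
    have Bint: "integrable M (\<lambda>x. B h (d z x))" for h
      by (rule integrable_bounded_linear[OF bounded_linear_right dint])
    have s_int: "integrable M (s n)" for n
      unfolding s_def[abs_def] using X f z Bint by auto
    have s_eq: "(\<integral>x. s n x \<partial>M) =
        ((\<integral>x. f (X n) x \<partial>M) - (\<integral>x. f z x \<partial>M) - B (X n - z) (\<integral>x. d z x \<partial>M)) /\<^sub>R norm (X n - z)" for n
      unfolding s_def using X f z Bint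
      by (simp add: integral_bounded_linear[OF bounded_linear_right dint])
    \<comment> \<open>The mean value inequality on the convex ball bounds the increment by
      \<open>K * g x\<close> times the step, and the linear term obeys the same bound; hence the
      factor 2.\<close>
    have s_bound: "norm (s n x) \<le> 2 * K * g x" if x: "x \<in> space M" for n x
    proof -
      have "norm (f (X n) x - f z x) \<le> (g x * K) * norm (X n - z)"
      proof (rule differentiable_bound[of "ball z r"])
        show "onorm (\<lambda>h. B h (d y x)) \<le> g x * K" if "y \<in> ball z r" for y
        proof (rule onorm_bound)
          show "0 \<le> g x * K"
            using K order.trans[OF norm_ge_zero bound[OF x that]] by simp
          fix h show "norm (B h (d y x)) \<le> g x * K * norm h"
            using order.trans[OF K(2) mult_right_mono[OF mult_left_mono[OF bound[OF x that]] K(1)], of h]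
            by (simp add: mult_ac)
        qed
        show "((\<lambda>y. f y x) has_derivative (\<lambda>h. B h (d y x))) (at y within ball z r)" if "y \<in> ball z r" for y
          using der[OF x that] by (rule has_derivative_at_withinI)
      qed (use X r in auto)
      moreover have "norm (B (X n - z) (d z x)) \<le> (g x * K) * norm (X n - z)"
        using order.trans[OF K(2) mult_right_mono[OF mult_left_mono[OF bound[OF x z]] K(1)], of "X n - z"]
        by (simp add: mult_ac)
      ultimately have "norm (f (X n) x - f z x - B (X n - z) (d z x)) \<le> (2 * K * g x) * norm (X n - z)"
        using norm_triangle_ineq4[of "f (X n) x - f z x" "B (X n - z) (d z x)"] by (simp add: algebra_simps)
      moreover have "0 < norm (X n - z)" using X by auto
      ultimately have "norm (f (X n) x - f z x - B (X n - z) (d z x)) / norm (X n - z) \<le> 2 * K * g x"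
        by (simp add: pos_divide_le_eq)
      then show ?thesis by (simp add: s_def divide_inverse mult.commute)
    qed
    have s_lim: "(\<lambda>n. s n x) \<longlonglongrightarrow> 0" if x: "x \<in> space M" for x
    proof -
      have "((\<lambda>y. (f y x - f z x - B (y - z) (d z x)) /\<^sub>R norm (y - z)) \<longlongrightarrow> 0) (at z within ball z r)"
        using has_derivative_at_withinI[OF der[OF x z]] unfolding has_derivative_at_within by blast
      then show ?thesis
        using X unfolding tendsto_at_iff_sequentially by (auto simp: s_def o_def)
    qed
    have "(\<lambda>n. \<integral>x. s n x \<partial>M) \<longlonglongrightarrow> (\<integral>x. 0 \<partial>M)"
      by (rule integral_dominated_convergence[where w="\<lambda>x. 2 * K * g x"])
         (use g s_bound s_lim s_int in auto)
    then show "((\<lambda>y. ((\<integral>x. f y x \<partial>M) - (\<integral>x. f z x \<partial>M) - B (y - z) (\<integral>x. d z x \<partial>M)) /\<^sub>R norm (y - z)) \<circ> X)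
          \<longlonglongrightarrow> 0"
      by (simp add: s_eq o_def)
  qed
  then show ?thesis
    unfolding has_derivative_at_within at_within_open[OF z open_ball] by (simp add: bounded_linear_left)
qed

lemma has_field_derivative_set_integral:
  fixes f :: "complex \<Rightarrow> real \<Rightarrow> complex"
  assumes r: "0 < r"
    and f: "\<And>y. y \<in> ball z r \<Longrightarrow> set_integrable lborel A (f y)"
    and d: "set_borel_measurable lborel A (d z)"
    and der: "\<And>x y. x \<in> A \<Longrightarrow> y \<in> ball z r \<Longrightarrow> ((\<lambda>y. f y x) has_field_derivative d y x) (at y)"
    and bound: "\<And>x y. x \<in> A \<Longrightarrow> y \<in> ball z r \<Longrightarrow> norm (d y x) \<le> g x"
    and g: "set_integrable lborel A g"
  shows "((\<lambda>y. LBINT x:A. f y x) has_field_derivative (LBINT x:A. d z x)) (at z)"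
  unfolding has_field_derivative_def set_lebesgue_integral_def
proof (rule has_derivative_integral_parametric[where B="\<lambda>h d. d * h" and g="\<lambda>x. indicator A x *\<^sub>R g x"])
  show "bounded_bilinear (\<lambda>h d::complex. d * h)"
    by (rule bounded_bilinear.flip[OF bounded_bilinear_mult])
  show "((\<lambda>y. indicator A x *\<^sub>R f y x) has_derivative (*) (indicator A x *\<^sub>R d y x)) (at y)"
    if "y \<in> ball z r" for x y
  proof (cases "x \<in> A")
    case True
    then show ?thesis using der[OF True that] by (simp add: has_field_derivative_def)
  qed (use has_derivative_const[of 0] in \<open>simp add: lambda_zero[symmetric]\<close>)
  show "norm (indicator A x *\<^sub>R d y x) \<le> indicator A x *\<^sub>R g x" if "y \<in> ball z r" for x y
    using bound[OF _ that] by (auto simp: indicator_def)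
qed (use assms in \<open>auto simp: set_integrable_def set_borel_measurable_def\<close>)

lemma has_field_derivative_logpow:
  assumes "0 < x"
  shows "((\<lambda>b. logpow b k x) has_field_derivative logpow b (Suc k) x) (at b)"
proof -
  have "((\<lambda>b. complex_of_real x powr b) has_field_derivative of_real x powr b * Ln (of_real x)) (at b)"
    using assms by (auto intro!: derivative_eq_intros simp: powr_def)
  from DERIV_cmult_right[OF this, of "complex_of_real (ln x) ^ k"] show ?thesis
    using assms by (simp add: logpow_def Ln_of_real mult_ac)
qed

lemma
  assumes \<Phi>: "continuous_on {0<..} \<Phi>"
    and int: "\<And>s. \<alpha> < s \<Longrightarrow> set_integrable lborel {0<..} (\<lambda>x. x powr s *\<^sub>R \<Phi> x)"
    and b: "\<alpha> < Re b"
  shows set_integrable_mellin: "set_integrable lborel {0<..} (\<lambda>x. logpow b k x * \<Phi> x)"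
    and has_field_derivative_mellin:
      "((\<lambda>b. LBINT x:{0<..}. logpow b k x * \<Phi> x) has_field_derivative
        (LBINT x:{0<..}. logpow b (Suc k) x * \<Phi> x)) (at b)"
proof -
  \<comment> \<open>A quarter of the distance to the edge, so that both exponents
    \<open>Re b - 2 * r\<close> and \<open>Re b + 2 * r\<close> of the dominating function stay
    above \<open>\<alpha>\<close>.\<close>
  define r where "r = (Re b - \<alpha>) / 4"
  have r: "0 < r" using b by (simp add: r_def)
  define g where "g k x = fact k / r ^ k * (norm (x powr (Re b - 2 * r) *\<^sub>R \<Phi> x) + norm (x powr (Re b + 2 * r) *\<^sub>R \<Phi> x))" for k x
  have "\<alpha> < Re b - 2 * r" "\<alpha> < Re b + 2 * r" using b by (simp_all add: r_def field_simps)
  then have g: "set_integrable lborel {0<..} (g k)" for k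
    unfolding g_def by (intro set_integrable_mult_right set_integral_add(1) set_integrable_norm int)
  have bound: "norm (logpow y k x * \<Phi> x) \<le> g k x" if "x \<in> {0<..}" "y \<in> ball b r" for x y k
  proof -
    have "\<bar>Re y - Re b\<bar> \<le> r"
      using that abs_Re_le_cmod[of "y - b"] by (simp add: dist_norm norm_minus_commute)
    then have "norm (logpow y k x) \<le> fact k / r ^ k * (x powr (Re b - 2 * r) + x powr (Re b + 2 * r))"
      using powr_times_abs_ln_power_le[OF _ r, of x "Re y" "Re b" k] that by (simp add: norm_logpow)
    from mult_right_mono[OF this norm_ge_zero[of "\<Phi> x"]] show ?thesis
      by (simp add: g_def norm_mult algebra_simps)
  qed
  have meas: "set_borel_measurable lborel {0<..} (\<lambda>x. logpow y k x * \<Phi> x)" for y k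
    by (intro set_borel_measurable_Ioi continuous_intros \<Phi>)
  have int': "set_integrable lborel {0<..} (\<lambda>x. logpow y k x * \<Phi> x)" if "y \<in> ball b r" for y k
    by (rule set_integrable_bound[OF g meas])
       (use bound[OF _ that] in \<open>auto intro!: AE_I2 order.trans[OF _ abs_ge_self]\<close>)
  show "set_integrable lborel {0<..} (\<lambda>x. logpow b k x * \<Phi> x)"
    using int' r by simp
  show "((\<lambda>b. LBINT x:{0<..}. logpow b k x * \<Phi> x) has_field_derivative
        (LBINT x:{0<..}. logpow b (Suc k) x * \<Phi> x)) (at b)"
    by (rule has_field_derivative_set_integral[OF r int' meas _ bound g])
       (auto intro!: DERIV_cmult_right has_field_derivative_logpow)
qed

text \<open>Each derivative in the exponent brings down one factor \<open>ln x\<close>; this is how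
  the logarithmic pairings \<open>xplus_log\<close> become integrals against
  \<open>logpow\<close>.\<close>

lemma higher_deriv_mellin:
  assumes \<Phi>: "continuous_on {0<..} \<Phi>"
    and int: "\<And>s. \<alpha> < s \<Longrightarrow> set_integrable lborel {0<..} (\<lambda>x. x powr s *\<^sub>R \<Phi> x)"
    and b: "\<alpha> < Re b"
  shows "(deriv ^^ k) (\<lambda>b. LBINT x:{0<..}. complex_of_real x powr b * \<Phi> x) b
      = (LBINT x:{0<..}. logpow b k x * \<Phi> x)"
  using b
proof (induction k arbitrary: b)
  case (Suc k)
  have "((deriv ^^ k) (\<lambda>b. LBINT x:{0<..}. complex_of_real x powr b * \<Phi> x) has_field_derivative
        (LBINT x:{0<..}. logpow b (Suc k) x * \<Phi> x)) (at b)"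
    by (rule has_field_derivative_transform_within_open
         [OF has_field_derivative_mellin[OF \<Phi> int Suc.prems], of "{b. \<alpha> < Re b}"])
       (use Suc in \<open>auto simp: open_halfspace_Re_gt\<close>)
  then show ?case by (simp add: DERIV_imp_deriv)
qed simp

lemma holomorphic_on_mellin:
  assumes \<Phi>: "continuous_on {0<..} \<Phi>"
    and int: "\<And>s. \<alpha> < s \<Longrightarrow> set_integrable lborel {0<..} (\<lambda>x. x powr s *\<^sub>R \<Phi> x)"
  shows "(\<lambda>b. LBINT x:{0<..}. complex_of_real x powr b * \<Phi> x) holomorphic_on {b. \<alpha> < Re b}"
proof (rule holomorphic_onI)
  fix b assume "b \<in> {b. \<alpha> < Re b}"
  then have "((\<lambda>b. LBINT x:{0<..}. logpow b 0 x * \<Phi> x) has_field_derivative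
        (LBINT x:{0<..}. logpow b (Suc 0) x * \<Phi> x)) (at b)"
    by (intro has_field_derivative_mellin[OF \<Phi> int]) auto
  then show "(\<lambda>b. LBINT x:{0<..}. complex_of_real x powr b * \<Phi> x)
      field_differentiable at b within {b. \<alpha> < Re b}"
    unfolding field_differentiable_def logpow_0 by (blast intro: has_field_derivative_at_within)
qed

lemma integral_Ioi_eq_diff_limits:
  fixes F f :: "real \<Rightarrow> complex"
  assumes F: "\<And>x. 0 < x \<Longrightarrow> (F has_vector_derivative f x) (at x)"
    and f: "continuous_on {0<..} f" "set_integrable lborel {0<..} f"
    and lims: "(F \<longlongrightarrow> A) (at_right 0)" "(F \<longlongrightarrow> B) at_top"
  shows "(LBINT x:{0<..}. f x) = B - A"
proof -
  have ei: "einterval 0 \<infinity> = {0<..}"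
    by (auto simp: einterval_def)
  have "(LBINT x=0..\<infinity>. f x) = B - A"
  proof (rule interval_integral_FTC_integrable[where F=F])
    show "isCont f x" if "0 < ereal x" for x
      using f(1) that by (simp add: continuous_on_eq_continuous_at)
    show "((F \<circ> real_of_ereal) \<longlongrightarrow> A) (at_right 0)" "((F \<circ> real_of_ereal) \<longlongrightarrow> B) (at_left \<infinity>)"
      using lims by (simp_all add: zero_ereal_def ereal_tendsto_simps)
  qed (use F f ei in auto)
  then show ?thesis
    by (simp add: interval_lebesgue_integral_def ei)
qed

lemma
  fixes f :: "'i \<Rightarrow> 'a \<Rightarrow> 'b::{banach, second_countable_topology}"
  assumes "\<And>i. i \<in> I \<Longrightarrow> set_integrable M A (f i)"
  shows set_integrable_sum: "set_integrable M A (\<lambda>x. \<Sum>i\<in>I. f i x)"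
    and set_integral_sum: "(LINT x:A|M. \<Sum>i\<in>I. f i x) = (\<Sum>i\<in>I. LINT x:A|M. f i x)"
  using assms unfolding set_integrable_def set_lebesgue_integral_def
  by (simp_all add: scaleR_sum_right)

lemma of_real_powr_add_nat:
  "0 < x \<Longrightarrow> complex_of_real x powr (b + of_nat n) = complex_of_real x powr b * complex_of_real x ^ n"
  by (simp add: powr_add powr_nat')

section \<open>Analytic continuation of powers on the half-line\<close>

lemma closed_neg_ints: "closed neg_ints"
  by (rule closed_subset_Ints) (auto simp: neg_ints_def)

lemma neg_ints_Re: "b \<in> neg_ints \<Longrightarrow> Re b \<le> -1"
  by (auto simp: neg_ints_def)

text \<open>A countable set does not disconnect the plane. Connectedness is what the identity
  theorem needs for the continuation in \<open>xplus\<close> to be unique.\<close>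

lemma connected_Compl_neg_ints: "connected (- neg_ints)"
proof -
  have "neg_ints = (\<lambda>n. - of_nat (Suc n)) ` UNIV"
    by (auto simp: neg_ints_def)
  then have "countable neg_ints" by (metis countable_image countableI_type)
  then have "connected (UNIV - neg_ints)"
    by (intro connected_open_diff_countable) auto
  then show ?thesis by (simp add: Compl_eq_Diff_UNIV)
qed

text \<open>Resolves the definite description once and for all: two continuations agree on the
  half-plane \<open>Re b > -1\<close>, hence on the whole connected domain, and at the poles both
  are forced to be 0.\<close>

lemma xplus_eqI:
  assumes G: "G holomorphic_on - neg_ints"
    and int: "\<And>b. -1 < Re b \<Longrightarrow> G b = (LBINT x:{0<..}. complex_of_real x powr b * \<phi> x)"
    and b: "b \<notin> neg_ints"
  shows "xplus \<phi> b = G b"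
proof -
  define F where "F b = (if b \<in> neg_ints then 0 else G b)" for b
  have F: "F holomorphic_on - neg_ints"
    by (rule holomorphic_transform[OF G]) (simp add: F_def)
  have Fint: "F b = (LBINT x:{0<..}. complex_of_real x powr b * \<phi> x)" if "-1 < Re b" for b
    using int[OF that] neg_ints_Re that by (force simp: F_def)
  have "xplus \<phi> = F"
    unfolding xplus_def
  proof (rule the_equality)
    show "F holomorphic_on - neg_ints \<and> (\<forall>b\<in>neg_ints. F b = 0)
      \<and> (\<forall>b. -1 < Re b \<longrightarrow> F b = (LBINT x:{0<..}. complex_of_real x powr b * \<phi> x))"
      using F Fint by (simp add: F_def)
  next
    fix F' assume F': "F' holomorphic_on - neg_ints \<and> (\<forall>b\<in>neg_ints. F' b = 0)
      \<and> (\<forall>b. -1 < Re b \<longrightarrow> F' b = (LBINT x:{0<..}. complex_of_real x powr b * \<phi> x))"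
    show "F' = F"
    proof
      fix b
      show "F' b = F b"
      proof (cases "b \<in> neg_ints")
        case False
        show ?thesis
        proof (rule analytic_continuation_open[of "{b. -1 < Re b}" "- neg_ints" F' F])
          show "{b. -1 < Re b} \<noteq> {}" by (auto intro: exI[of _ 0])
          show "{b. -1 < Re b} \<subseteq> - neg_ints" using neg_ints_Re by fastforce
        qed (use F F' Fint False connected_Compl_neg_ints closed_neg_ints in
              \<open>auto simp: open_halfspace_Re_gt\<close>)
      qed (use F' in \<open>simp add: F_def\<close>)
    qed
  qed
  then show ?thesis
    using b by (simp add: F_def)
qed

section \<open>Continuation by repeated integration by parts\<close>

lemma vd_funpow_eq_0:
  assumes "\<And>x. R < x \<Longrightarrow> f x = 0" "R < x"
  shows "(vd ^^ k) f x = 0"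
  by (rule vd_funpow_eqI[where S="{R<..}" and D="\<lambda>k x. 0"]) (use assms in auto)

lemma set_integrable_powr_times_compact_support:
  fixes \<Phi> :: "real \<Rightarrow> complex"
  assumes \<Phi>: "continuous_on UNIV \<Phi>" and R: "\<And>x. R < x \<Longrightarrow> \<Phi> x = 0" and s: "-1 - real n < s"
  shows "set_integrable lborel {0<..} (\<lambda>x. x powr s *\<^sub>R (complex_of_real x ^ n * \<Phi> x))"
\<comment> \<open>The factor \<open>x ^ n\<close> raises the exponent at 0 to \<open>s + n\<close>,
  with a constant from continuity of \<open>\<Phi>\<close> at 0. Beyond \<open>R\<close> the
  integrand is 0, so any exponent below -1 serves there.\<close>
proof (rule set_integrable_Ioi_powr_bounds[where s="s + n" and t="-2" and D=0 and C="norm (\<Phi> 0) + 1"])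
  show "continuous_on {0<..} (\<lambda>x. x powr s *\<^sub>R (complex_of_real x ^ n * \<Phi> x))"
    by (intro continuous_intros continuous_on_subset[OF \<Phi>]) auto
  have "isCont \<Phi> 0" using \<Phi> by (simp add: continuous_on_eq_continuous_at)
  then have "(\<Phi> \<longlongrightarrow> \<Phi> 0) (at_right 0)"
    unfolding isCont_def by (rule tendsto_within_subset) auto
  from tendsto_norm[OF this] have "\<forall>\<^sub>F x in at_right 0. norm (\<Phi> x) < norm (\<Phi> 0) + 1"
    by (rule order_tendstoD) simp
  moreover have "\<forall>\<^sub>F x::real in at_right 0. 0 < x"
    by (rule eventually_at_right_less)
  ultimately show "\<forall>\<^sub>F x in at_right 0. norm (x powr s *\<^sub>R (complex_of_real x ^ n * \<Phi> x))
      \<le> (norm (\<Phi> 0) + 1) * x powr (s + real n)"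
  proof eventually_elim
    case (elim x)
    then have "norm (x powr s *\<^sub>R (complex_of_real x ^ n * \<Phi> x)) = norm (\<Phi> x) * x powr (s + real n)"
      by (simp add: norm_mult norm_power powr_add powr_realpow)
    also have "\<dots> \<le> (norm (\<Phi> 0) + 1) * x powr (s + real n)"
      using elim by (intro mult_right_mono) auto
    finally show ?case .
  qed
  show "\<forall>\<^sub>F x in at_top. norm (x powr s *\<^sub>R (complex_of_real x ^ n * \<Phi> x)) \<le> 0 * x powr -2"
    using eventually_gt_at_top[of R] by eventually_elim (simp add: R)
qed (use s in auto)

text \<open>The result of \<open>n\<close> integrations by parts in \<open>\<integral>\<^sub>0\<^sup>\<infinity> x\<^sup>b \<psi>(x) dx\<close>.\<close>

definition xplus_ibp :: "(real \<Rightarrow> complex) \<Rightarrow> nat \<Rightarrow> complex \<Rightarrow> complex" where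
  "xplus_ibp \<psi> n b = (-1) ^ n / pochhammer (b + 1) n *
     (LBINT x:{0<..}. complex_of_real x powr b * (complex_of_real x ^ n * (vd ^^ n) \<psi> x))"

context
  fixes \<psi> :: "real \<Rightarrow> complex" and R :: real
  assumes smooth: "Cinf_on UNIV \<psi>" and supp: "\<And>x. R < x \<Longrightarrow> \<psi> x = 0"
begin

lemma set_integrable_powr_times_vd:
  "-1 - real n < s \<Longrightarrow> set_integrable lborel {0<..} (\<lambda>x. x powr s *\<^sub>R (complex_of_real x ^ n * (vd ^^ n) \<psi> x))"
  by (rule set_integrable_powr_times_compact_support[of _ R])
     (auto intro: Cinf_on_continuous[OF smooth] vd_funpow_eq_0 supp)

lemma continuous_on_power_times_vd:
  "continuous_on {0<..} (\<lambda>x. complex_of_real x ^ n * (vd ^^ n) \<psi> x)"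
  by (intro continuous_intros continuous_on_subset[OF Cinf_on_continuous[OF smooth]]) auto

text \<open>The factor \<open>b + n + 1\<close> by which one more integration by parts divides is
  the last factor of \<open>pochhammer (b + 1) (Suc n)\<close>; it is nonzero because
  \<open>Re b > -1 - n\<close>.\<close>

lemma xplus_ibp_Suc:
  assumes b: "-1 - real n < Re b"
  shows "xplus_ibp \<psi> (Suc n) b = xplus_ibp \<psi> n b"
proof -
  define c where "c = b + of_nat n"
  define I where "I n = (LBINT x:{0<..}. complex_of_real x powr b * (complex_of_real x ^ n * (vd ^^ n) \<psi> x))" for n
  have c: "-1 < Re c" using b by (simp add: c_def)
  have c0: "c + 1 \<noteq> 0" using c by (auto simp: complex_eq_iff)
  have int: "set_integrable lborel {0<..} (\<lambda>x. complex_of_real x powr b * (complex_of_real x ^ k * (vd ^^ k) \<psi> x))"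
    if "n \<le> k" for k
    using set_integrable_mellin[where b=b and k=0, OF continuous_on_power_times_vd[of k] set_integrable_powr_times_vd[of k]] b that by simp
  define f where "f x = (c + 1) * (complex_of_real x powr b * (complex_of_real x ^ n * (vd ^^ n) \<psi> x))
      + complex_of_real x powr b * (complex_of_real x ^ Suc n * (vd ^^ Suc n) \<psi> x)" for x
  \<comment> \<open>The boundary term: it vanishes at 0 since \<open>Re (c + 1) > 0\<close>, and at
    infinity by the support of \<open>\<psi>\<close>.\<close>
  define F where "F x = complex_of_real x powr (c + 1) * (vd ^^ n) \<psi> x" for x
  have "(LBINT x:{0<..}. f x) = 0 - 0"
  proof (rule integral_Ioi_eq_diff_limits[where F=F])
    fix x :: real assume x: "0 < x"
    have "((\<lambda>x. complex_of_real x powr (c + 1)) has_vector_derivative (c + 1) * complex_of_real x powr c) (at x)"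
      using has_vector_derivative_of_real_powr[OF x, of "c + 1"] by simp
    from has_vector_derivative_mult[OF this Cinf_on_derivative[OF smooth UNIV_I, of n x]]
    have "(F has_vector_derivative (complex_of_real x powr (c + 1) * (vd ^^ Suc n) \<psi> x
        + (c + 1) * complex_of_real x powr c * (vd ^^ n) \<psi> x)) (at x)"
      by (simp add: F_def[abs_def])
    also have "(complex_of_real x powr (c + 1) * (vd ^^ Suc n) \<psi> x
        + (c + 1) * complex_of_real x powr c * (vd ^^ n) \<psi> x) = f x"
      using of_real_powr_add_nat[OF x, of b n] of_real_powr_add_nat[OF x, of b "Suc n"]
      by (simp add: f_def c_def add_ac mult_ac)
    finally show "(F has_vector_derivative f x) (at x)" .
  next
    show "continuous_on {0<..} f"
      unfolding f_def
      by (intro continuous_intros continuous_on_subset[OF Cinf_on_continuous[OF smooth]])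
         (auto simp: complex_nonpos_Reals_iff)
    show "set_integrable lborel {0<..} f"
      unfolding f_def by (intro set_integral_add(1) set_integrable_mult_right int) auto
    have "isCont ((vd ^^ n) \<psi>) 0"
      using Cinf_on_continuous[OF smooth, of n] by (simp add: continuous_on_eq_continuous_at)
    then have 1: "((vd ^^ n) \<psi> \<longlongrightarrow> (vd ^^ n) \<psi> 0) (at_right 0)"
      unfolding isCont_def by (rule tendsto_within_subset) auto
    have "((\<lambda>x::real. x powr Re (c + 1)) \<longlongrightarrow> 0) (at_right 0)"
      using c by real_asymp
    moreover have "\<forall>\<^sub>F x in at_right 0. norm (complex_of_real x powr (c + 1)) \<le> x powr Re (c + 1)"
      using eventually_at_right_less[of "0::real"] by eventually_elim (simp add: norm_powr_real_powr)
    ultimately have 2: "((\<lambda>x. complex_of_real x powr (c + 1)) \<longlongrightarrow> 0) (at_right 0)"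
      by (rule Lim_null_comparison[rotated])
    show "(F \<longlongrightarrow> 0) (at_right 0)"
      using tendsto_mult[OF 2 1] by (simp add: F_def[abs_def])
    show "(F \<longlongrightarrow> 0) at_top"
      by (rule tendsto_eventually)
         (use eventually_gt_at_top[of R] in \<open>eventually_elim, simp add: F_def vd_funpow_eq_0[of R] supp\<close>)
  qed
  moreover have "(LBINT x:{0<..}. f x) = (c + 1) * I n + I (Suc n)"
    unfolding f_def I_def
    by (subst set_integral_add) (auto intro!: set_integrable_mult_right int simp del: power_Suc funpow.simps)
  ultimately have "I (Suc n) = - ((c + 1) * I n)"
    by (simp only: eq_neg_iff_add_eq_0 add.commute diff_self)
  then have "(-1) ^ Suc n / pochhammer (b + 1) (Suc n) * I (Suc n) = (-1) ^ n / pochhammer (b + 1) n * I n"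
    using c0 by (simp add: pochhammer_rec' c_def add_ac divide_simps)
  then show ?thesis
    by (simp only: xplus_ibp_def I_def)
qed

lemma xplus_ibp_mono:
  assumes b: "-1 - real n < Re b" and "n \<le> k"
  shows "xplus_ibp \<psi> k b = xplus_ibp \<psi> n b"
  using \<open>n \<le> k\<close> by (induction k rule: dec_induct) (use b in \<open>auto simp: xplus_ibp_Suc\<close>)

lemma xplus_ibp_holomorphic:
  shows "(\<lambda>b. LBINT x:{0<..}. complex_of_real x powr b * (complex_of_real x ^ n * (vd ^^ n) \<psi> x))
      holomorphic_on {b. -1 - real n < Re b}"
    and "(\<lambda>b. (-1) ^ n / pochhammer (b + 1) n) holomorphic_on - neg_ints"
    and "xplus_ibp \<psi> n holomorphic_on {b. -1 - real n < Re b} - neg_ints"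
proof -
  show 1: "(\<lambda>b. LBINT x:{0<..}. complex_of_real x powr b * (complex_of_real x ^ n * (vd ^^ n) \<psi> x))
      holomorphic_on {b. -1 - real n < Re b}"
    by (rule holomorphic_on_mellin[OF continuous_on_power_times_vd set_integrable_powr_times_vd])
  show 2: "(\<lambda>b. (-1) ^ n / pochhammer (b + 1) n) holomorphic_on - neg_ints"
    unfolding pochhammer_prod
  proof (intro holomorphic_intros)
    fix b :: complex assume b: "b \<in> - neg_ints"
    show "(\<Prod>i = 0..<n. b + 1 + of_nat i) \<noteq> 0"
    proof
      assume "(\<Prod>i = 0..<n. b + 1 + of_nat i) = 0"
      then obtain i where "b + 1 + of_nat i = 0" by auto
      then have "b = - of_nat (Suc i)" by (subst eq_neg_iff_add_eq_0) (simp add: add_ac)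
      then show False using b by (auto simp: neg_ints_def)
    qed
  qed
  show "xplus_ibp \<psi> n holomorphic_on {b. -1 - real n < Re b} - neg_ints"
    unfolding xplus_ibp_def[abs_def]
    by (intro holomorphic_on_mult holomorphic_on_subset[OF 1] holomorphic_on_subset[OF 2]) auto
qed

text \<open>The formulas for different \<open>n\<close> agree wherever both integrals converge, so
  they glue to one holomorphic function on the complement of \<open>neg_ints\<close>.
  \<open>G\<close> takes, for each argument, an \<open>n\<close> that is large enough.\<close>

lemma xplus_eq_ibp:
  assumes "-1 - real n < Re b" "b \<notin> neg_ints"
  shows "xplus \<psi> b = xplus_ibp \<psi> n b"
proof -
  define G where "G b = xplus_ibp \<psi> (nat \<lceil>- Re b\<rceil>) b" for b
  define U where "U n = {b. -1 - real n < Re b} - neg_ints" for n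
  have deg: "-1 - real (nat \<lceil>- Re b\<rceil>) < Re b" for b
    by linarith
  have G: "G b = xplus_ibp \<psi> n b" if "-1 - real n < Re b" for n b
    using xplus_ibp_mono[OF that, of "nat \<lceil>- Re b\<rceil>"] xplus_ibp_mono[OF deg, of b n]
    unfolding G_def by (metis nat_le_linear)
  have U: "open (U n)" for n
    unfolding U_def by (intro open_Diff closed_neg_ints open_halfspace_Re_gt)
  have "G holomorphic_on (\<Union>n. U n)"
  proof (rule holomorphic_on_UN_open)
    show "G holomorphic_on U n" for n
      by (rule holomorphic_transform[OF xplus_ibp_holomorphic(3)[of n, folded U_def]])
         (auto simp: U_def G)
  qed (rule U)
  moreover have "(\<Union>n. U n) = - neg_ints"
    using deg by (auto simp: U_def)
  ultimately have "G holomorphic_on - neg_ints" by simp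
  moreover have "G b = (LBINT x:{0<..}. complex_of_real x powr b * \<psi> x)" if "-1 < Re b" for b
    using G[of 0 b] that by (simp add: xplus_ibp_def)
  ultimately have "xplus \<psi> b = G b"
    using assms by (intro xplus_eqI) auto
  then show ?thesis
    using assms by (simp add: G)
qed

lemma xplus_eq_integral:
  "-1 < Re b \<Longrightarrow> xplus \<psi> b = (LBINT x:{0<..}. complex_of_real x powr b * \<psi> x)"
  using xplus_eq_ibp[of 0 b] neg_ints_Re[of b] by (force simp: xplus_ibp_def)

text \<open>The Leibniz rule in the exponent, applied to \<open>xplus_ibp\<close>: derivatives of
  the rational factor become constants, those of the integral only insert logarithms.\<close>

lemma xplus_log_eq_sum:
  assumes q: "-1 - real n < Re q" "q \<notin> neg_ints"
  shows "xplus_log \<psi> k q = (\<Sum>i\<le>k. of_nat (k choose i)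
      * (deriv ^^ i) (\<lambda>b. (-1) ^ n / pochhammer (b + 1) n) q
      * (LBINT x:{0<..}. logpow q (k - i) x * (complex_of_real x ^ n * (vd ^^ n) \<psi> x)))"
proof -
  define U where "U = {b. -1 - real n < Re b} - neg_ints"
  have U: "open U" "q \<in> U"
    unfolding U_def using q by (auto intro!: open_Diff closed_neg_ints open_halfspace_Re_gt)
  have "xplus_log \<psi> k q = (deriv ^^ k) (xplus_ibp \<psi> n) q"
    unfolding xplus_log_def
  proof (rule higher_deriv_transform_within_open[OF _ _ U])
    show "xplus \<psi> b = xplus_ibp \<psi> n b" if "b \<in> U" for b
      using that xplus_eq_ibp by (simp add: U_def)
    then show "xplus \<psi> holomorphic_on U"
      by (intro holomorphic_transform[OF xplus_ibp_holomorphic(3)[of n, folded U_def]]) auto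
    show "xplus_ibp \<psi> n holomorphic_on U"
      unfolding U_def by (rule xplus_ibp_holomorphic)
  qed
  also have "\<dots> = (\<Sum>i=0..k. of_nat (k choose i) * (deriv ^^ i) (\<lambda>b. (-1) ^ n / pochhammer (b + 1) n) q
     * (deriv ^^ (k - i)) (\<lambda>b. LBINT x:{0<..}. complex_of_real x powr b * (complex_of_real x ^ n * (vd ^^ n) \<psi> x)) q)"
    unfolding xplus_ibp_def[abs_def]
    by (rule higher_deriv_mult[OF _ _ U])
       (auto intro!: holomorphic_on_subset[OF xplus_ibp_holomorphic(1)]
             holomorphic_on_subset[OF xplus_ibp_holomorphic(2)] simp: U_def)
  also have "\<dots> = (\<Sum>i\<le>k. of_nat (k choose i) * (deriv ^^ i) (\<lambda>b. (-1) ^ n / pochhammer (b + 1) n) q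
      * (LBINT x:{0<..}. logpow q (k - i) x * (complex_of_real x ^ n * (vd ^^ n) \<psi> x)))"
    unfolding atMost_atLeast0
    by (subst higher_deriv_mellin[OF continuous_on_power_times_vd set_integrable_powr_times_vd q(1)]) auto
  finally show ?thesis .
qed

end

text \<open>Hides the explicit formula. What matters is that one weight \<open>W\<close> serves all
  test functions and stays integrable against any continuous function that vanishes far out, so that
  derivatives of the cut-off can be merged into it.\<close>

lemma xplus_log_representation:
  assumes q: "-1 - real n < Re q" "q \<notin> neg_ints"
  obtains W where "\<And>\<Phi> R. continuous_on UNIV \<Phi> \<Longrightarrow> (\<And>x. R < x \<Longrightarrow> \<Phi> x = 0)
      \<Longrightarrow> set_integrable lborel {0<..} (\<lambda>x. W x * \<Phi> x)"
    and "\<And>\<psi> R. Cinf_on UNIV \<psi> \<Longrightarrow> (\<And>x. R < x \<Longrightarrow> \<psi> x = 0)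
      \<Longrightarrow> xplus_log \<psi> k q = (LBINT x:{0<..}. W x * (vd ^^ n) \<psi> x)"
proof
  define c where "c i = of_nat (k choose i) * (deriv ^^ i) (\<lambda>b. (-1) ^ n / pochhammer (b + 1) n) q" for i
  define W where "W x = (\<Sum>i\<le>k. c i * logpow q (k - i) x * complex_of_real x ^ n)" for x
  have W_eq: "W x * y = (\<Sum>i\<le>k. c i * (logpow q (k - i) x * (complex_of_real x ^ n * y)))" for x y
    by (simp add: W_def sum_distrib_right mult.assoc)
  have int: "set_integrable lborel {0<..} (\<lambda>x. logpow q i x * (complex_of_real x ^ n * \<Phi> x))"
    if "continuous_on UNIV \<Phi>" "\<And>x. R < x \<Longrightarrow> \<Phi> x = 0" for \<Phi> R i
    by (rule set_integrable_mellin[OF _ set_integrable_powr_times_compact_support[OF that] q(1)])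
       (auto intro!: continuous_intros continuous_on_subset[OF that(1)])
  show "set_integrable lborel {0<..} (\<lambda>x. W x * \<Phi> x)"
    if "continuous_on UNIV \<Phi>" "\<And>x. R < x \<Longrightarrow> \<Phi> x = 0" for \<Phi> R
    unfolding W_eq using int[OF that] by (intro set_integrable_sum set_integrable_mult_right) auto
  show "xplus_log \<psi> k q = (LBINT x:{0<..}. W x * (vd ^^ n) \<psi> x)"
    if \<psi>: "Cinf_on UNIV \<psi>" "\<And>x. R < x \<Longrightarrow> \<psi> x = 0" for \<psi> R
  proof -
    have "set_integrable lborel {0<..} (\<lambda>x. logpow q i x * (complex_of_real x ^ n * (vd ^^ n) \<psi> x))" for i
      by (rule int[OF Cinf_on_continuous[OF \<psi>(1)]]) (rule vd_funpow_eq_0, use \<psi> in auto)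
    then have "(LBINT x:{0<..}. W x * (vd ^^ n) \<psi> x) = (\<Sum>i\<le>k. LBINT x:{0<..}. c i * (logpow q (k - i) x
        * (complex_of_real x ^ n * (vd ^^ n) \<psi> x)))"
      unfolding W_eq by (subst set_integral_sum) (auto intro!: set_integrable_mult_right)
    then show ?thesis
      by (subst xplus_log_eq_sum[where R=R and n=n]) (use \<psi> q in \<open>auto simp: c_def\<close>)
  qed
qed

section \<open>Structure of the extension by zero\<close>

lemma set_integrable_mult_bounded:
  fixes f g :: "real \<Rightarrow> complex"
  assumes f: "set_integrable lborel {0<..} f" and g: "continuous_on {0<..} g"
    and B: "\<And>x. 0 < x \<Longrightarrow> norm (g x) \<le> B"
  shows "set_integrable lborel {0<..} (\<lambda>x. f x * g x)"
proof (rule set_integrable_bound[of _ _ "\<lambda>x. of_real B * f x"])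
  show "set_integrable lborel {0<..} (\<lambda>x. of_real B * f x)"
    using f by simp
  have "set_borel_measurable lborel {0<..} f"
    using f by (simp add: set_integrable_def set_borel_measurable_def)
  moreover have "set_borel_measurable lborel {0<..} g"
    by (rule set_borel_measurable_Ioi[OF g])
  moreover have "(\<lambda>x. indicator {0<..} x *\<^sub>R (f x * g x))
      = (\<lambda>x. (indicator {0<..} x *\<^sub>R f x) * (indicator {0<..} x *\<^sub>R g x))"
    by (auto simp: indicator_def)
  ultimately show "set_borel_measurable lborel {0<..} (\<lambda>x. f x * g x)"
    unfolding set_borel_measurable_def by (simp only: borel_measurable_times)
  show "AE x\<in>{0<..} in lborel. norm (f x * g x) \<le> norm (of_real B * f x)"
  proof (intro AE_I2 impI)
    fix x :: real assume "x \<in> {0<..}"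
    then have "norm (g x) \<le> \<bar>B\<bar>" using B[of x] by auto
    then have "norm (f x) * norm (g x) \<le> norm (f x) * \<bar>B\<bar>" by (rule mult_left_mono) simp
    then show "norm (f x * g x) \<le> norm (of_real B * f x)"
      by (simp add: norm_mult mult.commute)
  qed
qed

lemma Cinf_on_of_real_ln: "Cinf_on {0<..} (\<lambda>x. complex_of_real (ln x))"
proof (rule Cinf_onI[where D="\<lambda>k. case k of 0 \<Rightarrow> (\<lambda>x. complex_of_real (ln x))
    | Suc k \<Rightarrow> (vd ^^ k) (\<lambda>x. complex_of_real x powr (-1))"])
  fix k x assume x: "x \<in> {0::real<..}"
  have "((\<lambda>x. complex_of_real (ln x)) has_vector_derivative complex_of_real (inverse x)) (at x)"
    using x by (intro has_vector_derivative_of_real) (auto intro!: derivative_eq_intros simp: divide_inverse)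
  moreover have "complex_of_real (inverse x) = complex_of_real x powr (-1)"
    using x by (simp add: powr_minus)
  ultimately show "((case k of 0 \<Rightarrow> (\<lambda>x. complex_of_real (ln x))
      | Suc k \<Rightarrow> (vd ^^ k) (\<lambda>x. complex_of_real x powr (-1))) has_vector_derivative
      (case Suc k of 0 \<Rightarrow> (\<lambda>x. complex_of_real (ln x))
      | Suc k \<Rightarrow> (vd ^^ k) (\<lambda>x. complex_of_real x powr (-1))) x) (at x)"
    using Cinf_on_derivative[OF Cinf_on_of_real_powr x] by (cases k) auto
qed auto

lemma Cinf_on_logpow: "Cinf_on {0<..} (logpow q k)"
proof (induction k)
  case 0
  then show ?case using Cinf_on_of_real_powr by (simp add: logpow_def[abs_def])
next
  case (Suc k)
  have "Cinf_on {0<..} (\<lambda>x. complex_of_real (ln x) * logpow q k x)"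
    by (intro Cinf_on_mult Cinf_on_of_real_ln Suc.IH) simp
  then show ?case by (simp add: logpow_def[abs_def] mult_ac)
qed

section \<open>Remainders of the expansion and the finite-order form of the extension\<close>

locale half_line_expansion =
  fixes p :: "nat \<Rightarrow> complex" and m :: "nat \<Rightarrow> nat" and mm :: nat
    and a :: "nat \<Rightarrow> nat \<Rightarrow> complex" and w :: "real \<Rightarrow> real" and u :: "real \<Rightarrow> complex"
  assumes pset: "power_set p m mm" and appr: "appropriate p"
    and cutoff: "cutoff w" and SP: "SP p m mm w u a"
begin

lemma Re_p_mono: "i \<le> j \<Longrightarrow> Re (p i) \<le> Re (p j)"
  by (rule lift_Suc_mono_le[of "\<lambda>j. Re (p j)"]) (use pset in \<open>unfold power_set_def, blast\<close>)

lemma p_not_neg_ints: "p j \<notin> neg_ints"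
  using appr unfolding appropriate_def neg_ints_def by blast

definition wc :: "real \<Rightarrow> complex" where "wc x = complex_of_real (w x)"

text \<open>The index at which \<open>eplus\<close> itself truncates, named so that longer
  truncations can be compared with it.\<close>

definition N0 :: nat where "N0 = (LEAST N. -1 < Re (p (Suc N)))"

text \<open>Cutting off the expansion but not \<open>u\<close> gives two clean regimes: near 0 the
  bounds of \<open>SP\<close> apply unchanged, and beyond the support of \<open>w\<close> only
  \<open>u\<close> is left, which coincides there with a Schwartz function.\<close>

definition rem :: "nat \<Rightarrow> real \<Rightarrow> complex" where "rem N x = u x - wc x * expsum p m a N x"

lemma Re_p_unbounded: "\<exists>N\<ge>M. B < Re (p N)"
proof -
  have "\<forall>\<^sub>F j in sequentially. B < Re (p j) \<and> M \<le> j"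
    using pset eventually_ge_at_top[of M]
    by (intro eventually_conj) (auto simp: power_set_def filterlim_at_top_dense)
  then show ?thesis by (auto dest: eventually_happens)
qed

lemma N0: "-1 < Re (p (Suc N0))"
proof -
  obtain N where "-1 < Re (p N)" "1 \<le> N" using Re_p_unbounded by blast
  then have "-1 < Re (p (Suc (N - 1)))" by simp
  then show ?thesis unfolding N0_def by (rule LeastI)
qed

lemma eplus_eq: "eplus p m a w u \<phi> = (\<Sum>j\<le>N0. \<Sum>k\<le>m j. a j k * xplus_log (\<lambda>x. wc x * \<phi> x) k (p j))
    + (LBINT x:{0<..}. rem N0 x * \<phi> x)"
  by (simp add: eplus_def N0_def rem_def wc_def scaleR_conv_of_real Let_def)

lemma w_support:
  obtains R e where "0 < R" "\<And>x. R < x \<Longrightarrow> wc x = 0" "0 < e" "\<And>x. \<bar>x\<bar> < e \<Longrightarrow> wc x = 1"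
proof -
  from cutoff obtain R e where "\<forall>x. R \<le> \<bar>x\<bar> \<longrightarrow> w x = 0" "0 < e" "\<forall>x. \<bar>x\<bar> < e \<longrightarrow> w x = 1"
    unfolding cutoff_def by blast
  then show ?thesis
    by (intro that[of "max R 1" e]) (auto simp: wc_def)
qed

lemma wc_smooth: "Cinf_on UNIV wc"
  unfolding wc_def[abs_def]
  by (rule Cinf_on_of_real[OF _ open_UNIV]) (use cutoff in \<open>unfold cutoff_def, blast\<close>)

lemma expsum_smooth: "Cinf_on {0<..} (expsum p m a N)"
  unfolding expsum_def[abs_def]
  by (intro Cinf_on_sum Cinf_on_mult Cinf_on_const Cinf_on_logpow) auto

lemma u_smooth: "Cinf_on {0<..} u"
  using SP unfolding SP_def by blast

lemma rem_smooth: "Cinf_on {0<..} (rem N)"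
  unfolding rem_def[abs_def]
  by (intro Cinf_on_diff Cinf_on_mult u_smooth expsum_smooth Cinf_on_subset[OF wc_smooth]) auto

lemma vd_rem_near_0:
  "\<exists>C. \<forall>\<^sub>F x in at_right 0. norm ((vd ^^ l) (rem N) x) \<le> C * x powr (Re (p (Suc N)) - real l) * \<bar>ln x\<bar> ^ mm"
proof -
  obtain R e where e: "0 < e" "\<And>x. \<bar>x\<bar> < e \<Longrightarrow> wc x = 1" using w_support by metis
  obtain C where C: "\<forall>\<^sub>F x in at_right 0. norm ((vd ^^ l) (\<lambda>y. u y - expsum p m a N y) x)
      \<le> C * x powr (Re (p (Suc N)) - real l) * \<bar>ln x\<bar> ^ mm"
    using SP unfolding SP_def by blast
  have eq: "(vd ^^ l) (\<lambda>y. u y - expsum p m a N y) x = (vd ^^ l) (rem N) x" if "x \<in> {0<..<e}" for x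
    by (rule vd_funpow_cong[where S="{0<..<e}", OF Cinf_on_subset[OF rem_smooth]]) (use that e in \<open>auto simp: rem_def\<close>)
  have "\<forall>\<^sub>F x in at_right 0. x \<in> {0<..<e}"
    by (rule eventually_at_right_real[OF e(1)])
  with C have "\<forall>\<^sub>F x in at_right 0. norm ((vd ^^ l) (rem N) x)
      \<le> C * x powr (Re (p (Suc N)) - real l) * \<bar>ln x\<bar> ^ mm"
    by eventually_elim (simp add: eq)
  then show ?thesis ..
qed

text \<open>An arbitrarily small loss in the exponent pays for the factor
  \<open>\<bar>ln x\<bar> ^ mm\<close>.\<close>

lemma vd_rem_near_0_powr:
  assumes "s < Re (p (Suc N)) - real l"
  shows "\<exists>C. \<forall>\<^sub>F x in at_right 0. norm ((vd ^^ l) (rem N) x) \<le> C * x powr s"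
proof -
  define r where "r = Re (p (Suc N)) - real l"
  \<comment> \<open>Half the gap, so that \<open>r - 2 * d\<close> is exactly \<open>s\<close>; for
    \<open>0 < x < 1\<close> the power with exponent \<open>r + 2 * d\<close> is smaller
    still.\<close>
  define d where "d = (r - s) / 2"
  obtain C where C: "\<forall>\<^sub>F x in at_right 0. norm ((vd ^^ l) (rem N) x) \<le> C * x powr r * \<bar>ln x\<bar> ^ mm"
    using vd_rem_near_0 unfolding r_def by blast
  have d: "0 < d" using assms by (simp add: d_def r_def)
  have "\<forall>\<^sub>F x::real in at_right 0. x \<in> {0<..<1}"
    by (rule eventually_at_right_real) simp
  with C have "\<forall>\<^sub>F x in at_right 0. norm ((vd ^^ l) (rem N) x) \<le> (\<bar>C\<bar> * (2 * (fact mm / d ^ mm))) * x powr s"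
  proof eventually_elim
    case (elim x)
    have "x powr r * \<bar>ln x\<bar> ^ mm \<le> fact mm / d ^ mm * (x powr (r - 2 * d) + x powr (r + 2 * d))"
      using elim d by (intro powr_times_abs_ln_power_le) auto
    also have "\<dots> \<le> fact mm / d ^ mm * (x powr s + x powr s)"
      using elim d by (intro mult_left_mono add_mono powr_mono') (auto simp: d_def field_simps)
    finally have *: "x powr r * \<bar>ln x\<bar> ^ mm \<le> 2 * (fact mm / d ^ mm) * x powr s"
      by (simp add: mult_ac)
    have "norm ((vd ^^ l) (rem N) x) \<le> C * (x powr r * \<bar>ln x\<bar> ^ mm)"
      using elim by (simp add: mult_ac)
    also have "\<dots> \<le> \<bar>C\<bar> * (x powr r * \<bar>ln x\<bar> ^ mm)"
      by (intro mult_right_mono) auto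
    also have "\<dots> \<le> \<bar>C\<bar> * (2 * (fact mm / d ^ mm) * x powr s)"
      using * by (intro mult_left_mono) auto
    finally show ?case by (simp add: mult_ac)
  qed
  then show ?thesis ..
qed

lemma vd_rem_at_top: "\<exists>C. \<forall>\<^sub>F x in at_top. norm ((vd ^^ l) (rem N) x) \<le> C * x powr -2"
proof -
  define v where "v x = (if 0 < x then (1 - w x) *\<^sub>R u x else 0)" for x
  obtain R where R: "0 < R" "\<And>x. R < x \<Longrightarrow> wc x = 0" using w_support by metis
  have "schwartz v" using SP by (simp add: SP_def v_def[abs_def])
  then obtain C where C: "\<And>x. \<bar>x\<bar> ^ 2 * norm ((vd ^^ l) v x) \<le> C"
    unfolding schwartz_def by blast
  have eq: "(vd ^^ l) v x = (vd ^^ l) (rem N) x" if "x \<in> {R<..}" for x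
    by (rule vd_funpow_cong[where S="{R<..}", OF Cinf_on_subset[OF rem_smooth]])
       (use that R in \<open>auto simp: rem_def v_def wc_def scaleR_conv_of_real\<close>)
  have "\<forall>\<^sub>F x in at_top. norm ((vd ^^ l) (rem N) x) \<le> C * x powr -2"
    using eventually_gt_at_top[of R]
  proof eventually_elim
    case (elim x)
    then have "norm ((vd ^^ l) (rem N) x) * x ^ 2 \<le> C"
      using C[of x] eq[of x] by (simp add: mult.commute)
    then show ?case using elim R
      by (simp add: powr_minus powr_numeral field_simps)
  qed
  then show ?thesis ..
qed

lemma set_integrable_vd_rem:
  assumes "-1 < Re (p (Suc N)) - real l"
  shows "set_integrable lborel {0<..} ((vd ^^ l) (rem N))"
proof -
  obtain s where s: "-1 < s" "s < Re (p (Suc N)) - real l"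
    using dense[OF assms] by auto
  from vd_rem_near_0_powr[OF s(2)] obtain C
    where C: "\<forall>\<^sub>F x in at_right 0. norm ((vd ^^ l) (rem N) x) \<le> C * x powr s" ..
  obtain D where D: "\<forall>\<^sub>F x in at_top. norm ((vd ^^ l) (rem N) x) \<le> D * x powr -2"
    using vd_rem_at_top ..
  show ?thesis
    by (rule set_integrable_Ioi_powr_bounds[OF Cinf_on_continuous[OF rem_smooth] s(1) _ C D]) simp
qed

lemma
  assumes "Cinf_on UNIV \<phi>"
  shows wc_times_smooth: "Cinf_on UNIV (\<lambda>x. wc x * \<phi> x)"
    and wc_times_support: "\<exists>R. \<forall>x>R. wc x * \<phi> x = 0"
proof -
  show "Cinf_on UNIV (\<lambda>x. wc x * \<phi> x)"
    by (intro Cinf_on_mult wc_smooth assms) simp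
  show "\<exists>R. \<forall>x>R. wc x * \<phi> x = 0"
    using w_support by (metis mult_zero_left)
qed

text \<open>All irregularity goes into fixed integrable weights. The Leibniz rule splits the
  derivatives of \<open>wc x * \<phi> x\<close>, and the part that falls on the cut-off joins the
  weight; this is why bounded derivatives of \<open>\<phi>\<close> suffice, without decay.\<close>

lemma eplus_representation:
  obtains L G where "\<And>l. l \<le> L \<Longrightarrow> set_integrable lborel {0<..} (G l)"
    and "\<And>\<phi>. Cinf_on UNIV \<phi> \<Longrightarrow> (\<And>l. \<exists>B. \<forall>x>0. norm ((vd ^^ l) \<phi> x) \<le> B) \<Longrightarrow>
      eplus p m a w u \<phi> = (\<Sum>l\<le>L. LBINT x:{0<..}. G l x * (vd ^^ l) \<phi> x)"
proof -
  \<comment> \<open>\<open>Re (p 0)\<close> is the smallest real part, so one order \<open>n\<close>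
    of integration by parts serves every term.\<close>
  obtain n :: nat where "-1 - Re (p 0) < real n"
    using reals_Archimedean2 by blast
  then have n: "-1 - real n < Re (p j)" for j
    using Re_p_mono[of 0 j] by simp
  \<comment> \<open>Both properties of a weight are bundled so that the weights for all pairs of
    indices can be chosen at once.\<close>
  define P where "P i W \<longleftrightarrow> (\<forall>\<Phi> R. continuous_on UNIV \<Phi> \<longrightarrow> (\<forall>x>R. \<Phi> x = 0) \<longrightarrow>
            set_integrable lborel {0<..} (\<lambda>x. W x * \<Phi> x))
      \<and> (\<forall>\<psi> R. Cinf_on UNIV \<psi> \<longrightarrow> (\<forall>x>R. \<psi> x = 0) \<longrightarrow>
            xplus_log \<psi> (snd i) (p (fst i)) = (LBINT x:{0<..}. W x * (vd ^^ n) \<psi> x))"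
    for i :: "nat \<times> nat" and W
  have "\<exists>W. P i W" for i
  proof (rule xplus_log_representation[where k="snd i" and q="p (fst i)", OF n p_not_neg_ints])
    fix W
    assume 1: "\<And>\<Phi> R. continuous_on UNIV \<Phi> \<Longrightarrow> (\<And>x. R < x \<Longrightarrow> \<Phi> x = 0)
        \<Longrightarrow> set_integrable lborel {0<..} (\<lambda>x. W x * \<Phi> x)"
      and 2: "\<And>\<psi> R. Cinf_on UNIV \<psi> \<Longrightarrow> (\<And>x. R < x \<Longrightarrow> \<psi> x = 0)
        \<Longrightarrow> xplus_log \<psi> (snd i) (p (fst i)) = (LBINT x:{0<..}. W x * (vd ^^ n) \<psi> x)"
    have "P i W"
      unfolding P_def
    proof (intro conjI allI impI)
      show "set_integrable lborel {0<..} (\<lambda>x. W x * \<Phi> x)"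
        if "continuous_on UNIV \<Phi>" "\<forall>x>R. \<Phi> x = 0" for \<Phi> R
        using that by (intro 1[of _ R]) auto
      show "xplus_log \<psi> (snd i) (p (fst i)) = (LBINT x:{0<..}. W x * (vd ^^ n) \<psi> x)"
        if "Cinf_on UNIV \<psi>" "\<forall>x>R. \<psi> x = 0" for \<psi> R
        using that by (intro 2[of _ R]) auto
    qed
    then show "\<exists>W. P i W" by (rule exI[of "P i"])
  qed
  then have "\<forall>i. \<exists>W. P i W" by (rule allI)
  from choice[OF this] obtain W where PW: "\<forall>i. P i (W i)" by (rule exE)
  have W: "set_integrable lborel {0<..} (\<lambda>x. W i x * \<Phi> x)"
    if "continuous_on UNIV \<Phi>" "\<forall>x>R. \<Phi> x = 0" for i \<Phi> R
    using PW[rule_format, of i, unfolded P_def] that by blast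
  have xW: "xplus_log \<psi> (snd i) (p (fst i)) = (LBINT x:{0<..}. W i x * (vd ^^ n) \<psi> x)"
    if "Cinf_on UNIV \<psi>" "\<forall>x>R. \<psi> x = 0" for i \<psi> R
    using PW[rule_format, of i, unfolded P_def] that by blast
  obtain R where R: "\<And>x. R < x \<Longrightarrow> wc x = 0" using w_support by metis
  define K where "K = Sigma {..N0} (\<lambda>j. {..m j})"
  define c where "c i = a (fst i) (snd i)" for i
  define V where "V i l x = of_nat (n choose l) * (W i x * (vd ^^ (n - l)) wc x)" for i l x
  \<comment> \<open>The remainder is paired with \<open>\<phi>\<close> itself and hence enters only
    at order 0.\<close>
  define d :: "nat \<Rightarrow> complex" where "d l = (if l = 0 then 1 else 0)" for l
  define G where "G l x = (\<Sum>i\<in>K. c i * V i l x) + d l * rem N0 x" for l x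
  have V: "set_integrable lborel {0<..} (V i l)" for i l
    unfolding V_def[abs_def]
    by (intro set_integrable_mult_right W[of _ R] Cinf_on_continuous[OF wc_smooth])
       (use R vd_funpow_eq_0[of R wc] in blast)
  have rem_int: "set_integrable lborel {0<..} (rem N0)"
    using set_integrable_vd_rem[of N0 0] N0 by simp
  show ?thesis
  proof (rule that[of n G])
    show "set_integrable lborel {0<..} (G l)" for l
      unfolding G_def[abs_def] using rem_int
      by (intro set_integral_add(1) set_integrable_sum set_integrable_mult_right V)
    fix \<phi> :: "real \<Rightarrow> complex"
    assume \<phi>: "Cinf_on UNIV \<phi>" and bdd: "\<And>l. \<exists>B. \<forall>x>0. norm ((vd ^^ l) \<phi> x) \<le> B"
    have int: "set_integrable lborel {0<..} (\<lambda>x. f x * (vd ^^ l) \<phi> x)"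
      if "set_integrable lborel {0<..} f" for f l
    proof -
      obtain B where "\<forall>x>0. norm ((vd ^^ l) \<phi> x) \<le> B" using bdd ..
      then show ?thesis
        by (intro set_integrable_mult_bounded[OF that, of _ B]
              continuous_on_subset[OF Cinf_on_continuous[OF \<phi>]]) auto
    qed
    have vd_prod: "(vd ^^ n) (\<lambda>x. wc x * \<phi> x) x
        = (\<Sum>l\<le>n. of_nat (n choose l) * ((vd ^^ l) \<phi> x * (vd ^^ (n - l)) wc x))" for x
      using vd_funpow_mult[OF \<phi> wc_smooth, of x n] by (simp add: mult.commute)
    obtain R' where R': "\<forall>x>R'. wc x * \<phi> x = 0" using wc_times_support[OF \<phi>] ..
    have xlog: "xplus_log (\<lambda>x. wc x * \<phi> x) (snd i) (p (fst i)) = (\<Sum>l\<le>n. LBINT x:{0<..}. V i l x * (vd ^^ l) \<phi> x)" for i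
    proof -
      have "W i x * (vd ^^ n) (\<lambda>x. wc x * \<phi> x) x = (\<Sum>l\<le>n. V i l x * (vd ^^ l) \<phi> x)" for x
        unfolding vd_prod V_def sum_distrib_left by (intro sum.cong refl) (simp add: mult_ac)
      then have "xplus_log (\<lambda>x. wc x * \<phi> x) (snd i) (p (fst i)) = (LBINT x:{0<..}. \<Sum>l\<le>n. V i l x * (vd ^^ l) \<phi> x)"
        using xW[OF wc_times_smooth[OF \<phi>] R', of i] by simp
      also have "\<dots> = (\<Sum>l\<le>n. LBINT x:{0<..}. V i l x * (vd ^^ l) \<phi> x)"
        by (intro set_integral_sum int V)
      finally show ?thesis .
    qed
    have "(\<Sum>l\<le>n. LBINT x:{0<..}. G l x * (vd ^^ l) \<phi> x)
        = (\<Sum>l\<le>n. (\<Sum>i\<in>K. c i * (LBINT x:{0<..}. V i l x * (vd ^^ l) \<phi> x))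
             + d l * (LBINT x:{0<..}. rem N0 x * (vd ^^ l) \<phi> x))"
    proof (rule sum.cong[OF refl])
      fix l
      have "G l x * (vd ^^ l) \<phi> x
        = (\<Sum>i\<in>K. c i * (V i l x * (vd ^^ l) \<phi> x)) + d l * (rem N0 x * (vd ^^ l) \<phi> x)" for x
        by (simp add: G_def distrib_right sum_distrib_right mult.assoc)
      then have "(LBINT x:{0<..}. G l x * (vd ^^ l) \<phi> x)
        = (LBINT x:{0<..}. (\<Sum>i\<in>K. c i * (V i l x * (vd ^^ l) \<phi> x)) + d l * (rem N0 x * (vd ^^ l) \<phi> x))"
        by simp
      also have "\<dots> = (LBINT x:{0<..}. (\<Sum>i\<in>K. c i * (V i l x * (vd ^^ l) \<phi> x)))
          + (LBINT x:{0<..}. d l * (rem N0 x * (vd ^^ l) \<phi> x))"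
        by (intro set_integral_add set_integrable_sum set_integrable_mult_right int V rem_int)
      also have "(LBINT x:{0<..}. (\<Sum>i\<in>K. c i * (V i l x * (vd ^^ l) \<phi> x)))
          = (\<Sum>i\<in>K. LBINT x:{0<..}. c i * (V i l x * (vd ^^ l) \<phi> x))"
        by (intro set_integral_sum set_integrable_mult_right int V)
      finally show "(LBINT x:{0<..}. G l x * (vd ^^ l) \<phi> x)
        = (\<Sum>i\<in>K. c i * (LBINT x:{0<..}. V i l x * (vd ^^ l) \<phi> x))
             + d l * (LBINT x:{0<..}. rem N0 x * (vd ^^ l) \<phi> x)"
        by simp
    qed
    also have "\<dots> = (\<Sum>i\<in>K. c i * xplus_log (\<lambda>x. wc x * \<phi> x) (snd i) (p (fst i))) + (LBINT x:{0<..}. rem N0 x * \<phi> x)"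
      unfolding sum.distrib xlog sum_distrib_left
      by (subst sum.swap) (simp add: d_def if_distrib[of "\<lambda>z. z * _"] cong: if_cong)
    also have "\<dots> = eplus p m a w u \<phi>"
      unfolding eplus_eq K_def c_def by (subst sum.Sigma) (simp_all add: case_prod_unfold)
    finally show "eplus p m a w u \<phi> = (\<Sum>l\<le>n. LBINT x:{0<..}. G l x * (vd ^^ l) \<phi> x)" by simp
  qed
qed

end

section \<open>Laplace and Fourier transforms\<close>

definition laplace :: "(real \<Rightarrow> complex) \<Rightarrow> complex \<Rightarrow> complex" where
  "laplace G z = (LBINT x:{0<..}. G x * exp (- complex_of_real x * z))"

lemma norm_exp_le_1: "0 < x \<Longrightarrow> 0 \<le> Re z \<Longrightarrow> norm (exp (- complex_of_real x * z)) \<le> 1"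
  by simp

lemma set_integrable_laplace:
  assumes "set_integrable lborel {0<..} G" "0 \<le> Re z"
  shows "set_integrable lborel {0<..} (\<lambda>x. G x * exp (- complex_of_real x * z))"
  by (rule set_integrable_mult_bounded[OF assms(1), of _ 1]) (use assms in \<open>auto intro!: continuous_intros\<close>)

lemma norm_laplace_le:
  assumes G: "set_integrable lborel {0<..} G" and z: "0 \<le> Re z"
  shows "norm (laplace G z) \<le> (LBINT x:{0<..}. norm (G x))"
proof -
  have "norm (laplace G z) \<le> (LBINT x:{0<..}. norm (G x * exp (- complex_of_real x * z)))"
    unfolding laplace_def by (rule set_integral_norm_bound[OF set_integrable_laplace[OF assms]])
  also have "\<dots> \<le> (LBINT x:{0<..}. norm (G x))"
  proof (rule set_integral_mono)
    show "norm (G x * exp (- complex_of_real x * z)) \<le> norm (G x)" if "x \<in> {0<..}" for x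
      using mult_left_mono[OF norm_exp_le_1[of x z] norm_ge_zero[of "G x"]] z that by (simp add: norm_mult)
  qed (intro set_integrable_norm set_integrable_laplace assms)+
  finally show ?thesis .
qed

lemma continuous_on_laplace:
  assumes G: "set_integrable lborel {0<..} G"
  shows "continuous_on {z. 0 \<le> Re z} (laplace G)"
  unfolding continuous_on_sequentially
proof (intro allI ballI impI)
  fix X z assume z: "z \<in> {z. 0 \<le> Re z}" and X: "(\<forall>n. X n \<in> {z. 0 \<le> Re z}) \<and> X \<longlonglongrightarrow> z"
  have "(\<lambda>n. laplace G (X n)) \<longlonglongrightarrow> laplace G z"
    unfolding laplace_def set_lebesgue_integral_def
  proof (rule integral_dominated_convergence[where w="\<lambda>x. norm (indicator {0<..} x *\<^sub>R G x)"])
    show "(\<lambda>x. indicator {0<..} x *\<^sub>R (G x * exp (- complex_of_real x * z))) \<in> borel_measurable lborel"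
      using set_integrable_laplace[OF G] z by (simp add: set_integrable_def)
    show "(\<lambda>x. indicator {0<..} x *\<^sub>R (G x * exp (- complex_of_real x * X n))) \<in> borel_measurable lborel" for n
      using set_integrable_laplace[OF G] X by (simp add: set_integrable_def)
    show "integrable lborel (\<lambda>x. norm (indicator {0<..} x *\<^sub>R G x))"
      using G unfolding set_integrable_def by (rule integrable_norm)
    show "AE x in lborel. (\<lambda>n. indicator {0<..} x *\<^sub>R (G x * exp (- complex_of_real x * X n)))
        \<longlonglongrightarrow> indicator {0<..} x *\<^sub>R (G x * exp (- complex_of_real x * z))"
      using X by (intro AE_I2 tendsto_intros) auto
    show "AE x in lborel. norm (indicator {0<..} x *\<^sub>R (G x * exp (- complex_of_real x * X n)))
        \<le> norm (indicator {0<..} x *\<^sub>R G x)" for n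
    proof (intro AE_I2)
      fix x
      show "norm (indicator {0<..} x *\<^sub>R (G x * exp (- complex_of_real x * X n))) \<le> norm (indicator {0<..} x *\<^sub>R G x)"
        using mult_left_mono[OF norm_exp_le_1[of x "X n"] norm_ge_zero[of "G x"]] X
        by (cases "0 < x") (auto simp: norm_mult)
    qed
  qed
  then show "(laplace G \<circ> X) \<longlonglongrightarrow> laplace G z" by (simp add: o_def)
qed

text \<open>No first moment of \<open>G\<close> is available. On a ball where
  \<open>Re y > Re z / 2\<close>, the inequality \<open>t \<le> exp t\<close> at
  \<open>t = x * (Re z / 2)\<close> lets the exponential absorb the factor \<open>x\<close>.\<close>

lemma has_field_derivative_laplace:
  assumes G: "set_integrable lborel {0<..} G" and z: "0 < Re z"
  shows "(laplace G has_field_derivative (LBINT x:{0<..}. - complex_of_real x * (G x * exp (- complex_of_real x * z)))) (at z)"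
  unfolding laplace_def[abs_def]
proof (rule has_field_derivative_set_integral[where r="Re z / 2" and
      d="\<lambda>z x. - complex_of_real x * (G x * exp (- complex_of_real x * z))" and g="\<lambda>x. 2 / Re z * norm (G x)"])
  have Re: "Re z / 2 < Re y" if "y \<in> ball z (Re z / 2)" for y
    using that abs_Re_le_cmod[of "z - y"] by (simp add: dist_norm)
  show "set_integrable lborel {0<..} (\<lambda>x. G x * exp (- complex_of_real x * y))" if "y \<in> ball z (Re z / 2)" for y
    using Re[OF that] z by (intro set_integrable_laplace G) simp
  have "(\<lambda>x. indicator {0<..} x *\<^sub>R (G x * exp (- complex_of_real x * z))) \<in> borel_measurable lborel"
    using set_integrable_laplace[OF G] z by (simp add: set_integrable_def)
  then have "(\<lambda>x. - complex_of_real x * (indicator {0<..} x *\<^sub>R (G x * exp (- complex_of_real x * z)))) \<in> borel_measurable lborel"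
    by (intro borel_measurable_times) auto
  then show "set_borel_measurable lborel {0<..} (\<lambda>x. - complex_of_real x * (G x * exp (- complex_of_real x * z)))"
    by (simp add: set_borel_measurable_def)
  show "set_integrable lborel {0<..} (\<lambda>x. 2 / Re z * norm (G x))"
    by (intro set_integrable_mult_right set_integrable_norm G)
  fix x :: real and y assume x: "x \<in> {0<..}" and y: "y \<in> ball z (Re z / 2)"
  show "((\<lambda>y. G x * exp (- complex_of_real x * y)) has_field_derivative
      - complex_of_real x * (G x * exp (- complex_of_real x * y))) (at y)"
    by (auto intro!: derivative_eq_intros)
  have "x * (Re z / 2) \<le> exp (x * (Re z / 2))"
    using exp_ge_add_one_self[of "x * (Re z / 2)"] by linarith
  also have "\<dots> \<le> exp (x * Re y)"
    using Re[OF y] x by simp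
  finally have "x * exp (- (x * Re y)) \<le> 2 / Re z"
    using z by (simp add: exp_minus field_simps)
  from mult_left_mono[OF this norm_ge_zero[of "G x"]]
  show "norm (- complex_of_real x * (G x * exp (- complex_of_real x * y))) \<le> 2 / Re z * norm (G x)"
    using x by (simp add: norm_mult mult_ac)
qed (use z in simp)

lemma holomorphic_on_laplace:
  assumes "set_integrable lborel {0<..} G"
  shows "laplace G holomorphic_on {z. 0 < Re z}"
  using has_field_derivative_laplace[OF assms]
  by (auto simp: holomorphic_on_open open_halfspace_Re_gt)

section \<open>Fourier transforms of Schwartz functions as test functions\<close>

lemma schwartz_integrable_power:
  assumes "schwartz \<phi>"
  shows "integrable lborel (\<lambda>\<xi>. complex_of_real \<xi> ^ l * \<phi> \<xi>)"
proof -
  have "\<exists>C. \<forall>x. \<bar>x\<bar> ^ k * norm (\<phi> x) \<le> C" for k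
    using assms unfolding schwartz_def by (metis funpow_0)
  then obtain C where C: "\<And>k x. \<bar>x\<bar> ^ k * norm (\<phi> x) \<le> C k" by metis
  have cont: "continuous_on UNIV \<phi>"
    using assms Cinf_on_continuous[of UNIV \<phi> 0] by (simp add: schwartz_def)
  have "integrable lborel (\<lambda>x::real. inverse (1 + x^2))"
    using integrable_inverse_1_plus_square by (simp add: set_integrable_def)
  \<comment> \<open>The two constants bound the two summands of
    \<open>\<bar>x\<bar> ^ l * norm (\<phi> x) * (1 + x^2)\<close>.\<close>
  then have int: "integrable lborel (\<lambda>x::real. (C l + C (l + 2)) * inverse (1 + x^2))"
    by simp
  show ?thesis
  proof (rule Bochner_Integration.integrable_bound[OF int])
    have "continuous_on UNIV (\<lambda>\<xi>. complex_of_real \<xi> ^ l * \<phi> \<xi>)"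
      by (intro continuous_intros cont)
    then show "(\<lambda>\<xi>. complex_of_real \<xi> ^ l * \<phi> \<xi>) \<in> borel_measurable lborel"
      by (simp add: borel_measurable_continuous_onI)
    show "AE x in lborel. norm (complex_of_real x ^ l * \<phi> x) \<le> norm ((C l + C (l + 2)) * inverse (1 + x\<^sup>2))"
    proof (intro AE_I2)
      fix x :: real
      have pos: "0 < 1 + x^2" by (simp add: add_pos_nonneg)
      have "\<bar>x\<bar> ^ l * norm (\<phi> x) * (1 + x^2) = \<bar>x\<bar> ^ l * norm (\<phi> x) + \<bar>x\<bar> ^ (l + 2) * norm (\<phi> x)"
        by (simp add: power_add power2_eq_square algebra_simps)
      also have "\<dots> \<le> C l + C (l + 2)" by (intro add_mono C)
      finally have "\<bar>x\<bar> ^ l * norm (\<phi> x) \<le> (C l + C (l + 2)) * inverse (1 + x^2)"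
        using pos by (simp add: field_simps)
      then show "norm (complex_of_real x ^ l * \<phi> x) \<le> norm ((C l + C (l + 2)) * inverse (1 + x\<^sup>2))"
        by (simp add: norm_mult norm_power)
    qed
  qed
qed

lemma schwartz_integrable_power':
  assumes "schwartz \<phi>"
  shows "integrable lborel (\<lambda>\<xi>. (- \<i> * complex_of_real \<xi>) ^ l * \<phi> \<xi>)"
proof -
  have "integrable lborel (\<lambda>\<xi>. (- \<i>) ^ l * (complex_of_real \<xi> ^ l * \<phi> \<xi>))"
    by (intro integrable_mult_right schwartz_integrable_power assms)
  then show ?thesis
    by (simp only: power_mult_distrib mult.assoc)
qed

lemma norm_exp_ii [simp]: "norm (exp (- \<i> * complex_of_real x * complex_of_real y)) = 1"
  by (simp add: norm_exp_eq_Re)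

lemma integrable_exp_ii_mult:
  assumes "integrable lborel \<psi>"
  shows "integrable lborel (\<lambda>\<xi>. exp (- \<i> * complex_of_real x * complex_of_real \<xi>) * \<psi> \<xi>)"
proof (rule Bochner_Integration.integrable_bound[OF assms])
  have "(\<lambda>\<xi>. exp (- \<i> * complex_of_real x * complex_of_real \<xi>)) \<in> borel_measurable borel"
    by (intro borel_measurable_continuous_onI continuous_intros)
  then show "(\<lambda>\<xi>. exp (- \<i> * complex_of_real x * complex_of_real \<xi>) * \<psi> \<xi>) \<in> borel_measurable lborel"
    using assms by (intro borel_measurable_times) auto
qed (simp add: norm_mult del: mult_minus_left)

lemma has_vector_derivative_fourier_integral:
  assumes "schwartz \<phi>"
  shows "((\<lambda>x. LBINT \<xi>. exp (- \<i> * complex_of_real x * complex_of_real \<xi>) * ((- \<i> * complex_of_real \<xi>) ^ l * \<phi> \<xi>))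
    has_vector_derivative (LBINT \<xi>. exp (- \<i> * complex_of_real x * complex_of_real \<xi>) * ((- \<i> * complex_of_real \<xi>) ^ Suc l * \<phi> \<xi>))) (at x)"
  unfolding has_vector_derivative_def
proof (rule has_derivative_integral_parametric[where r=1 and g="\<lambda>\<xi>. norm ((- \<i> * complex_of_real \<xi>) ^ Suc l * \<phi> \<xi>)"
    and d="\<lambda>x \<xi>. exp (- \<i> * complex_of_real x * complex_of_real \<xi>) * ((- \<i> * complex_of_real \<xi>) ^ Suc l * \<phi> \<xi>)"])
  show "bounded_bilinear (scaleR :: real \<Rightarrow> complex \<Rightarrow> complex)" by (rule bounded_bilinear_scaleR)
  show "integrable lborel (\<lambda>\<xi>. exp (- \<i> * complex_of_real y * complex_of_real \<xi>) * ((- \<i> * complex_of_real \<xi>) ^ l * \<phi> \<xi>))" for y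
    by (intro integrable_exp_ii_mult schwartz_integrable_power' assms)
  show "(\<lambda>\<xi>. exp (- \<i> * complex_of_real x * complex_of_real \<xi>) * ((- \<i> * complex_of_real \<xi>) ^ Suc l * \<phi> \<xi>)) \<in> borel_measurable lborel"
    by (rule borel_measurable_integrable, intro integrable_exp_ii_mult schwartz_integrable_power' assms)
  show "integrable lborel (\<lambda>\<xi>. norm ((- \<i> * complex_of_real \<xi>) ^ Suc l * \<phi> \<xi>))"
    by (intro integrable_norm schwartz_integrable_power' assms)
  show "norm (exp (- \<i> * complex_of_real y * complex_of_real \<xi>) * ((- \<i> * complex_of_real \<xi>) ^ Suc l * \<phi> \<xi>))
      \<le> norm ((- \<i> * complex_of_real \<xi>) ^ Suc l * \<phi> \<xi>)" for y \<xi>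
    by (subst norm_mult) (simp only: norm_exp_ii mult_1)
  fix \<xi> y
  have "((\<lambda>y. exp (- \<i> * y * complex_of_real \<xi>) * ((- \<i> * complex_of_real \<xi>) ^ l * \<phi> \<xi>)) has_field_derivative
      exp (- \<i> * complex_of_real y * complex_of_real \<xi>) * ((- \<i> * complex_of_real \<xi>) ^ Suc l * \<phi> \<xi>)) (at (complex_of_real y))"
    by (auto intro!: derivative_eq_intros)
  from has_vector_derivative_real_field[OF this]
  show "((\<lambda>y. exp (- \<i> * complex_of_real y * complex_of_real \<xi>) * ((- \<i> * complex_of_real \<xi>) ^ l * \<phi> \<xi>))
      has_derivative (\<lambda>h. h *\<^sub>R (exp (- \<i> * complex_of_real y * complex_of_real \<xi>) * ((- \<i> * complex_of_real \<xi>) ^ Suc l * \<phi> \<xi>)))) (at y)"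
    by (simp add: has_vector_derivative_def)
qed simp

lemma
  assumes "schwartz \<phi>"
  shows fourier_smooth: "Cinf_on UNIV (fourier \<phi>)"
    and vd_fourier: "(vd ^^ l) (fourier \<phi>) x = complex_of_real (1 / sqrt (2 * pi)) *
      (LBINT \<xi>. exp (- \<i> * complex_of_real x * complex_of_real \<xi>) * ((- \<i> * complex_of_real \<xi>) ^ l * \<phi> \<xi>))"
proof -
  define D where "D l x = complex_of_real (1 / sqrt (2 * pi)) *
      (LBINT \<xi>. exp (- \<i> * complex_of_real x * complex_of_real \<xi>) * ((- \<i> * complex_of_real \<xi>) ^ l * \<phi> \<xi>))" for l x
  have D: "(D l has_vector_derivative D (Suc l) x) (at x)" for l x
    unfolding D_def by (intro has_vector_derivative_mult_right has_vector_derivative_fourier_integral assms)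
  have D0: "D 0 x = fourier \<phi> x" for x
    by (simp add: D_def fourier_def mult_ac)
  show "Cinf_on UNIV (fourier \<phi>)"
    by (rule Cinf_onI[where D=D]) (auto simp: D0 D)
  show "(vd ^^ l) (fourier \<phi>) x = complex_of_real (1 / sqrt (2 * pi)) *
      (LBINT \<xi>. exp (- \<i> * complex_of_real x * complex_of_real \<xi>) * ((- \<i> * complex_of_real \<xi>) ^ l * \<phi> \<xi>))"
    unfolding D_def[symmetric] by (rule vd_funpow_eqI[where S=UNIV and D=D]) (auto simp: D0 D)
qed

text \<open>Together with smoothness this is what \<open>eplus_representation\<close> asks of a test
  function, so the extension can be evaluated on Fourier transforms.\<close>

lemma vd_fourier_bounded:
  assumes "schwartz \<phi>"
  shows "\<exists>B. \<forall>x>0. norm ((vd ^^ l) (fourier \<phi>) x) \<le> B"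
proof (intro exI allI impI)
  fix x :: real
  have "norm (LBINT \<xi>. exp (- \<i> * complex_of_real x * complex_of_real \<xi>) * ((- \<i> * complex_of_real \<xi>) ^ l * \<phi> \<xi>))
      \<le> (LBINT \<xi>. norm (exp (- \<i> * complex_of_real x * complex_of_real \<xi>) * ((- \<i> * complex_of_real \<xi>) ^ l * \<phi> \<xi>)))"
    by (rule integral_norm_bound)
  also have "\<dots> = (LBINT \<xi>. norm ((- \<i> * complex_of_real \<xi>) ^ l * \<phi> \<xi>))"
    unfolding norm_mult[of "exp _"] norm_exp_ii by simp
  finally show "norm ((vd ^^ l) (fourier \<phi>) x) \<le> norm (complex_of_real (1 / sqrt (2 * pi))) *
      (LBINT \<xi>. norm ((- \<i> * complex_of_real \<xi>) ^ l * \<phi> \<xi>))"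
    unfolding vd_fourier[OF assms] norm_mult[of "complex_of_real _"] by (intro mult_left_mono) auto
qed

text \<open>Transfers the Fourier transform from the test function to the weight. The exponential is
  unimodular, so absolute integrability reduces to that of
  \<open>norm (g x) * norm (\<psi> \<xi>)\<close>.\<close>

lemma fubini_laplace_fourier:
  assumes G: "set_integrable lborel {0<..} G" and \<psi>: "integrable lborel \<psi>"
  shows "(LBINT x:{0<..}. G x * (LBINT \<xi>. exp (- \<i> * complex_of_real x * complex_of_real \<xi>) * \<psi> \<xi>))
    = (LBINT \<xi>. laplace G (\<i> * complex_of_real \<xi>) * \<psi> \<xi>)"
proof -
  define g where "g x = indicator {0<..} x *\<^sub>R G x" for x
  define F where "F x \<xi> = g x * (exp (- \<i> * complex_of_real x * complex_of_real \<xi>) * \<psi> \<xi>)" for x \<xi>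
  have g: "integrable lborel g" using G by (simp add: set_integrable_def g_def[abs_def])
  have [measurable]: "g \<in> borel_measurable borel" "\<psi> \<in> borel_measurable borel"
    using g \<psi> by auto
  have nF: "norm (F x \<xi>) = norm (g x) * norm (\<psi> \<xi>)" for x \<xi>
    unfolding F_def norm_mult norm_exp_ii by simp
  have "integrable (lborel \<Otimes>\<^sub>M lborel) (case_prod F)"
  proof (rule lborel_pair.Fubini_integrable)
    show "case_prod F \<in> borel_measurable (lborel \<Otimes>\<^sub>M lborel)"
      unfolding F_def by measurable
    have "integrable lborel (\<lambda>x. norm (g x) * (LBINT \<xi>. norm (\<psi> \<xi>)))"
      using g by simp
    then show "integrable lborel (\<lambda>x. LBINT \<xi>. norm (case_prod F (x, \<xi>)))"
      by (simp add: nF)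
    show "AE x in lborel. integrable lborel (\<lambda>\<xi>. case_prod F (x, \<xi>))"
      unfolding F_def prod.case by (intro AE_I2 integrable_mult_right integrable_exp_ii_mult \<psi>)
  qed
  from lborel_pair.Fubini_integral[OF this]
  have "(LBINT \<xi>. LBINT x. F x \<xi>) = (LBINT x. LBINT \<xi>. F x \<xi>)" .
  moreover have "(LBINT x. LBINT \<xi>. F x \<xi>)
      = (LBINT x:{0<..}. G x * (LBINT \<xi>. exp (- \<i> * complex_of_real x * complex_of_real \<xi>) * \<psi> \<xi>))"
    by (simp add: F_def g_def set_lebesgue_integral_def)
  moreover have "(LBINT x. F x \<xi>) = laplace G (\<i> * complex_of_real \<xi>) * \<psi> \<xi>" for \<xi>
  proof -
    have "F x \<xi> = indicator {0<..} x *\<^sub>R (G x * exp (- complex_of_real x * (\<i> * complex_of_real \<xi>))) * \<psi> \<xi>" for x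
      by (simp add: F_def g_def mult_ac)
    then show ?thesis
      by (simp only: laplace_def set_lebesgue_integral_def integral_mult_left_zero)
  qed
  ultimately show ?thesis by simp
qed

text \<open>Reduces polynomial growth of degree \<open>M\<close> to the moments of order 0 and
  \<open>M\<close>: below \<open>t = 2\<close> the base is at most 4, above it at most
  \<open>2 * t\<close>.\<close>

lemma two_plus_power_le:
  fixes t :: real
  assumes "0 \<le> t"
  shows "(2 + t) ^ M \<le> 4 ^ M + 2 ^ M * t ^ M"
proof (cases "t \<le> 2")
  case True
  then have "(2 + t) ^ M \<le> 4 ^ M" using assms by (intro power_mono) auto
  then show ?thesis using assms by (simp add: add_increasing2)
next
  case False
  then have "(2 + t) ^ M \<le> (2 * t) ^ M" using assms by (intro power_mono) auto
  then show ?thesis by (simp add: power_mult_distrib add_increasing)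
qed

section \<open>The extension evaluated on exponentials\<close>

context half_line_expansion
begin

text \<open>The last property identifies the values of \<open>H\<close> on the imaginary axis with
  the density of the Fourier transform, so that the boundary limit in (i) and the expansion in (iii)
  concern the same function.\<close>

lemma eplus_exp:
  obtains H where "H holomorphic_on {z. 0 < Re z}" and "continuous_on {z. 0 \<le> Re z} H"
    and "\<exists>C>0. \<exists>M::nat. \<forall>z. 0 \<le> Re z \<longrightarrow> norm (H z) \<le> C * (1 + norm z) ^ M"
    and "\<forall>z. 0 \<le> Re z \<longrightarrow> eplus p m a w u (\<lambda>x. exp (- complex_of_real x * z)) = H z"
    and "\<forall>\<phi>. schwartz \<phi> \<longrightarrow> FT (eplus p m a w u) \<phi> =
      (LBINT \<xi>. complex_of_real (1 / sqrt (2 * pi)) * H (\<i> * complex_of_real \<xi>) * \<phi> \<xi>)"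
proof (rule eplus_representation)
  fix L G assume G: "\<And>l. l \<le> L \<Longrightarrow> set_integrable lborel {0<..} (G l)"
    and rep: "\<And>\<phi>. Cinf_on UNIV \<phi> \<Longrightarrow> (\<And>l. \<exists>B. \<forall>x>0. norm ((vd ^^ l) \<phi> x) \<le> B) \<Longrightarrow>
      eplus p m a w u \<phi> = (\<Sum>l\<le>L. LBINT x:{0<..}. G l x * (vd ^^ l) \<phi> x)"
  define H where "H z = (\<Sum>l\<le>L. (- z) ^ l * laplace (G l) z)" for z
  define c where "c = complex_of_real (1 / sqrt (2 * pi))"
  show thesis
  proof (rule that[of H])
    show "H holomorphic_on {z. 0 < Re z}"
      unfolding H_def[abs_def] using G
      by (intro holomorphic_on_sum holomorphic_on_mult holomorphic_on_laplace holomorphic_intros) auto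
    show "continuous_on {z. 0 \<le> Re z} H"
      unfolding H_def[abs_def] using G
      by (intro continuous_intros continuous_on_laplace) auto
    define B where "B = (\<Sum>l\<le>L. LBINT x:{0<..}. norm (G l x))"
    have Gpos: "0 \<le> (LBINT x:{0<..}. norm (G l x))" for l
      unfolding set_lebesgue_integral_def by (rule integral_nonneg_AE) (simp add: indicator_def)
    have "0 \<le> B" unfolding B_def by (intro sum_nonneg Gpos)
    have "norm (H z) \<le> (B + 1) * (1 + norm z) ^ L" if z: "0 \<le> Re z" for z
    proof -
      have "norm (H z) \<le> (\<Sum>l\<le>L. norm ((- z) ^ l * laplace (G l) z))"
        unfolding H_def by (rule norm_sum)
      also have "\<dots> \<le> (\<Sum>l\<le>L. (1 + norm z) ^ L * (LBINT x:{0<..}. norm (G l x)))"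
      proof (rule sum_mono)
        fix l assume l: "l \<in> {..L}"
        have "norm ((- z) ^ l) \<le> (1 + norm z) ^ l"
          by (simp add: norm_power power_mono)
        also have "\<dots> \<le> (1 + norm z) ^ L"
          using l by (intro power_increasing) auto
        finally show "norm ((- z) ^ l * laplace (G l) z) \<le> (1 + norm z) ^ L * (LBINT x:{0<..}. norm (G l x))"
          unfolding norm_mult using l z G by (intro mult_mono norm_laplace_le) auto
      qed
      also have "\<dots> = (1 + norm z) ^ L * B"
        by (simp add: B_def sum_distrib_left)
      \<comment> \<open>Adding 1 makes the constant positive even if every weight vanishes.\<close>
      also have "\<dots> \<le> (B + 1) * (1 + norm z) ^ L"
        by (simp add: algebra_simps)
      finally show ?thesis .
    qed
    then show "\<exists>C>0. \<exists>M::nat. \<forall>z. 0 \<le> Re z \<longrightarrow> norm (H z) \<le> C * (1 + norm z) ^ M"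
      using \<open>0 \<le> B\<close> by (intro exI[of _ "B + 1"] conjI exI[of _ L]) auto
    show "\<forall>z. 0 \<le> Re z \<longrightarrow> eplus p m a w u (\<lambda>x. exp (- complex_of_real x * z)) = H z"
    proof (intro allI impI)
      fix z :: complex assume z: "0 \<le> Re z"
      have "\<exists>B. \<forall>x>0. norm ((vd ^^ l) (\<lambda>x. exp (- complex_of_real x * z)) x) \<le> B" for l
      proof (intro exI allI impI)
        fix x :: real assume "0 < x"
        then show "norm ((vd ^^ l) (\<lambda>x. exp (- complex_of_real x * z)) x) \<le> norm ((- z) ^ l) * 1"
          unfolding vd_funpow_exp norm_mult using z by (intro mult_left_mono norm_exp_le_1) auto
      qed
      from rep[OF Cinf_on_exp this] show "eplus p m a w u (\<lambda>x. exp (- complex_of_real x * z)) = H z"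
        unfolding vd_funpow_exp H_def laplace_def
        by (simp only: mult.left_commute[of "G _ _"] set_integral_mult_right)
    qed
    show "\<forall>\<phi>. schwartz \<phi> \<longrightarrow> FT (eplus p m a w u) \<phi> =
      (LBINT \<xi>. complex_of_real (1 / sqrt (2 * pi)) * H (\<i> * complex_of_real \<xi>) * \<phi> \<xi>)"
    proof (intro allI impI)
      fix \<phi> assume \<phi>: "schwartz \<phi>"
      \<comment> \<open>Differentiating \<open>fourier \<phi>\<close> \<open>l\<close> times
        multiplies \<open>\<phi>\<close> by this power, which is also the factor
        \<open>(- z) ^ l\<close> of \<open>H\<close> at \<open>z = \<i> * \<xi>\<close>.\<close>
      define \<psi> where "\<psi> l \<xi> = (- \<i> * complex_of_real \<xi>) ^ l * \<phi> \<xi>" for l \<xi>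
      have \<psi>: "integrable lborel (\<psi> l)" for l
        unfolding \<psi>_def by (rule schwartz_integrable_power'[OF \<phi>])
      have int: "integrable lborel (\<lambda>\<xi>. laplace (G l) (\<i> * complex_of_real \<xi>) * \<psi> l \<xi>)" if "l \<le> L" for l
      proof (rule Bochner_Integration.integrable_bound)
        show "integrable lborel (\<lambda>\<xi>. (LBINT x:{0<..}. norm (G l x)) * norm (\<psi> l \<xi>))"
          by (intro integrable_mult_right integrable_norm \<psi>)
        have "continuous_on UNIV (laplace (G l) \<circ> (\<lambda>\<xi>. \<i> * complex_of_real \<xi>))"
          by (intro continuous_on_compose continuous_intros continuous_on_subset[OF continuous_on_laplace[OF G[OF that]]]) auto
        then have "(\<lambda>\<xi>. laplace (G l) (\<i> * complex_of_real \<xi>)) \<in> borel_measurable borel"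
          by (simp add: borel_measurable_continuous_onI o_def)
        then show "(\<lambda>\<xi>. laplace (G l) (\<i> * complex_of_real \<xi>) * \<psi> l \<xi>) \<in> borel_measurable lborel"
          using \<psi>[of l] by (intro borel_measurable_times) auto
        show "AE \<xi> in lborel. norm (laplace (G l) (\<i> * complex_of_real \<xi>) * \<psi> l \<xi>)
            \<le> norm ((LBINT x:{0<..}. norm (G l x)) * norm (\<psi> l \<xi>))"
          using Gpos[of l] norm_laplace_le[OF G[OF that]]
          by (auto intro!: AE_I2 mult_right_mono simp: norm_mult)
      qed
      have "FT (eplus p m a w u) \<phi> = (\<Sum>l\<le>L. LBINT x:{0<..}. G l x * (vd ^^ l) (fourier \<phi>) x)"
        unfolding FT_def by (rule rep[OF fourier_smooth[OF \<phi>] vd_fourier_bounded[OF \<phi>]])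
      also have "\<dots> = (\<Sum>l\<le>L. c * (LBINT x:{0<..}. G l x *
          (LBINT \<xi>. exp (- \<i> * complex_of_real x * complex_of_real \<xi>) * \<psi> l \<xi>)))"
        unfolding vd_fourier[OF \<phi>] \<psi>_def c_def[symmetric]
        by (simp only: mult.left_commute[of "G _ _"] set_integral_mult_right)
      also have "\<dots> = (\<Sum>l\<le>L. c * (LBINT \<xi>. laplace (G l) (\<i> * complex_of_real \<xi>) * \<psi> l \<xi>))"
        by (intro sum.cong refl arg_cong[where f="(*) c"] fubini_laplace_fourier G \<psi>) auto
      also have "\<dots> = (LBINT \<xi>. c * (\<Sum>l\<le>L. laplace (G l) (\<i> * complex_of_real \<xi>) * \<psi> l \<xi>))"
        using int by (simp add: sum_distrib_left)
      also have "\<dots> = (LBINT \<xi>. c * H (\<i> * complex_of_real \<xi>) * \<phi> \<xi>)"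
        by (simp add: H_def \<psi>_def sum_distrib_left sum_distrib_right mult_ac)
      finally show "FT (eplus p m a w u) \<phi> =
          (LBINT \<xi>. complex_of_real (1 / sqrt (2 * pi)) * H (\<i> * complex_of_real \<xi>) * \<phi> \<xi>)"
        by (simp add: c_def)
    qed
  qed
qed

end

section \<open>Decay of Laplace transforms\<close>

lemma powr_times_exp_eventually_le:
  fixes s r C :: real
  assumes "0 < r"
  shows "\<forall>\<^sub>F x in at_top. C * x powr s * exp (- (x * r)) \<le> 1 * x powr -2"
proof -
  have "((\<lambda>x. C * x powr s * exp (- (x * r)) * x powr 2) \<longlongrightarrow> 0) at_top"
    using assms by real_asymp
  then have "\<forall>\<^sub>F x in at_top. C * x powr s * exp (- (x * r)) * x powr 2 < 1"
    by (rule order_tendstoD) simp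
  then show ?thesis
    using eventually_gt_at_top[of 0]
    by eventually_elim (simp add: powr_minus field_simps)
qed

text \<open>For \<open>Re z > 0\<close> the exponential beats every power at infinity, so
  \<open>t\<close> is unrestricted.\<close>

lemma set_integrable_times_exp:
  fixes f :: "real \<Rightarrow> complex"
  assumes f: "continuous_on {0<..} f" and s: "-1 < s" and z: "0 < Re z"
    and near: "\<forall>\<^sub>F x in at_right 0. norm (f x) \<le> C * x powr s"
    and top: "\<forall>\<^sub>F x in at_top. norm (f x) \<le> D * x powr t"
  shows "set_integrable lborel {0<..} (\<lambda>x. f x * exp (- complex_of_real x * z))"
proof (rule set_integrable_Ioi_powr_bounds[where s=s and t="-2" and C=C and D=1])
  show "continuous_on {0<..} (\<lambda>x. f x * exp (- complex_of_real x * z))"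
    by (intro continuous_intros f)
  show "\<forall>\<^sub>F x in at_right 0. norm (f x * exp (- complex_of_real x * z)) \<le> C * x powr s"
    using near eventually_at_right_less[of "0::real"]
  proof eventually_elim
    case (elim x)
    have "norm (f x * exp (- complex_of_real x * z)) \<le> norm (f x) * 1"
      unfolding norm_mult using elim z by (intro mult_left_mono norm_exp_le_1) auto
    with elim show ?case by simp
  qed
  show "\<forall>\<^sub>F x in at_top. norm (f x * exp (- complex_of_real x * z)) \<le> 1 * x powr -2"
    using top powr_times_exp_eventually_le[OF z, of D t]
  proof eventually_elim
    case (elim x)
    have "norm (f x * exp (- complex_of_real x * z)) \<le> D * x powr t * exp (- (x * Re z))"
      using elim by (simp add: norm_mult mult_right_mono)
    with elim show ?case by simp
  qed
qed (use s in auto)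

lemma tendsto_times_exp_at_top:
  fixes f :: "real \<Rightarrow> complex"
  assumes z: "0 < Re z" and top: "\<forall>\<^sub>F x in at_top. norm (f x) \<le> D * x powr t"
  shows "((\<lambda>x. f x * exp (- complex_of_real x * z)) \<longlongrightarrow> 0) at_top"
proof (rule Lim_null_comparison)
  show "\<forall>\<^sub>F x in at_top. norm (f x * exp (- complex_of_real x * z)) \<le> D * x powr t * exp (- (x * Re z))"
    using top by eventually_elim (simp add: norm_mult mult_right_mono)
  show "((\<lambda>x. D * x powr t * exp (- (x * Re z))) \<longlongrightarrow> 0) at_top"
    using z by real_asymp
qed

lemma laplace_derivative:
  fixes f f' :: "real \<Rightarrow> complex"
  assumes f: "\<And>x. 0 < x \<Longrightarrow> (f has_vector_derivative f' x) (at x)" and f': "continuous_on {0<..} f'"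
    and int: "set_integrable lborel {0<..} (\<lambda>x. f x * exp (- complex_of_real x * z))"
      "set_integrable lborel {0<..} (\<lambda>x. f' x * exp (- complex_of_real x * z))"
    and lims: "(f \<longlongrightarrow> 0) (at_right 0)" "((\<lambda>x. f x * exp (- complex_of_real x * z)) \<longlongrightarrow> 0) at_top"
  shows "laplace f' z = z * laplace f z"
proof -
  define g where "g x = f' x * exp (- complex_of_real x * z) - z * (f x * exp (- complex_of_real x * z))" for x
  have "(LBINT x:{0<..}. g x) = 0 - 0"
  proof (rule integral_Ioi_eq_diff_limits[where F="\<lambda>x. f x * exp (- complex_of_real x * z)"])
    fix x :: real assume x: "0 < x"
    have "((\<lambda>x. exp (- complex_of_real x * z)) has_vector_derivative - z * exp (- complex_of_real x * z)) (at x)"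
      using Cinf_on_derivative[OF Cinf_on_exp[of z] UNIV_I, of 0 x] vd_funpow_exp[of 1 z x] by simp
    from has_vector_derivative_mult[OF f[OF x] this]
    show "((\<lambda>x. f x * exp (- complex_of_real x * z)) has_vector_derivative g x) (at x)"
      by (simp add: g_def algebra_simps)
  next
    have "continuous_on {0<..} f"
      using f by (auto intro!: continuous_at_imp_continuous_on has_vector_derivative_continuous)
    then show "continuous_on {0<..} g"
      unfolding g_def by (intro continuous_intros f')
    show "set_integrable lborel {0<..} g"
      unfolding g_def by (intro set_integral_diff(1) set_integrable_mult_right int)
    have "isCont (\<lambda>x. exp (- complex_of_real x * z)) 0"
      by (intro continuous_intros)
    then have "((\<lambda>x. exp (- complex_of_real x * z)) \<longlongrightarrow> exp (- complex_of_real 0 * z)) (at_right 0)"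
      unfolding isCont_def by (rule tendsto_within_subset) auto
    from tendsto_mult[OF lims(1) this]
    show "((\<lambda>x. f x * exp (- complex_of_real x * z)) \<longlongrightarrow> 0) (at_right 0)" by simp
  qed (rule lims(2))
  moreover have "(LBINT x:{0<..}. g x) = laplace f' z - z * laplace f z"
    unfolding g_def laplace_def
    by (subst set_integral_diff(2)[OF int(2) set_integrable_mult_right[OF int(1)]])
       (simp only: set_integral_mult_right)
  ultimately show ?thesis by simp
qed

text \<open>Each integration by parts gains a factor \<open>z\<close>; the boundary terms vanish at
  0 by \<open>near\<close> and at infinity by the exponential. The constant is the L1 norm of the
  \<open>K\<close>-th derivative and thus independent of \<open>Re z\<close>.\<close>

lemma laplace_decay:
  assumes f: "Cinf_on {0<..} f"
    and near: "\<And>l. l < K \<Longrightarrow> ((vd ^^ l) f \<longlongrightarrow> 0) (at_right 0)"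
    and top: "\<And>l. l < K \<Longrightarrow> \<exists>D t. \<forall>\<^sub>F x in at_top. norm ((vd ^^ l) f x) \<le> D * x powr t"
    and int: "set_integrable lborel {0<..} ((vd ^^ K) f)"
  shows "\<exists>C\<ge>0. \<forall>z. 0 < Re z \<longrightarrow> norm (laplace f z) \<le> C / norm z ^ K"
proof (intro exI conjI allI impI)
  show "0 \<le> (LBINT x:{0<..}. norm ((vd ^^ K) f x))"
    unfolding set_lebesgue_integral_def by (rule integral_nonneg_AE) (simp add: indicator_def)
  fix z :: complex assume z: "0 < Re z"
  have int': "set_integrable lborel {0<..} (\<lambda>x. (vd ^^ l) f x * exp (- complex_of_real x * z))" if "l \<le> K" for l
  proof (cases "l = K")
    case True
    then show ?thesis using set_integrable_laplace[OF int] z by simp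
  next
    case False
    with that have "l < K" by simp
    from top[OF this] obtain D t where D: "\<forall>\<^sub>F x in at_top. norm ((vd ^^ l) f x) \<le> D * x powr t" by blast
    have "\<forall>\<^sub>F x in at_right 0. norm ((vd ^^ l) f x) < 1"
      by (rule order_tendstoD[OF tendsto_norm_zero[OF near[OF \<open>l < K\<close>]]]) simp
    then have 1: "\<forall>\<^sub>F x in at_right 0. norm ((vd ^^ l) f x) \<le> 1 * x powr 0"
      using eventually_at_right_less[of "0::real"] by eventually_elim simp
    show ?thesis
      by (rule set_integrable_times_exp[OF Cinf_on_continuous[OF f] _ z 1 D]) simp
  qed
  have lap: "laplace ((vd ^^ l) f) z = z ^ l * laplace f z" if "l \<le> K" for l
    using that
  proof (induction l)
    case (Suc l)
    then have l: "l < K" by simp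
    from top[OF this] obtain D t where D: "\<forall>\<^sub>F x in at_top. norm ((vd ^^ l) f x) \<le> D * x powr t" by blast
    have "laplace ((vd ^^ Suc l) f) z = z * laplace ((vd ^^ l) f) z"
      by (rule laplace_derivative[OF Cinf_on_derivative[OF f] Cinf_on_continuous[OF f] int' int' near[OF l]
            tendsto_times_exp_at_top[OF z D]]) (use l in auto)
    then show ?case using Suc by simp
  qed simp
  have "z \<noteq> 0" using z by auto
  from lap[of K] have "norm z ^ K * norm (laplace f z) = norm (laplace ((vd ^^ K) f) z)"
    by (simp add: norm_mult norm_power)
  also have "\<dots> \<le> (LBINT x:{0<..}. norm ((vd ^^ K) f x))"
    using z by (intro norm_laplace_le int) simp
  finally show "norm (laplace f z) \<le> (LBINT x:{0<..}. norm ((vd ^^ K) f x)) / norm z ^ K"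
    using \<open>z \<noteq> 0\<close> by (subst pos_le_divide_eq) (simp_all add: mult.commute)
qed

section \<open>Laplace transforms of pure powers\<close>

lemma continuous_on_of_real_powr: "continuous_on {0<..} (\<lambda>x. complex_of_real x powr q)"
  using continuous_on_logpow[of q 0] by (simp add: logpow_def[abs_def])

lemma of_real_powr_bounds:
  shows "\<forall>\<^sub>F x in at_right 0. norm (complex_of_real x powr q) \<le> 1 * x powr Re q"
    and "\<forall>\<^sub>F x in at_top. norm (complex_of_real x powr q) \<le> 1 * x powr Re q"
  by (rule eventually_mono[OF eventually_at_right_less[of "0::real"]], simp add: norm_powr_real_powr)
     (rule eventually_mono[OF eventually_gt_at_top[of "0::real"]], simp add: norm_powr_real_powr)

lemma set_integrable_powr_exp:
  assumes "-1 < Re q" "0 < Re z"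
  shows "set_integrable lborel {0<..} (\<lambda>x. complex_of_real x powr q * exp (- complex_of_real x * z))"
  by (rule set_integrable_times_exp[OF continuous_on_of_real_powr assms of_real_powr_bounds])

text \<open>The analogue of the functional equation of Gamma; it cancels the two terms in the
  derivative of \<open>z powr (q + 1)\<close> times the transform.\<close>

lemma laplace_powr_Suc:
  assumes q: "-1 < Re q" and z: "0 < Re z"
  shows "z * laplace (\<lambda>x. complex_of_real x powr (q + 1)) z = (q + 1) * laplace (\<lambda>x. complex_of_real x powr q) z"
proof -
  have "laplace (\<lambda>x. (q + 1) * complex_of_real x powr q) z = z * laplace (\<lambda>x. complex_of_real x powr (q + 1)) z"
  proof (rule laplace_derivative)
    show "((\<lambda>x. complex_of_real x powr (q + 1)) has_vector_derivative (q + 1) * complex_of_real x powr q) (at x)"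
      if "0 < x" for x
      using has_vector_derivative_of_real_powr[OF that, of "q + 1"] by simp
    show "continuous_on {0<..} (\<lambda>x. (q + 1) * complex_of_real x powr q)"
      by (intro continuous_intros continuous_on_of_real_powr) auto
    show "set_integrable lborel {0<..} (\<lambda>x. complex_of_real x powr (q + 1) * exp (- complex_of_real x * z))"
      using q z by (intro set_integrable_powr_exp) auto
    show "set_integrable lborel {0<..} (\<lambda>x. (q + 1) * complex_of_real x powr q * exp (- complex_of_real x * z))"
      unfolding mult.assoc using q z by (intro set_integrable_mult_right set_integrable_powr_exp) auto
    have "((\<lambda>x::real. 1 * x powr Re (q + 1)) \<longlongrightarrow> 0) (at_right 0)"
      using q by real_asymp
    from Lim_null_comparison[OF of_real_powr_bounds(1) this]
    show "((\<lambda>x. complex_of_real x powr (q + 1)) \<longlongrightarrow> 0) (at_right 0)" .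
    show "((\<lambda>x. complex_of_real x powr (q + 1) * exp (- complex_of_real x * z)) \<longlongrightarrow> 0) at_top"
      by (rule tendsto_times_exp_at_top[OF z of_real_powr_bounds(2)])
  qed
  then show ?thesis by (simp add: laplace_def mult.assoc)
qed

lemma has_field_derivative_laplace_powr:
  assumes q: "-1 < Re q" and z: "0 < Re z"
  shows "(laplace (\<lambda>x. complex_of_real x powr q) has_field_derivative - laplace (\<lambda>x. complex_of_real x powr (q + 1)) z) (at z)"
proof -
  \<comment> \<open>The power alone is not integrable on the half-line. Moving half of the decay
    into \<open>G\<close> and shifting the argument by \<open>d\<close> makes
    \<open>has_field_derivative_laplace\<close> applicable.\<close>
  define d where "d = complex_of_real (Re z / 2)"
  define G where "G x = complex_of_real x powr q * exp (- complex_of_real x * d)" for x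
  have G: "set_integrable lborel {0<..} G"
    unfolding G_def using q z by (intro set_integrable_powr_exp) (auto simp: d_def)
  have shift: "laplace G (y - d) = laplace (\<lambda>x. complex_of_real x powr q) y" for y
    unfolding laplace_def G_def by (simp add: mult.assoc exp_add[symmetric] algebra_simps)
  have "(laplace G has_field_derivative (LBINT x:{0<..}. - complex_of_real x * (G x * exp (- complex_of_real x * (z - d))))) (at (z - d))"
    using z by (intro has_field_derivative_laplace G) (simp add: d_def)
  then have "((\<lambda>y. laplace G (y - d)) has_field_derivative
      (LBINT x:{0<..}. - complex_of_real x * (G x * exp (- complex_of_real x * (z - d)))) * 1) (at z)"
    by (rule DERIV_chain2) (auto intro!: derivative_eq_intros)
  moreover have "(LBINT x:{0<..}. - complex_of_real x * (G x * exp (- complex_of_real x * (z - d))))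
      = (LBINT x:{0<..}. (-1) * (complex_of_real x powr (q + 1) * exp (- complex_of_real x * z)))"
  proof (intro set_lebesgue_integral_cong allI impI)
    fix x :: real assume "x \<in> {0<..}"
    then show "- complex_of_real x * (G x * exp (- complex_of_real x * (z - d)))
        = (-1) * (complex_of_real x powr (q + 1) * exp (- complex_of_real x * z))"
      by (simp add: G_def powr_add mult.assoc exp_add[symmetric] algebra_simps)
  qed simp
  moreover have "\<dots> = - laplace (\<lambda>x. complex_of_real x powr (q + 1)) z"
    unfolding laplace_def set_integral_mult_right by simp
  ultimately show ?thesis
    unfolding shift by simp
qed

text \<open>By integration by parts \<open>z\<^sup>q\<^sup>+\<^sup>1\<close> times the transform has derivative zero, so it equals its value at 1.\<close>

lemma laplace_powr:
  assumes q: "-1 < Re q" and z: "0 < Re z"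
  shows "laplace (\<lambda>x. complex_of_real x powr q) z = Gamma (q + 1) * z powr (- q - 1)"
proof -
  define f where "f y = y powr (q + 1) * laplace (\<lambda>x. complex_of_real x powr q) y" for y
  have f: "(f has_field_derivative 0) (at y)" if "0 < Re y" for y
  proof -
    have nz: "y \<notin> \<real>\<^sub>\<le>\<^sub>0" "y \<noteq> 0" using that by (auto simp: complex_nonpos_Reals_iff)
    have "((\<lambda>y. y powr (q + 1)) has_field_derivative (q + 1) * y powr q) (at y)"
      using has_field_derivative_powr[OF nz(1), of "q + 1"] by simp
    from DERIV_mult[OF this has_field_derivative_laplace_powr[OF q that]]
    have "(f has_field_derivative (q + 1) * y powr q * laplace (\<lambda>x. complex_of_real x powr q) y
        + - laplace (\<lambda>x. complex_of_real x powr (q + 1)) y * y powr (q + 1)) (at y)"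
      by (simp add: f_def[abs_def])
    moreover have "y powr (q + 1) = y powr q * y" using nz by (simp add: powr_add)
    moreover have "(q + 1) * y powr q * laplace (\<lambda>x. complex_of_real x powr q) y
        = laplace (\<lambda>x. complex_of_real x powr (q + 1)) y * (y powr q * y)"
      using laplace_powr_Suc[OF q that] by (metis mult.assoc mult.commute)
    ultimately show ?thesis by simp
  qed
  have "\<exists>c. \<forall>y\<in>{y. 0 < Re y}. f y = c"
  proof (rule has_field_derivative_zero_constant)
    show "(f has_field_derivative 0) (at y within {y. 0 < Re y})" if "y \<in> {y. 0 < Re y}" for y
      using f[of y] that by (simp add: has_field_derivative_at_within)
  qed (rule convex_halfspace_Re_gt)
  then obtain c where c: "\<forall>y\<in>{y. 0 < Re y}. f y = c" ..
  have "f z = f 1" using z bspec[OF c, of z] bspec[OF c, of 1] by simp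
  have "laplace (\<lambda>x. complex_of_real x powr q) 1 = integral {0<..} (\<lambda>x. complex_of_real x powr q * exp (- complex_of_real x * 1))"
    unfolding laplace_def using q by (intro set_borel_integral_eq_integral(2) set_integrable_powr_exp) auto
  also have "\<dots> = integral {0<..} (\<lambda>t. complex_of_real t powr (q + 1 - 1) / of_real (exp t))"
    by (simp add: exp_minus exp_of_real divide_inverse)
  also have "\<dots> = Gamma (q + 1)"
    using q by (intro integral_unique Gamma_integral_complex') simp
  finally have "f 1 = Gamma (q + 1)" by (simp add: f_def)
  moreover have "laplace (\<lambda>x. complex_of_real x powr q) z = f z * z powr (- q - 1)"
  proof -
    have "z \<noteq> 0" using z by auto
    then have "z powr (q + 1) * z powr (- q - 1) = 1" by (simp add: powr_add[symmetric])
    then show ?thesis by (simp add: f_def mult_ac)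
  qed
  ultimately show ?thesis using \<open>f z = f 1\<close> by simp
qed

section \<open>Expansion of the pairing with exponentials for Re z > 0\<close>

context half_line_expansion
begin

definition tail :: "complex \<Rightarrow> real \<Rightarrow> complex" where
  "tail q x = (1 - wc x) * complex_of_real x powr q"

lemma tail_smooth: "Cinf_on {0<..} (tail q)"
  unfolding tail_def[abs_def]
  by (intro Cinf_on_mult Cinf_on_diff Cinf_on_const Cinf_on_of_real_powr Cinf_on_subset[OF wc_smooth]) auto

lemma vd_tail_near_0: "\<forall>\<^sub>F x in at_right 0. (vd ^^ l) (tail q) x = 0"
proof -
  obtain R e where e: "0 < e" "\<And>x. \<bar>x\<bar> < e \<Longrightarrow> wc x = 1" using w_support by metis
  have "(vd ^^ l) (tail q) x = 0" if "x \<in> {0<..<e}" for x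
    by (rule vd_funpow_eqI[where S="{0<..<e}" and D="\<lambda>k x. 0"]) (use that e in \<open>auto simp: tail_def\<close>)
  then show ?thesis
    by (rule eventually_mono[OF eventually_at_right_real[OF e(1)]])
qed

lemma vd_tail_at_top:
  "\<forall>\<^sub>F x in at_top. norm ((vd ^^ l) (tail q) x) \<le> norm (\<Prod>i<l. q - of_nat i) * x powr (Re q - real l)"
proof -
  obtain R where R: "0 < R" "\<And>x. R < x \<Longrightarrow> wc x = 0" using w_support by metis
  have "(vd ^^ l) (tail q) x = (vd ^^ l) (\<lambda>x. complex_of_real x powr q) x" if "x \<in> {R<..}" for x
    by (rule vd_funpow_cong[where S="{R<..}", OF Cinf_on_subset[OF Cinf_on_of_real_powr]])
       (use that R in \<open>auto simp: tail_def\<close>)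
  then show ?thesis
    using R by (intro eventually_mono[OF eventually_gt_at_top[of R]])
      (simp add: vd_funpow_of_real_powr norm_mult norm_powr_real_powr)
qed

lemma tail_decay:
  "\<exists>C\<ge>0. \<forall>z. 0 < Re z \<longrightarrow> 1 \<le> norm z \<longrightarrow> norm (laplace (tail q) z) \<le> C / norm z ^ K"
proof -
  obtain n :: nat where n: "Re q + 1 < real n" using reals_Archimedean2 by blast
  \<comment> \<open>At least \<open>K\<close> derivatives for the decay, and at least
    \<open>n\<close> to push the exponent \<open>Re q - L\<close> below -1, which makes the
    derivative integrable at infinity. For \<open>1 \<le> norm z\<close> the bound with
    \<open>L\<close> implies the one with \<open>K\<close>.\<close>
  define L where "L = max n K"
  have "\<exists>C\<ge>0. \<forall>z. 0 < Re z \<longrightarrow> norm (laplace (tail q) z) \<le> C / norm z ^ L"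
  proof (rule laplace_decay[OF tail_smooth])
    show "((vd ^^ l) (tail q) \<longlongrightarrow> 0) (at_right 0)" for l
      by (rule tendsto_eventually[OF vd_tail_near_0])
    show "\<exists>D t. \<forall>\<^sub>F x in at_top. norm ((vd ^^ l) (tail q) x) \<le> D * x powr t" for l
      using vd_tail_at_top by blast
    have 1: "\<forall>\<^sub>F x in at_right 0. norm ((vd ^^ L) (tail q) x) \<le> 0 * x powr 0"
      using vd_tail_near_0 by eventually_elim simp
    show "set_integrable lborel {0<..} ((vd ^^ L) (tail q))"
      by (rule set_integrable_Ioi_powr_bounds[OF Cinf_on_continuous[OF tail_smooth] _ _ 1 vd_tail_at_top])
         (use n in \<open>simp_all add: L_def\<close>)
  qed
  then obtain C where C: "0 \<le> C" "\<And>z. 0 < Re z \<Longrightarrow> norm (laplace (tail q) z) \<le> C / norm z ^ L" by blast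
  have "norm (laplace (tail q) z) \<le> C / norm z ^ K" if "0 < Re z" "1 \<le> norm z" for z
  proof -
    have "C / norm z ^ L \<le> C / norm z ^ K"
      using that C(1) by (intro divide_left_mono power_increasing mult_pos_pos zero_less_power) (auto simp: L_def)
    with C(2)[OF that(1)] show ?thesis by simp
  qed
  with C(1) show ?thesis by blast
qed

text \<open>The assumption leaves a positive exponent at 0 for every derivative of order at most
  \<open>K\<close>: the lower ones tend to 0 there, and the \<open>K\<close>-th is
  integrable.\<close>

lemma rem_decay:
  assumes "real K < Re (p (Suc N))"
  shows "\<exists>C\<ge>0. \<forall>z. 0 < Re z \<longrightarrow> norm (laplace (rem N) z) \<le> C / norm z ^ K"
proof (rule laplace_decay[OF rem_smooth])
  fix l assume l: "l < K"
  then have "0 < Re (p (Suc N)) - real l" using assms by simp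
  from dense[OF this] obtain s where s: "0 < s" "s < Re (p (Suc N)) - real l" by blast
  from vd_rem_near_0_powr[OF s(2)] obtain C where
    C: "\<forall>\<^sub>F x in at_right 0. norm ((vd ^^ l) (rem N) x) \<le> C * x powr s" ..
  have "((\<lambda>x::real. C * x powr s) \<longlongrightarrow> 0) (at_right 0)" using s(1) by real_asymp
  with C show "((vd ^^ l) (rem N) \<longlongrightarrow> 0) (at_right 0)" by (rule Lim_null_comparison)
  show "\<exists>D t. \<forall>\<^sub>F x in at_top. norm ((vd ^^ l) (rem N) x) \<le> D * x powr t"
    using vd_rem_at_top by blast
next
  show "set_integrable lborel {0<..} ((vd ^^ K) (rem N))"
    using assms by (intro set_integrable_vd_rem) simp
qed

lemma set_integrable_tail_exp:
  assumes z: "0 < Re z"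
  shows "set_integrable lborel {0<..} (\<lambda>x. x powr s *\<^sub>R ((1 - wc x) * exp (- complex_of_real x * z)))"
proof -
  have "set_integrable lborel {0<..} (\<lambda>x. tail (of_real s) x * exp (- complex_of_real x * z))"
  proof (rule set_integrable_times_exp[OF _ _ z])
    show "continuous_on {0<..} (tail (of_real s))"
      using Cinf_on_continuous[OF tail_smooth, of 0] by simp
    show "\<forall>\<^sub>F x in at_right 0. norm (tail (of_real s) x) \<le> 0 * x powr 0"
      using vd_tail_near_0[of 0] by simp
    show "\<forall>\<^sub>F x in at_top. norm (tail (of_real s) x) \<le> 1 * x powr s"
      using vd_tail_at_top[of 0 "of_real s"] by simp
  qed simp
  moreover have "tail (of_real s) x * exp (- complex_of_real x * z) = x powr s *\<^sub>R ((1 - wc x) * exp (- complex_of_real x * z))"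
    if "x \<in> {0<..}" for x
    using that by (simp add: tail_def powr_of_real scaleR_conv_of_real)
  ultimately show ?thesis
    by (subst set_integrable_cong[OF refl refl]) auto
qed

text \<open>Both sides are holomorphic in \<open>q\<close> and agree for \<open>Re q > -1\<close>; the tail vanishes near 0, hence is entire in \<open>q\<close>.\<close>

lemma xplus_exp:
  assumes z: "0 < Re z" and q: "q \<notin> neg_ints"
  shows "xplus (\<lambda>x. wc x * exp (- complex_of_real x * z)) q = Gamma (q + 1) * z powr (- q - 1) - laplace (tail q) z"
proof (rule xplus_eqI[OF _ _ q])
  define \<Phi> where "\<Phi> x = (1 - wc x) * exp (- complex_of_real x * z)" for x
  have \<Phi>: "continuous_on {0<..} \<Phi>"
    unfolding \<Phi>_def using Cinf_on_continuous[OF wc_smooth, of 0]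
    by (intro continuous_intros) (auto intro: continuous_on_subset)
  have tail_eq: "laplace (tail b) z = (LBINT x:{0<..}. complex_of_real x powr b * \<Phi> x)" for b
    by (simp add: laplace_def tail_def \<Phi>_def mult_ac)
  have int: "set_integrable lborel {0<..} (\<lambda>x. x powr s *\<^sub>R \<Phi> x)" for s
    unfolding \<Phi>_def by (rule set_integrable_tail_exp[OF z])
  \<comment> \<open>\<open>\<Phi>\<close> vanishes near 0, so no exponent is excluded and the edge
    can be put at \<open>Re b - 1\<close> for whichever \<open>b\<close> is considered.\<close>
  have der: "((\<lambda>b. laplace (tail b) z) has_field_derivative (LBINT x:{0<..}. logpow b (Suc 0) x * \<Phi> x)) (at b)" for b
    using has_field_derivative_mellin[of \<Phi> "Re b - 1" b 0, OF \<Phi> int] by (simp add: tail_eq)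
  have "(\<lambda>b. laplace (tail b) z) holomorphic_on UNIV"
    using der by (auto simp: holomorphic_on_open)
  moreover have "b + 1 \<notin> \<int>\<^sub>\<le>\<^sub>0" if "b \<in> - neg_ints" for b
  proof
    assume "b + 1 \<in> \<int>\<^sub>\<le>\<^sub>0"
    then obtain n where "b + 1 = - of_nat n" by (auto elim: nonpos_Ints_cases')
    then have "b = - of_nat n - 1" by (simp only: eq_diff_eq)
    then have "b = - of_nat (Suc n)" by simp
    with that show False by (auto simp: neg_ints_def)
  qed
  ultimately show "(\<lambda>b. Gamma (b + 1) * z powr (- b - 1) - laplace (tail b) z) holomorphic_on - neg_ints"
    using z by (intro holomorphic_intros) (auto intro: holomorphic_on_subset)
  fix b assume b: "-1 < Re b"
  have "(LBINT x:{0<..}. complex_of_real x powr b * (wc x * exp (- complex_of_real x * z)))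
      = (LBINT x:{0<..}. complex_of_real x powr b * exp (- complex_of_real x * z) - complex_of_real x powr b * \<Phi> x)"
    by (simp add: \<Phi>_def algebra_simps)
  also have "\<dots> = laplace (\<lambda>x. complex_of_real x powr b) z - laplace (tail b) z"
    unfolding laplace_def[of "\<lambda>x. complex_of_real x powr b"] tail_eq
    using set_integrable_mellin[of \<Phi> "Re b - 1" b 0, OF \<Phi> int]
    by (intro set_integral_diff(2) set_integrable_powr_exp b z) auto
  finally show "Gamma (b + 1) * z powr (- b - 1) - laplace (tail b) z
      = (LBINT x:{0<..}. complex_of_real x powr b * (wc x * exp (- complex_of_real x * z)))"
    by (simp add: laplace_powr[OF b z])
qed

text \<open>Past \<open>N0\<close> every \<open>Re (p j)\<close> exceeds -1. The next power is then
  an ordinary integral that can be split off the remainder and rewritten by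
  \<open>xplus_exp\<close>, so the value of \<open>eplus\<close>, truncated at \<open>N0\<close>, is
  expressed by sums of any greater length.\<close>

lemma eplus_exp_eq:
  assumes m0: "\<forall>j. m j = 0" and z: "0 < Re z" and N: "N0 \<le> N"
  shows "eplus p m a w u (\<lambda>x. exp (- complex_of_real x * z)) =
    (\<Sum>j\<le>N. a j 0 * (Gamma (p j + 1) * z powr (- p j - 1) - laplace (tail (p j)) z)) + laplace (rem N) z"
  using N
proof (induction N rule: dec_induct)
  case base
  have "(\<Sum>k\<le>m j. a j k * xplus_log f k (p j)) = a j 0 * xplus f (p j)" for j f
    using m0[rule_format, of j] by (simp add: xplus_log_def)
  then show ?case
    unfolding eplus_eq laplace_def[symmetric] by (simp only: xplus_exp[OF z p_not_neg_ints])
next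
  case (step N)
  have N': "-1 < Re (p (Suc N))" using N0 Re_p_mono[of "Suc N0" "Suc N"] step by simp
  define E where "E x = exp (- complex_of_real x * z)" for x
  have E: "Cinf_on UNIV E" unfolding E_def by (rule Cinf_on_exp)
  obtain R where R: "\<forall>x>R. wc x * E x = 0" using wc_times_support[OF E] ..
  have int_r: "set_integrable lborel {0<..} (\<lambda>x. rem N x * E x)"
    unfolding E_def using set_integrable_vd_rem[of N 0] N' z by (intro set_integrable_laplace) auto
  have int_p: "set_integrable lborel {0<..} (\<lambda>x. complex_of_real x powr p (Suc N) * (wc x * E x))"
  proof (rule set_integrable_mellin[where k=0, unfolded logpow_0, OF _ _ N'])
    show "continuous_on {0<..} (\<lambda>x. wc x * E x)"
      by (rule continuous_on_subset[OF Cinf_on_continuous[OF wc_times_smooth[OF E], of 0, simplified]]) simp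
    show "set_integrable lborel {0<..} (\<lambda>x. x powr s *\<^sub>R (wc x * E x))" if "-1 < s" for s
      using set_integrable_powr_times_compact_support[OF Cinf_on_continuous[OF wc_times_smooth[OF E], of 0, simplified], of R 0 s]
        R that by simp
  qed
  have "rem (Suc N) x * E x = rem N x * E x - a (Suc N) 0 * (complex_of_real x powr p (Suc N) * (wc x * E x))" for x
    by (simp add: rem_def expsum_def m0 algebra_simps)
  then have "laplace (rem (Suc N)) z = (LBINT x:{0<..}. rem N x * E x - a (Suc N) 0 * (complex_of_real x powr p (Suc N) * (wc x * E x)))"
    unfolding laplace_def E_def[symmetric] by simp
  also have "\<dots> = laplace (rem N) z - (LBINT x:{0<..}. a (Suc N) 0 * (complex_of_real x powr p (Suc N) * (wc x * E x)))"
    unfolding laplace_def E_def[symmetric] by (intro set_integral_diff(2) int_r set_integrable_mult_right int_p)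
  also have "\<dots> = laplace (rem N) z - a (Suc N) 0 * xplus (\<lambda>x. wc x * E x) (p (Suc N))"
    using xplus_eq_integral[OF wc_times_smooth[OF E], of R "p (Suc N)"] R N' by simp
  also have "xplus (\<lambda>x. wc x * E x) (p (Suc N)) = Gamma (p (Suc N) + 1) * z powr (- p (Suc N) - 1) - laplace (tail (p (Suc N))) z"
    unfolding E_def by (rule xplus_exp[OF z p_not_neg_ints])
  finally show ?case
    using step.IH by simp
qed

text \<open>The error consists of the remainder and finitely many tails; the restriction
  \<open>1 \<le> norm z\<close> comes from \<open>tail_decay\<close>.\<close>

lemma eplus_exp_asymp:
  assumes m0: "\<forall>j. m j = 0" and N: "N0 \<le> N" and K: "real K < Re (p (Suc N))"
  shows "\<exists>C\<ge>0. \<forall>z. 0 < Re z \<longrightarrow> 1 \<le> norm z \<longrightarrow>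
    norm (eplus p m a w u (\<lambda>x. exp (- complex_of_real x * z))
      - (\<Sum>j\<le>N. a j 0 * Gamma (p j + 1) * z powr (- p j - 1))) \<le> C / norm z ^ K"
proof -
  obtain D where D: "0 \<le> D" "\<And>z. 0 < Re z \<Longrightarrow> norm (laplace (rem N) z) \<le> D / norm z ^ K"
    using rem_decay[OF K] by blast
  have "\<forall>j. \<exists>C\<ge>0. \<forall>z. 0 < Re z \<longrightarrow> 1 \<le> norm z \<longrightarrow> norm (laplace (tail (p j)) z) \<le> C / norm z ^ K"
    using tail_decay by blast
  from choice[OF this] obtain T where T: "\<And>j. 0 \<le> T j"
    "\<And>j z. 0 < Re z \<Longrightarrow> 1 \<le> norm z \<Longrightarrow> norm (laplace (tail (p j)) z) \<le> T j / norm z ^ K" by blast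
  define C where "C = D + (\<Sum>j\<le>N. norm (a j 0) * T j)"
  have "0 \<le> C" unfolding C_def using D T by (intro add_nonneg_nonneg sum_nonneg) auto
  moreover have "norm (eplus p m a w u (\<lambda>x. exp (- complex_of_real x * z))
      - (\<Sum>j\<le>N. a j 0 * Gamma (p j + 1) * z powr (- p j - 1))) \<le> C / norm z ^ K" if z: "0 < Re z" "1 \<le> norm z" for z
  proof -
    have "eplus p m a w u (\<lambda>x. exp (- complex_of_real x * z))
      - (\<Sum>j\<le>N. a j 0 * Gamma (p j + 1) * z powr (- p j - 1)) = laplace (rem N) z - (\<Sum>j\<le>N. a j 0 * laplace (tail (p j)) z)"
      unfolding eplus_exp_eq[OF m0 z(1) N] by (simp add: algebra_simps sum_subtractf)
    also have "norm \<dots> \<le> norm (laplace (rem N) z) + (\<Sum>j\<le>N. norm (a j 0 * laplace (tail (p j)) z))"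
      by (rule order.trans[OF norm_triangle_ineq4 add_left_mono[OF norm_sum]])
    also have "\<dots> \<le> D / norm z ^ K + (\<Sum>j\<le>N. norm (a j 0) * (T j / norm z ^ K))"
      unfolding norm_mult by (intro add_mono sum_mono mult_left_mono D T z) auto
    also have "\<dots> = C / norm z ^ K"
      by (simp add: C_def add_divide_distrib sum_divide_distrib)
    finally show ?thesis .
  qed
  ultimately show ?thesis by blast
qed

end

section \<open>Boundary values\<close>

text \<open>The principal logarithm of \<open>\<i> * \<xi>\<close> has imaginary part
  \<open>pi / 2\<close> or \<open>- pi / 2\<close> according to the sign of \<open>\<xi>\<close>.
  For negative \<open>\<xi>\<close> the phase \<open>exp (\<i> * pi * (q + 1))\<close> inside
  \<open>mi0pow\<close> turns one value into the other; it is the ratio of the coefficients on the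
  two half-lines.\<close>

lemma ii_powr_eq_mi0pow:
  assumes "\<xi> \<noteq> 0"
  shows "(\<i> * complex_of_real \<xi>) powr (- q - 1) = exp (- \<i> * complex_of_real pi * (q + 1) / 2) * mi0pow \<xi> (- q - 1)"
proof (cases "0 < \<xi>")
  case True
  have "Ln (\<i> * complex_of_real \<xi>) = ln \<xi> + \<i> * pi / 2"
    using True Ln_times_of_real[of \<xi> \<i>] Ln_of_real[of \<xi>] by (simp add: mult.commute)
  then show ?thesis
    using True by (simp add: mi0pow_def powr_def Ln_of_real exp_add[symmetric] algebra_simps add_divide_distrib diff_divide_distrib)
next
  case False
  with assms have neg: "\<xi> < 0" by simp
  have "Ln (\<i> * complex_of_real \<xi>) = Ln (complex_of_real (- \<xi>) * (- \<i>))"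
    by (simp add: mult.commute)
  also have "\<dots> = ln (- \<xi>) + Ln (- \<i>)"
    using neg Ln_of_real[of "- \<xi>"] by (subst Ln_times_of_real) auto
  finally have L: "Ln (\<i> * complex_of_real \<xi>) = ln (- \<xi>) - \<i> * pi / 2"
    by simp
  have A: "Ln (complex_of_real \<bar>\<xi>\<bar>) = ln (- \<xi>)"
    using neg Ln_of_real[of "- \<xi>"] by simp
  show ?thesis
    using neg unfolding mi0pow_def powr_def L A
    by (simp add: exp_add[symmetric] algebra_simps add_divide_distrib diff_divide_distrib)
qed

text \<open>The factor accounts for negative \<open>\<xi>\<close>, where
  \<open>exp (- \<i> * pi * b)\<close> has norm \<open>exp (pi * Im b)\<close>.\<close>

lemma norm_mi0pow_le:
  assumes "\<xi> \<noteq> 0"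
  shows "norm (mi0pow \<xi> b) \<le> exp (pi * \<bar>Im b\<bar>) * \<bar>\<xi>\<bar> powr Re b"
proof -
  have 1: "norm (complex_of_real \<bar>\<xi>\<bar> powr b) = \<bar>\<xi>\<bar> powr Re b"
    using assms by (subst norm_powr_real_powr) auto
  have 2: "norm (exp (- \<i> * complex_of_real pi * b)) \<le> exp (pi * \<bar>Im b\<bar>)"
    by (simp add: norm_exp_eq_Re)
  have 3: "1 \<le> exp (pi * \<bar>Im b\<bar>)" by simp
  show ?thesis
  proof (cases "0 < \<xi>")
    case True
    then have "norm (mi0pow \<xi> b) = 1 * \<bar>\<xi>\<bar> powr Re b"
      using 1 by (simp add: mi0pow_def)
    also have "\<dots> \<le> exp (pi * \<bar>Im b\<bar>) * \<bar>\<xi>\<bar> powr Re b"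
      by (rule mult_right_mono[OF 3]) simp
    finally show ?thesis .
  next
    case False
    then have "norm (mi0pow \<xi> b) = norm (exp (- \<i> * complex_of_real pi * b)) * \<bar>\<xi>\<bar> powr Re b"
      using 1 by (simp add: mi0pow_def norm_mult)
    also have "\<dots> \<le> exp (pi * \<bar>Im b\<bar>) * \<bar>\<xi>\<bar> powr Re b"
      by (rule mult_right_mono[OF 2]) simp
    finally show ?thesis .
  qed
qed

lemma xplus_cong:
  assumes "\<And>x. 0 < x \<Longrightarrow> \<phi> x = \<psi> x"
  shows "xplus \<phi> = xplus \<psi>"
proof -
  have "(LBINT x:{0<..}. complex_of_real x powr b * \<phi> x) = (LBINT x:{0<..}. complex_of_real x powr b * \<psi> x)" for b
    using assms by (intro set_lebesgue_integral_cong) auto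
  then show ?thesis unfolding xplus_def by simp
qed

text \<open>Both the continued pairings and the remainder integral see only \<open>x > 0\<close>. As
  \<open>chi\<close> is 1 there, this removes \<open>chi\<close> from the formula for
  \<open>h\<close>.\<close>

lemma eplus_cong:
  assumes "\<And>x. 0 < x \<Longrightarrow> \<phi> x = \<psi> x"
  shows "eplus p m a w u \<phi> = eplus p m a w u \<psi>"
proof -
  have "xplus (\<lambda>x. w x *\<^sub>R \<phi> x) = xplus (\<lambda>x. w x *\<^sub>R \<psi> x)"
    using assms by (intro xplus_cong) auto
  moreover have "(LBINT x:{0<..}. (u x - w x *\<^sub>R expsum p m a N x) * \<phi> x)
      = (LBINT x:{0<..}. (u x - w x *\<^sub>R expsum p m a N x) * \<psi> x)" for N
    using assms by (intro set_lebesgue_integral_cong) auto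
  ultimately show ?thesis
    unfolding eplus_def xplus_log_def by simp
qed

lemma boundary_value_tendsto:
  fixes H :: "complex \<Rightarrow> complex"
  assumes cont: "continuous_on {z. 0 \<le> Re z} H"
    and bound: "\<And>z. 0 \<le> Re z \<Longrightarrow> norm (H z) \<le> C * (1 + norm z) ^ M" and C: "0 < C"
    and \<phi>: "schwartz \<phi>"
  shows "((\<lambda>\<eta>. LBINT \<xi>. c * H (complex_of_real \<eta> + \<i> * complex_of_real \<xi>) * \<phi> \<xi>)
    \<longlongrightarrow> (LBINT \<xi>. c * H (\<i> * complex_of_real \<xi>) * \<phi> \<xi>)) (at_right 0)"
proof -
  \<comment> \<open>For \<open>\<eta> < 1\<close> one has
    \<open>norm z \<le> 1 + \<bar>\<xi>\<bar>\<close>, so the dominating function does not depend on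
    \<open>\<eta>\<close>.\<close>
  have "at_right 0 = at 0 within {0<..<1::real}"
    by (rule at_within_nhd[of 0 "{-1<..<1}"]) auto
  moreover have "((\<lambda>\<eta>. LBINT \<xi>. c * H (complex_of_real \<eta> + \<i> * complex_of_real \<xi>) * \<phi> \<xi>)
    \<longlongrightarrow> (LBINT \<xi>. c * H (\<i> * complex_of_real \<xi>) * \<phi> \<xi>)) (at 0 within {0<..<1})"
    unfolding tendsto_at_iff_sequentially o_def
  proof (intro allI impI)
    fix X :: "nat \<Rightarrow> real" assume X: "\<forall>i. X i \<in> {0<..<1} - {0}" "X \<longlonglongrightarrow> 0"
    have X': "0 < X i" "X i < 1" for i using X(1) by auto
    have \<phi>c: "continuous_on UNIV \<phi>"
      using \<phi> Cinf_on_continuous[of UNIV \<phi> 0] by (simp add: schwartz_def)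
    have meas: "(\<lambda>\<xi>. c * H (complex_of_real r + \<i> * complex_of_real \<xi>) * \<phi> \<xi>) \<in> borel_measurable lborel" if "0 \<le> r" for r
    proof -
      have "continuous_on UNIV (H \<circ> (\<lambda>\<xi>. complex_of_real r + \<i> * complex_of_real \<xi>))"
        by (intro continuous_on_compose continuous_intros continuous_on_subset[OF cont]) (use that in auto)
      then have "continuous_on UNIV (\<lambda>\<xi>. c * H (complex_of_real r + \<i> * complex_of_real \<xi>) * \<phi> \<xi>)"
        unfolding o_def by (intro continuous_intros \<phi>c)
      then show ?thesis by (simp add: borel_measurable_continuous_onI)
    qed
    \<comment> \<open>The constants are those of \<open>two_plus_power_le\<close>; the factor
      \<open>\<xi> ^ 0\<close> is written out so that both summands match
      \<open>schwartz_integrable_power\<close>.\<close>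
    define W where "W \<xi> = norm c * C * (4 ^ M * norm (complex_of_real \<xi> ^ 0 * \<phi> \<xi>) + 2 ^ M * norm (complex_of_real \<xi> ^ M * \<phi> \<xi>))" for \<xi>
    show "(\<lambda>n. LBINT \<xi>. c * H (complex_of_real (X n) + \<i> * complex_of_real \<xi>) * \<phi> \<xi>)
        \<longlonglongrightarrow> (LBINT \<xi>. c * H (\<i> * complex_of_real \<xi>) * \<phi> \<xi>)"
    proof (rule integral_dominated_convergence[where w=W])
      show "integrable lborel W"
        unfolding W_def
        by (intro integrable_mult_right Bochner_Integration.integrable_add integrable_norm schwartz_integrable_power \<phi>)
      show "(\<lambda>\<xi>. c * H (\<i> * complex_of_real \<xi>) * \<phi> \<xi>) \<in> borel_measurable lborel"
        using meas[of 0] by simp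
      show "(\<lambda>\<xi>. c * H (complex_of_real (X n) + \<i> * complex_of_real \<xi>) * \<phi> \<xi>) \<in> borel_measurable lborel" for n
        using X'(1)[of n] by (intro meas) simp
      show "AE \<xi> in lborel. (\<lambda>n. c * H (complex_of_real (X n) + \<i> * complex_of_real \<xi>) * \<phi> \<xi>)
          \<longlonglongrightarrow> c * H (\<i> * complex_of_real \<xi>) * \<phi> \<xi>"
      proof (intro AE_I2 tendsto_intros)
        fix \<xi>
        have "(\<lambda>n. complex_of_real (X n) + \<i> * complex_of_real \<xi>) \<longlonglongrightarrow> complex_of_real 0 + \<i> * complex_of_real \<xi>"
          by (intro tendsto_intros X)
        then have "(\<lambda>n. complex_of_real (X n) + \<i> * complex_of_real \<xi>) \<longlonglongrightarrow> \<i> * complex_of_real \<xi>"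
          by simp
        then show "(\<lambda>n. H (complex_of_real (X n) + \<i> * complex_of_real \<xi>)) \<longlonglongrightarrow> H (\<i> * complex_of_real \<xi>)"
          by (rule continuous_on_tendsto_compose[OF cont]) (use X'(1) in \<open>auto intro!: always_eventually less_imp_le\<close>)
      qed
      show "AE \<xi> in lborel. norm (c * H (complex_of_real (X n) + \<i> * complex_of_real \<xi>) * \<phi> \<xi>) \<le> W \<xi>" for n
      proof (intro AE_I2)
        fix \<xi>
        define z where "z = complex_of_real (X n) + \<i> * complex_of_real \<xi>"
        have "norm z \<le> norm (complex_of_real (X n)) + norm (\<i> * complex_of_real \<xi>)"
          unfolding z_def by (rule norm_triangle_ineq)
        then have "norm z \<le> 1 + \<bar>\<xi>\<bar>"
          using X'[of n] by (simp add: norm_mult)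
        then have "(1 + norm z) ^ M \<le> (2 + \<bar>\<xi>\<bar>) ^ M"
          by (intro power_mono) auto
        also have "\<dots> \<le> 4 ^ M + 2 ^ M * \<bar>\<xi>\<bar> ^ M"
          by (rule two_plus_power_le) simp
        finally have "C * (1 + norm z) ^ M \<le> C * (4 ^ M + 2 ^ M * \<bar>\<xi>\<bar> ^ M)"
          using C by simp
        with bound[of z] have "norm (H z) \<le> C * (4 ^ M + 2 ^ M * \<bar>\<xi>\<bar> ^ M)"
          using X'(1)[of n] by (simp add: z_def)
        from mult_right_mono[OF mult_left_mono[OF this norm_ge_zero[of c]] norm_ge_zero[of "\<phi> \<xi>"]]
        show "norm (c * H z * \<phi> \<xi>) \<le> W \<xi>"
          by (simp add: W_def norm_mult norm_power algebra_simps)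
      qed
    qed
  qed
  ultimately show ?thesis by simp
qed

section \<open>Asymptotics on the imaginary axis\<close>

context half_line_expansion
begin

lemma boundary_asymp:
  assumes m0: "\<forall>j. m j = 0" and cont: "continuous_on {z. 0 \<le> Re z} H"
    and H: "\<And>z. 0 \<le> Re z \<Longrightarrow> eplus p m a w u (\<lambda>x. exp (- complex_of_real x * z)) = H z"
    and N: "N0 \<le> N" and K: "real K < Re (p (Suc N))"
  shows "\<exists>C\<ge>0. \<forall>\<xi>. 1 \<le> \<bar>\<xi>\<bar> \<longrightarrow> norm (H (\<i> * complex_of_real \<xi>)
      - (\<Sum>j\<le>N. a j 0 * Gamma (p j + 1) * (\<i> * complex_of_real \<xi>) powr (- p j - 1))) \<le> C / \<bar>\<xi>\<bar> ^ K"
proof -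
  define S where "S z = (\<Sum>j\<le>N. a j 0 * Gamma (p j + 1) * z powr (- p j - 1))" for z
  obtain C where C: "0 \<le> C" and bound: "\<And>z. 0 < Re z \<Longrightarrow> 1 \<le> norm z \<Longrightarrow> norm (H z - S z) \<le> C / norm z ^ K"
  proof -
    obtain C where "0 \<le> C" and C: "\<forall>z. 0 < Re z \<longrightarrow> 1 \<le> norm z \<longrightarrow>
      norm (eplus p m a w u (\<lambda>x. exp (- complex_of_real x * z)) - S z) \<le> C / norm z ^ K"
      using eplus_exp_asymp[OF m0 N K] unfolding S_def by blast
    show thesis
    proof (rule that[OF \<open>0 \<le> C\<close>])
      fix z assume "0 < Re z" "1 \<le> norm z"
      then show "norm (H z - S z) \<le> C / norm z ^ K"
        using C[rule_format, of z] H[of z] by (simp del: mult_minus_left)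
    qed
  qed
  have "norm (H (\<i> * complex_of_real \<xi>) - S (\<i> * complex_of_real \<xi>)) \<le> C / \<bar>\<xi>\<bar> ^ K" if \<xi>: "1 \<le> \<bar>\<xi>\<bar>" for \<xi>
  proof -
    \<comment> \<open>A horizontal approach to the axis has
      \<open>norm (Z n) \<ge> \<bar>\<xi>\<bar>\<close>, so the bound passes to the limit with the
      same constant; the limit point \<open>\<i> * \<xi>\<close> lies off the branch cut of
      \<open>powr\<close>.\<close>
    define Z where "Z n = complex_of_real (inverse (real (Suc n))) + \<i> * complex_of_real \<xi>" for n
    have "Z \<longlonglongrightarrow> complex_of_real 0 + \<i> * complex_of_real \<xi>"
      unfolding Z_def by (intro tendsto_intros LIMSEQ_inverse_real_of_nat)
    then have Z: "Z \<longlonglongrightarrow> \<i> * complex_of_real \<xi>" by simp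
    have ReZ: "0 < Re (Z n)" for n by (simp add: Z_def)
    have normZ: "\<bar>\<xi>\<bar> \<le> norm (Z n)" for n
      using abs_Im_le_cmod[of "Z n"] by (simp add: Z_def)
    have "(\<lambda>n. H (Z n)) \<longlonglongrightarrow> H (\<i> * complex_of_real \<xi>)"
      by (rule continuous_on_tendsto_compose[OF cont Z]) (use ReZ in \<open>auto intro!: always_eventually less_imp_le\<close>)
    moreover have "(\<lambda>n. S (Z n)) \<longlonglongrightarrow> S (\<i> * complex_of_real \<xi>)"
      unfolding S_def
      by (intro tendsto_intros tendsto_powr_complex Z) (use \<xi> in \<open>auto simp: complex_nonpos_Reals_iff\<close>)
    ultimately have lim: "(\<lambda>n. norm (H (Z n) - S (Z n))) \<longlonglongrightarrow> norm (H (\<i> * complex_of_real \<xi>) - S (\<i> * complex_of_real \<xi>))"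
      by (intro tendsto_intros)
    have "norm (H (Z n) - S (Z n)) \<le> C / \<bar>\<xi>\<bar> ^ K" for n
    proof -
      have "norm (H (Z n) - S (Z n)) \<le> C / norm (Z n) ^ K"
        using ReZ normZ[of n] \<xi> by (intro bound) auto
      also have "\<dots> \<le> C / \<bar>\<xi>\<bar> ^ K"
        using normZ[of n] \<xi> C by (intro divide_left_mono power_mono mult_pos_pos zero_less_power) auto
      finally show ?thesis .
    qed
    with lim show ?thesis
      by (intro LIMSEQ_le_const2) auto
  qed
  with C show ?thesis unfolding S_def by blast
qed

lemma boundary_asymp_mi0pow:
  assumes m0: "\<forall>j. m j = 0" and cont: "continuous_on {z. 0 \<le> Re z} H"
    and H: "\<And>z. 0 \<le> Re z \<Longrightarrow> eplus p m a w u (\<lambda>x. exp (- complex_of_real x * z)) = H z"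
  shows "\<exists>C. \<forall>\<xi>. 1 \<le> \<bar>\<xi>\<bar> \<longrightarrow> norm (H (\<i> * complex_of_real \<xi>)
      - (\<Sum>j\<le>N. a j 0 * Gamma (p j + 1) * exp (- \<i> * complex_of_real pi * (p j + 1) / 2) * mi0pow \<xi> (- p j - 1)))
      \<le> C * \<bar>\<xi>\<bar> powr (- Re (p (Suc N)) - 1)"
proof -
  define r where "r = - Re (p (Suc N)) - 1"
  define t where "t j \<xi> = a j 0 * Gamma (p j + 1) * exp (- \<i> * complex_of_real pi * (p j + 1) / 2) * mi0pow \<xi> (- p j - 1)" for j \<xi>
  \<comment> \<open>The integer order must exceed the wanted \<open>Re (p (Suc N)) + 1\<close>, and
    \<open>boundary_asymp\<close> grants it only for a sum long enough that
    \<open>Re (p (Suc N'))\<close> exceeds \<open>K\<close>. Requiring \<open>N1\<close> to be at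
    least a successor gives \<open>Suc N' = N1\<close>.\<close>
  obtain K :: nat where K: "- r < real K" using reals_Archimedean2 by blast
  obtain N1 where N1: "max (Suc N0) (Suc N) \<le> N1" "real K < Re (p N1)"
    using Re_p_unbounded by blast
  define N' where "N' = N1 - 1"
  have N': "N0 \<le> N'" "N \<le> N'" "real K < Re (p (Suc N'))"
    using N1 by (auto simp: N'_def)
  obtain C where C: "0 \<le> C" "\<And>\<xi>. 1 \<le> \<bar>\<xi>\<bar> \<Longrightarrow> norm (H (\<i> * complex_of_real \<xi>)
      - (\<Sum>j\<le>N'. a j 0 * Gamma (p j + 1) * (\<i> * complex_of_real \<xi>) powr (- p j - 1))) \<le> C / \<bar>\<xi>\<bar> ^ K"
    using boundary_asymp[OF m0 cont H N'(1,3)] by blast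
  define B where "B j = norm (a j 0 * Gamma (p j + 1) * exp (- \<i> * complex_of_real pi * (p j + 1) / 2))
      * exp (pi * \<bar>Im (- p j - 1)\<bar>)" for j
  \<comment> \<open>Surplus terms are no larger than the claimed error, because the real parts of
    the exponents are nondecreasing and \<open>\<bar>\<xi>\<bar> \<ge> 1\<close>.\<close>
  have t: "norm (t j \<xi>) \<le> B j * \<bar>\<xi>\<bar> powr r" if \<xi>: "1 \<le> \<bar>\<xi>\<bar>" and j: "N < j" for j \<xi>
  proof -
    have "Re (- p j - 1) \<le> r" using Re_p_mono[of "Suc N" j] j by (simp add: r_def)
    then have "\<bar>\<xi>\<bar> powr Re (- p j - 1) \<le> \<bar>\<xi>\<bar> powr r"
      using \<xi> by (intro powr_mono) auto
    then have "norm (mi0pow \<xi> (- p j - 1)) \<le> exp (pi * \<bar>Im (- p j - 1)\<bar>) * \<bar>\<xi>\<bar> powr r"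
      using \<xi> by (intro order.trans[OF norm_mi0pow_le mult_left_mono]) auto
    from mult_left_mono[OF this norm_ge_zero] show ?thesis
      unfolding t_def B_def norm_mult[of _ "mi0pow _ _"] mult.assoc[of "norm _"] .
  qed
  have "norm (H (\<i> * complex_of_real \<xi>) - (\<Sum>j\<le>N. t j \<xi>)) \<le> (C + (\<Sum>j\<in>{N<..N'}. B j)) * \<bar>\<xi>\<bar> powr r"
    if \<xi>: "1 \<le> \<bar>\<xi>\<bar>" for \<xi>
  proof -
    have "a j 0 * Gamma (p j + 1) * (\<i> * complex_of_real \<xi>) powr (- p j - 1) = t j \<xi>" for j
      using \<xi> by (subst ii_powr_eq_mi0pow) (auto simp: t_def mult.assoc)
    then have 1: "norm (H (\<i> * complex_of_real \<xi>) - (\<Sum>j\<le>N'. t j \<xi>)) \<le> C / \<bar>\<xi>\<bar> ^ K"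
      using C(2)[OF \<xi>] by simp
    have "\<bar>\<xi>\<bar> powr (- real K) \<le> \<bar>\<xi>\<bar> powr r"
      using K \<xi> by (intro powr_mono) auto
    then have "inverse (\<bar>\<xi>\<bar> ^ K) \<le> \<bar>\<xi>\<bar> powr r"
      using \<xi> by (simp add: powr_minus powr_realpow)
    from mult_left_mono[OF this C(1)] have 2: "C / \<bar>\<xi>\<bar> ^ K \<le> C * \<bar>\<xi>\<bar> powr r"
      by (simp add: divide_inverse)
    have "{..N'} = {..N} \<union> {N<..N'}" using N' by auto
    moreover have "(\<Sum>j\<in>{..N} \<union> {N<..N'}. t j \<xi>) = (\<Sum>j\<le>N. t j \<xi>) + (\<Sum>j\<in>{N<..N'}. t j \<xi>)"
      by (rule sum.union_disjoint) auto
    ultimately have "(\<Sum>j\<le>N'. t j \<xi>) = (\<Sum>j\<le>N. t j \<xi>) + (\<Sum>j\<in>{N<..N'}. t j \<xi>)"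
      by simp
    then have "H (\<i> * complex_of_real \<xi>) - (\<Sum>j\<le>N. t j \<xi>)
        = (H (\<i> * complex_of_real \<xi>) - (\<Sum>j\<le>N'. t j \<xi>)) + (\<Sum>j\<in>{N<..N'}. t j \<xi>)"
      by simp
    also have "norm \<dots> \<le> C * \<bar>\<xi>\<bar> powr r + (\<Sum>j\<in>{N<..N'}. B j * \<bar>\<xi>\<bar> powr r)"
      using 1 2 t[OF \<xi>]
      by (intro order.trans[OF norm_triangle_ineq] add_mono order.trans[OF norm_sum] sum_mono) auto
    finally show ?thesis
      by (simp add: distrib_right sum_distrib_right)
  qed
  then show ?thesis unfolding t_def r_def by blast
qed

end

theorem mainTheorem10:
  fixes p :: "nat \<Rightarrow> complex" and m :: "nat \<Rightarrow> nat" and mm :: nat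
    and a :: "nat \<Rightarrow> nat \<Rightarrow> complex"
    and w chi :: "real \<Rightarrow> real" and u :: "real \<Rightarrow> complex" and h :: "complex \<Rightarrow> complex"
  assumes "power_set p m mm" and "appropriate p"
    and "cutoff w"
    and "SP p m mm w u a"
    and "Cinf_on UNIV chi" and "\<forall>x. -1 \<le> x \<longrightarrow> chi x = 1" and "\<forall>x. x \<le> -2 \<longrightarrow> chi x = 0"
    and h_def: "\<forall>\<zeta>. Im \<zeta> < 0 \<longrightarrow> h \<zeta> = complex_of_real (1 / sqrt (2 * pi)) *
                 eplus p m a w u (\<lambda>x. chi x *\<^sub>R exp (- \<i> * complex_of_real x * \<zeta>))"
  shows "h holomorphic_on {\<zeta>. Im \<zeta> < 0}
    \<and> (\<forall>\<phi>. schwartz \<phi> \<longrightarrow>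
         ((\<lambda>\<eta>. LBINT \<xi>. h (complex_of_real \<xi> - \<i> * complex_of_real \<eta>) * \<phi> \<xi>)
            \<longlongrightarrow> FT (eplus p m a w u) \<phi>) (at_right 0))
    \<and> (\<exists>C>0. \<exists>M::nat. \<forall>\<zeta>. Im \<zeta> < 0 \<longrightarrow> norm (h \<zeta>) \<le> C * (1 + norm \<zeta>) ^ M)
    \<and> ((\<forall>j. m j = 0) \<longrightarrow>
        (\<exists>g. continuous_on UNIV g
           \<and> (\<forall>\<phi>. schwartz \<phi> \<longrightarrow> FT (eplus p m a w u) \<phi> = (LBINT \<xi>. g \<xi> * \<phi> \<xi>))
           \<and> (\<forall>N. \<exists>C. eventually (\<lambda>\<xi>. norm (g \<xi> - (\<Sum>j\<le>N. a j 0 * Gamma (p j + 1)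
                    / complex_of_real (sqrt (2 * pi))
                    * exp (- \<i> * complex_of_real pi * (p j + 1) / 2) * mi0pow \<xi> (- p j - 1)))
                 \<le> C * \<bar>\<xi>\<bar> powr (- Re (p (Suc N)) - 1)) at_infinity)))"
proof -
  interpret half_line_expansion p m mm a w u
    by (rule half_line_expansion.intro) fact+
  define c where "c = complex_of_real (1 / sqrt (2 * pi))"
  obtain H where Hhol: "H holomorphic_on {z. 0 < Re z}" and Hcont: "continuous_on {z. 0 \<le> Re z} H"
    and Hbound: "\<exists>C>0. \<exists>M::nat. \<forall>z. 0 \<le> Re z \<longrightarrow> norm (H z) \<le> C * (1 + norm z) ^ M"
    and HE: "\<forall>z. 0 \<le> Re z \<longrightarrow> eplus p m a w u (\<lambda>x. exp (- complex_of_real x * z)) = H z"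
    and HFT: "\<forall>\<phi>. schwartz \<phi> \<longrightarrow> FT (eplus p m a w u) \<phi> =
      (LBINT \<xi>. complex_of_real (1 / sqrt (2 * pi)) * H (\<i> * complex_of_real \<xi>) * \<phi> \<xi>)"
    by (rule eplus_exp)
  note HE = HE[rule_format] and HFT = HFT[rule_format, folded c_def]
  obtain C M where C: "0 < C" "\<And>z. 0 \<le> Re z \<Longrightarrow> norm (H z) \<le> C * (1 + norm z) ^ (M::nat)"
    using Hbound by blast
  \<comment> \<open>Multiplication by \<open>\<i>\<close> turns the half-plane
    \<open>Im \<zeta> < 0\<close> into \<open>Re z > 0\<close>.\<close>
  have h: "h \<zeta> = c * H (\<i> * \<zeta>)" if "Im \<zeta> < 0" for \<zeta>
  proof -
    have "eplus p m a w u (\<lambda>x. chi x *\<^sub>R exp (- \<i> * complex_of_real x * \<zeta>))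
        = eplus p m a w u (\<lambda>x. exp (- complex_of_real x * (\<i> * \<zeta>)))"
      using assms(6) by (intro eplus_cong) (simp add: mult_ac)
    then show ?thesis
      using h_def[rule_format, OF that] HE[of "\<i> * \<zeta>"] that by (simp add: c_def)
  qed
  have "h holomorphic_on {\<zeta>. Im \<zeta> < 0}"
  proof (rule holomorphic_transform)
    have "(H \<circ> (\<lambda>\<zeta>. \<i> * \<zeta>)) holomorphic_on {\<zeta>. Im \<zeta> < 0}"
      by (rule holomorphic_on_compose) (auto intro!: holomorphic_intros holomorphic_on_subset[OF Hhol])
    then show "(\<lambda>\<zeta>. c * H (\<i> * \<zeta>)) holomorphic_on {\<zeta>. Im \<zeta> < 0}"
      unfolding o_def by (intro holomorphic_intros)
  qed (simp add: h)
  moreover have "((\<lambda>\<eta>. LBINT \<xi>. h (complex_of_real \<xi> - \<i> * complex_of_real \<eta>) * \<phi> \<xi>)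
            \<longlongrightarrow> FT (eplus p m a w u) \<phi>) (at_right 0)" if \<phi>: "schwartz \<phi>" for \<phi>
    unfolding HFT[OF \<phi>]
  proof (rule Lim_transform_eventually[OF boundary_value_tendsto[OF Hcont C(2,1) \<phi>]])
    show "\<forall>\<^sub>F \<eta> in at_right 0. (LBINT \<xi>. c * H (complex_of_real \<eta> + \<i> * complex_of_real \<xi>) * \<phi> \<xi>)
        = (LBINT \<xi>. h (complex_of_real \<xi> - \<i> * complex_of_real \<eta>) * \<phi> \<xi>)"
      using eventually_at_right_less[of "0::real"]
    proof eventually_elim
      case (elim \<eta>)
      \<comment> \<open>Rotating the point \<open>\<xi> - \<i> * \<eta>\<close> by
        \<open>\<i>\<close> gives \<open>\<eta> + \<i> * \<xi>\<close>, the form used in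
        \<open>boundary_value_tendsto\<close>.\<close>
      have "h (complex_of_real \<xi> - \<i> * complex_of_real \<eta>) = c * H (complex_of_real \<eta> + \<i> * complex_of_real \<xi>)" for \<xi>
        using elim by (subst h) (auto simp: algebra_simps)
      then show ?case by simp
    qed
  qed
  moreover have "\<exists>C>0. \<exists>M::nat. \<forall>\<zeta>. Im \<zeta> < 0 \<longrightarrow> norm (h \<zeta>) \<le> C * (1 + norm \<zeta>) ^ M"
  proof (intro exI[of _ "norm c * C"] exI[of _ M] conjI allI impI)
    show "0 < norm c * C" using C(1) by (simp add: c_def)
    show "norm (h \<zeta>) \<le> norm c * C * (1 + norm \<zeta>) ^ M" if "Im \<zeta> < 0" for \<zeta>
      using mult_left_mono[OF C(2)[of "\<i> * \<zeta>"] norm_ge_zero[of c]] that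
      by (simp add: h norm_mult mult.assoc)
  qed
  moreover have "\<exists>g. continuous_on UNIV g
           \<and> (\<forall>\<phi>. schwartz \<phi> \<longrightarrow> FT (eplus p m a w u) \<phi> = (LBINT \<xi>. g \<xi> * \<phi> \<xi>))
           \<and> (\<forall>N. \<exists>C. eventually (\<lambda>\<xi>. norm (g \<xi> - (\<Sum>j\<le>N. a j 0 * Gamma (p j + 1)
                    / complex_of_real (sqrt (2 * pi))
                    * exp (- \<i> * complex_of_real pi * (p j + 1) / 2) * mi0pow \<xi> (- p j - 1)))
                 \<le> C * \<bar>\<xi>\<bar> powr (- Re (p (Suc N)) - 1)) at_infinity)" if m0: "\<forall>j. m j = 0"
  \<comment> \<open>The witness is the continuous boundary value of \<open>h\<close> on the real
    line.\<close>
  proof (intro exI[of _ "\<lambda>\<xi>. c * H (\<i> * complex_of_real \<xi>)"] conjI allI impI)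
    have "continuous_on UNIV (H \<circ> (\<lambda>\<xi>. \<i> * complex_of_real \<xi>))"
      by (intro continuous_on_compose continuous_intros continuous_on_subset[OF Hcont]) auto
    then show "continuous_on UNIV (\<lambda>\<xi>. c * H (\<i> * complex_of_real \<xi>))"
      unfolding o_def by (intro continuous_intros)
    show "FT (eplus p m a w u) \<phi> = (LBINT \<xi>. c * H (\<i> * complex_of_real \<xi>) * \<phi> \<xi>)" if "schwartz \<phi>" for \<phi>
      by (rule HFT[OF that])
    fix N
    obtain B where B: "\<forall>\<xi>. 1 \<le> \<bar>\<xi>\<bar> \<longrightarrow> norm (H (\<i> * complex_of_real \<xi>)
        - (\<Sum>j\<le>N. a j 0 * Gamma (p j + 1) * exp (- \<i> * complex_of_real pi * (p j + 1) / 2) * mi0pow \<xi> (- p j - 1)))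
        \<le> B * \<bar>\<xi>\<bar> powr (- Re (p (Suc N)) - 1)"
      using boundary_asymp_mi0pow[OF m0 Hcont HE, of N] by blast
    have "norm (c * H (\<i> * complex_of_real \<xi>) - (\<Sum>j\<le>N. a j 0 * Gamma (p j + 1) / complex_of_real (sqrt (2 * pi))
        * exp (- \<i> * complex_of_real pi * (p j + 1) / 2) * mi0pow \<xi> (- p j - 1)))
        \<le> norm c * B * \<bar>\<xi>\<bar> powr (- Re (p (Suc N)) - 1)" if \<xi>: "1 \<le> norm \<xi>" for \<xi> :: real
    proof -
      have "c * H (\<i> * complex_of_real \<xi>) - (\<Sum>j\<le>N. a j 0 * Gamma (p j + 1) / complex_of_real (sqrt (2 * pi))
        * exp (- \<i> * complex_of_real pi * (p j + 1) / 2) * mi0pow \<xi> (- p j - 1))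
        = c * (H (\<i> * complex_of_real \<xi>) - (\<Sum>j\<le>N. a j 0 * Gamma (p j + 1)
        * exp (- \<i> * complex_of_real pi * (p j + 1) / 2) * mi0pow \<xi> (- p j - 1)))"
        unfolding right_diff_distrib sum_distrib_left c_def of_real_divide of_real_1
        by (simp only: times_divide_eq_left times_divide_eq_right mult_1)
      then show ?thesis
        using mult_left_mono[OF B[rule_format, of \<xi>] norm_ge_zero[of c]] \<xi>
        by (simp add: norm_mult mult.assoc)
    qed
    then show "\<exists>C. eventually (\<lambda>\<xi>. norm (c * H (\<i> * complex_of_real \<xi>) - (\<Sum>j\<le>N. a j 0 * Gamma (p j + 1)
                    / complex_of_real (sqrt (2 * pi))
                    * exp (- \<i> * complex_of_real pi * (p j + 1) / 2) * mi0pow \<xi> (- p j - 1)))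
                 \<le> C * \<bar>\<xi>\<bar> powr (- Re (p (Suc N)) - 1)) at_infinity"
      unfolding eventually_at_infinity by blast
  qed
  ultimately show ?thesis by blast
qed

end
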